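(* Let $\mathcal{C}=(C_1,\dots,C_m)$ be a collection of $m\ge 3$ pinhole cameras with distinct centers, where no three centers are collinear. 1. If $m \geq 4$ and the cameras are not coplanar, then $\mathcal{L}_{\mathcal{C}}$ is smooth. 2. If the cameras are coplanar, then $\mathcal{L}_{\mathcal{C}}$ has exactly one singular point, which is the image under $\Upsilon_{\mathcal C}$ of any line in the plane spanned by the camera centers (at which $\Upsilon_{\mathcal C}$ is defined, i.e. passing through no camera center).
   Context: All projective spaces are complex. A pinhole camera is a full-rank matrix $C\in\mathbb C^{3\times 4}$; its center is the point $c=\ker(C)\in\mathbb P^3$. Let $\mathbb G$ be the Grassmannian of lines in $\mathbb P^3$. A line in $\mathbb P^2$ is identified with its linear equation $\ell\in\mathbb P^2$: a point $x$ is on the line if and only if $x^T\ell=0$. For a line $L\subset\mathbb P^3$ through points $x,y$ and not through the center of $C$, $C\cdot L$ denotes the line in $\mathbb P^2$ through $Cx$ and $Cy$. The joint camera map is the rational map $\Upsilon_{\mathcal C}:\mathbb G\dashrightarrow(\mathbb P^2)^m$, $L\mapsto (C_1\cdot L,\dots,C_m\cdot L)$, defined at the lines that pass through no camera center $c_i=\ker(C_i)$; $\Upsilon_{\mathcal C}(\mathbb G)$ denotes its image. The line multiview variety is the Zariski closure $\mathcal L_{\mathcal C}:=\overline{\Upsilon_{\mathcal C}(\mathbb G)}\subseteq(\mathbb P^2)^m$. Centers are collinear if they lie on a common line; the cameras are coplanar if all centers $c_1,\dots,c_m$ lie in a common plane in $\mathbb P^3$. *)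

theory Defs
  imports "HOL-Analysis.Analysis" "HOL-Library.Poly_Mapping"
begin

section \<open>Projective spaces, lines and cameras\<close>

text \<open>
  A projective flat is represented by the linear subspace above it: a point of
  \<open>P(complex^'n)\<close> is a one-dimensional subspace of \<open>complex^'n\<close>, a line is a two-dimensional one,
  a plane is a three-dimensional one, and incidence is inclusion.
\<close>

definition proj_flats :: "nat \<Rightarrow> (complex^'n) set set" where
  "proj_flats k = {V. vec.subspace V \<and> vec.dim V = k + 1}"

abbreviation proj_points :: "(complex^'n) set set" where
  "proj_points \<equiv> proj_flats 0"

abbreviation proj_lines :: "(complex^'n) set set" where
  "proj_lines \<equiv> proj_flats 1"

abbreviation proj_planes :: "(complex^'n) set set" where
  "proj_planes \<equiv> proj_flats 2"

definition pinhole_camera :: "complex^4^3 \<Rightarrow> bool" where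
  "pinhole_camera C \<longleftrightarrow> rank C = 3"

definition center :: "complex^4^3 \<Rightarrow> (complex^4) set" where
  "center C = {x. C *v x = 0}"

text \<open>The linear equations of a flat; for a line in the projective plane they form a point of
  the projective plane. The pairing is bilinear (no complex conjugation).\<close>

definition linear_equation :: "(complex^'n) set \<Rightarrow> (complex^'n) set" where
  "linear_equation V = {l. \<forall>x\<in>V. (\<Sum>j\<in>UNIV. x $ j * l $ j) = 0}"

text \<open>If \<open>L\<close> avoids the center of \<open>C\<close>, then \<open>(*v) C ` L\<close> is the line through the images of any
  two distinct points of \<open>L\<close>.\<close>

definition camera_line :: "complex^4^3 \<Rightarrow> (complex^4) set \<Rightarrow> (complex^3) set" where
  "camera_line C L = linear_equation ((*v) C ` L)"

text \<open>Only the values of \<open>joint_camera_map C\<close> on \<open>camera_domain C\<close> are meaningful.\<close>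

definition camera_domain :: "('m \<Rightarrow> complex^4^3) \<Rightarrow> (complex^4) set set" where
  "camera_domain C = {L \<in> proj_lines. \<forall>i. \<not> center (C i) \<subseteq> L}"

definition joint_camera_map ::
  "('m \<Rightarrow> complex^4^3) \<Rightarrow> (complex^4) set \<Rightarrow> ('m \<Rightarrow> (complex^3) set)" where
  "joint_camera_map C L = (\<lambda>i. camera_line (C i) L)"

definition flat_collinear :: "(complex^'n) set set \<Rightarrow> bool" where
  "flat_collinear P \<longleftrightarrow> (\<exists>L\<in>proj_lines. \<forall>p\<in>P. p \<subseteq> L)"

definition coplanar_cameras :: "('m \<Rightarrow> complex^4^3) \<Rightarrow> bool" where
  "coplanar_cameras C \<longleftrightarrow> (\<exists>H\<in>proj_planes. \<forall>i. center (C i) \<subseteq> H)"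


section \<open>Closed subsets of products of projective spaces\<close>

text \<open>A polynomial on the product of the spaces \<open>complex^'n\<close>, one for each \<open>i :: 'm\<close>; its
  variables are indexed by pairs of a factor and a coordinate.\<close>

type_synonym ('m, 'n) mpoly = "(('m \<times> 'n \<Rightarrow>\<^sub>0 nat) \<Rightarrow>\<^sub>0 complex)"

definition mpoly_eval :: "('m::finite, 'n::finite) mpoly \<Rightarrow> complex^('m \<times> 'n) \<Rightarrow> complex" where
  "mpoly_eval f x = (\<Sum>\<mu>\<in>Poly_Mapping.keys f. Poly_Mapping.lookup f \<mu> *
      (\<Prod>k\<in>UNIV. (x $ k) ^ Poly_Mapping.lookup \<mu> k))"

definition multihomogeneous :: "('m::finite, 'n::finite) mpoly \<Rightarrow> bool" where
  "multihomogeneous f \<longleftrightarrow> (\<exists>d :: 'm \<Rightarrow> nat. \<forall>\<mu>\<in>Poly_Mapping.keys f. \<forall>i.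
      (\<Sum>j\<in>UNIV. Poly_Mapping.lookup \<mu> (i, j)) = d i)"

definition multi_points :: "('m \<Rightarrow> (complex^'n) set) set" where
  "multi_points = {p. \<forall>i. p i \<in> proj_points}"

definition homogeneous_coords ::
  "('m::finite \<Rightarrow> (complex^'n::finite) set) \<Rightarrow> (complex^('m \<times> 'n)) set" where
  "homogeneous_coords p = {x. \<forall>i. (\<chi> j. x $ (i, j)) \<in> p i - {0}}"

definition vanishes_at ::
  "('m::finite, 'n::finite) mpoly \<Rightarrow> ('m \<Rightarrow> (complex^'n) set) \<Rightarrow> bool" where
  "vanishes_at f p \<longleftrightarrow> (\<forall>x\<in>homogeneous_coords p. mpoly_eval f x = 0)"

definition zariski_closed :: "('m::finite \<Rightarrow> (complex^'n::finite) set) set \<Rightarrow> bool" where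
  "zariski_closed Z \<longleftrightarrow> (\<exists>F. (\<forall>f\<in>F. multihomogeneous f) \<and>
      Z = {p \<in> multi_points. \<forall>f\<in>F. vanishes_at f p})"

definition irreducible_closed :: "('m::finite \<Rightarrow> (complex^'n::finite) set) set \<Rightarrow> bool" where
  "irreducible_closed Z \<longleftrightarrow> zariski_closed Z \<and> Z \<noteq> {} \<and>
      (\<forall>A B. zariski_closed A \<longrightarrow> zariski_closed B \<longrightarrow> Z = A \<union> B \<longrightarrow> Z = A \<or> Z = B)"

definition krull_dim :: "('m::finite \<Rightarrow> (complex^'n::finite) set) set \<Rightarrow> enat" where
  "krull_dim X = Sup {enat n | n. \<exists>W. (\<forall>k\<le>n. irreducible_closed (W k) \<and> W k \<subseteq> X) \<and>
      (\<forall>k<n. W k \<subset> W (Suc k))}"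

text \<open>The largest dimension of an irreducible component through \<open>p\<close>.\<close>

definition local_dim ::
  "('m::finite \<Rightarrow> (complex^'n::finite) set) set \<Rightarrow> ('m \<Rightarrow> (complex^'n) set) \<Rightarrow> enat" where
  "local_dim X p = Sup {krull_dim Z | Z. irreducible_closed Z \<and> Z \<subseteq> X \<and> p \<in> Z}"


section \<open>Smooth and singular points\<close>

text \<open>The multihomogeneous elements of the vanishing ideal; they generate it.\<close>

definition vanishing_polys ::
  "('m::finite \<Rightarrow> (complex^'n::finite) set) set \<Rightarrow> ('m, 'n) mpoly set" where
  "vanishing_polys X = {f. multihomogeneous f \<and> (\<forall>p\<in>X. vanishes_at f p)}"

text \<open>The Zariski tangent space at \<open>x\<close> of the multicone over \<open>X\<close>: the common kernel of the
  differentials at \<open>x\<close> of the polynomials that vanish on \<open>X\<close>.\<close>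

definition cone_tangent_space ::
  "('m::finite \<Rightarrow> (complex^'n::finite) set) set \<Rightarrow> complex^('m \<times> 'n) \<Rightarrow> (complex^('m \<times> 'n)) set"
  where
  "cone_tangent_space X x =
     {v. \<forall>f\<in>vanishing_polys X. deriv (\<lambda>t. mpoly_eval f (x + t *s v)) 0 = 0}"

text \<open>
  The Zariski tangent space of \<open>X\<close> at \<open>p\<close> is the quotient of \<open>cone_tangent_space X x\<close>, for
  homogeneous coordinates \<open>x\<close> of \<open>p\<close>, by the directions in which the factors of \<open>x\<close> are rescaled.
  These directions span a subspace of dimension \<open>CARD('m)\<close>. A point is smooth if the dimension
  of this quotient is the dimension of \<open>X\<close> at the point. The condition does not depend on the
  choice of \<open>x\<close>.
\<close>

definition smooth_at ::
  "('m::finite \<Rightarrow> (complex^'n::finite) set) set \<Rightarrow> ('m \<Rightarrow> (complex^'n) set) \<Rightarrow> bool" where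
  "smooth_at X p \<longleftrightarrow> (\<forall>x\<in>homogeneous_coords p.
      enat (vec.dim (cone_tangent_space X x)) = local_dim X p + enat CARD('m))"

definition singular_points ::
  "('m::finite \<Rightarrow> (complex^'n::finite) set) set \<Rightarrow> ('m \<Rightarrow> (complex^'n) set) set" where
  "singular_points X = {p \<in> X. \<not> smooth_at X p}"

definition smooth_variety :: "('m::finite \<Rightarrow> (complex^'n::finite) set) set \<Rightarrow> bool" where
  "smooth_variety X \<longleftrightarrow> (\<forall>p\<in>X. smooth_at X p)"


section \<open>The line multiview variety\<close>

definition line_multiview_variety ::
  "('m::finite \<Rightarrow> complex^4^3) \<Rightarrow> ('m \<Rightarrow> (complex^3) set) set" where
  "line_multiview_variety C = zariski_closed hull (joint_camera_map C ` camera_domain C)"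

end

theory Submission
  imports Defs
begin

text \<open>
  Let \<open>e i\<close> span the kernel of \<open>C i\<close>, and let \<open>m\<close> be the number of cameras. The image in camera \<open>i\<close>
  of the line through \<open>x\<close> and \<open>y\<close> has the equation \<open>C i x \<times> C i y\<close>, so the joint camera map is polynomial
  in \<open>(x, y)\<close> (\<open>Psi\<close>). An image line with equation \<open>l i\<close> is the image of every line in its
  back-projected plane \<open>{z. l i \<bullet> C i z = 0}\<close>, which contains the center \<open>e i\<close>. The planes
  obtained from one line all contain that line, so their equations span a space of dimension at most
  two, and the 3 by 3 minors (\<open>minor3\<close>) of these linear forms vanish on the variety \<open>X\<close>.

  The local dimension of \<open>X\<close> is 4 at every point. The closure of a polynomial image is irreducible
  (\<open>irreducible_param\<close>), so the local dimension is the Krull dimension. Generic lines lie in an affine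
  chart with four parameters. If \<open>W 0 \<subset> \<dots> \<subset> W n\<close> is a chain of irreducible closed sets and \<open>f k\<close>
  vanishes on \<open>W k\<close> but not on \<open>W (k + 1)\<close>, then the monomials in the \<open>f k\<close> are linearly independent
  on \<open>W n\<close> (\<open>chain_growth\<close>). There are \<open>(N + 1)^n\<close> of them with all exponents at most \<open>N\<close>, and in the
  chart they become polynomials in four variables of degree \<open>O(N)\<close>, which span a space of dimension
  \<open>O(N^4)\<close>; hence \<open>n \<le> 4\<close>. A chain of length four arises by letting the parameters vary one by one.

  Smoothness at a point therefore means that the tangent space of the multicone has dimension
  \<open>m + 4\<close>. Suppose first that two of the planes at the point differ; they meet in a line \<open>L\<close>.
  The differentials of the minors express the restriction to \<open>L\<close> of the velocity of each further plane
  by the velocities of these two. These are \<open>2 (m - 2)\<close> linear conditions, and they are independent because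
  \<open>L\<close> contains at most two centers; so the dimension is at most \<open>m + 4\<close> (\<open>dim_tangent_le\<close>). It is
  at least \<open>m + 4\<close> at the image of a line that avoids all centers, since there the parametrisation has an
  injective differential (\<open>dim_tangent_generic_ge\<close>). Every other such point, where \<open>L\<close> passes through
  one or two centers, is a limit of points of that kind, and the dimension of the tangent space can only
  jump up in the limit (\<open>dim_tangent_semicontinuous\<close>, \<open>dim_tangent_ge\<close>).

  If all planes at the point coincide, the common plane contains all centers. So the centers are coplanar,
  and the point is determined by their plane: it is the image of every line of that plane. Each of
  these lines can be tilted out of the plane, which gives a tangent vector at the same point, and together
  these vectors fill a space of dimension at least \<open>m + 6\<close> (\<open>dim_tangent_singular_pt\<close>). The point is singular.
\<close>

section \<open>Linear algebra over the complex numbers\<close>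

lemma homogeneous_system_nontrivial_solution:
  fixes a :: "'j \<Rightarrow> 's \<Rightarrow> 'a::field"
  assumes "finite S" "finite J" "card S < card J"
  shows "\<exists>c. (\<exists>j\<in>J. c j \<noteq> 0) \<and> (\<forall>s\<in>S. (\<Sum>j\<in>J. c j * a j s) = 0)"
  using assms
proof (induction S arbitrary: J a rule: finite_induct)
  case empty
  then have "J \<noteq> {}" by auto
  then show ?case by (intro exI[of _ "\<lambda>_. 1"] conjI) auto
next
  case (insert s S)
  show ?case
  proof (cases "\<exists>p\<in>J. a p s \<noteq> 0")
    case False
    have "card S < card J" using insert by simp
    from insert.IH[OF insert.prems(1) this, of a] obtain c where
      c: "\<exists>j\<in>J. c j \<noteq> 0" "\<forall>s\<in>S. (\<Sum>j\<in>J. c j * a j s) = 0" by blast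
    have "(\<Sum>j\<in>J. c j * a j s) = 0" using False by (intro sum.neutral) auto
    with c show ?thesis by blast
  next
    case True
    then obtain p where p: "p \<in> J" "a p s \<noteq> 0" by blast
    define J' where "J' = J - {p}"
    have J': "finite J'" "card S < card J'" "J = insert p J'" "p \<notin> J'"
      using insert p by (auto simp: J'_def)
    from insert.IH[OF J'(1,2), of "\<lambda>j r. a j r - a j s / a p s * a p r"] obtain c where
      c: "\<exists>j\<in>J'. c j \<noteq> 0"
        "\<And>r. r \<in> S \<Longrightarrow> (\<Sum>j\<in>J'. c j * (a j r - a j s / a p s * a p r)) = 0" by blast
    define c' where "c' = (\<lambda>j. if j = p then - (\<Sum>j\<in>J'. c j * a j s) / a p s else c j)"
    have s: "(\<Sum>j\<in>J. c' j * a j r) = - (\<Sum>j\<in>J'. c j * a j s) / a p s * a p r + (\<Sum>j\<in>J'. c j * a j r)" for r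
    proof -
      have "(\<Sum>j\<in>J'. c' j * a j r) = (\<Sum>j\<in>J'. c j * a j r)"
        using J'(4) by (intro sum.cong) (auto simp: c'_def)
      then show ?thesis using J' by (simp add: c'_def)
    qed
    have "(\<Sum>j\<in>J. c' j * a j r) = 0" if "r \<in> insert s S" for r
    proof (cases "r = s")
      case True
      then show ?thesis using p by (simp add: s)
    next
      case False
      have "(\<Sum>j\<in>J'. c j * (a j r - a j s / a p s * a p r))
         = (\<Sum>j\<in>J'. c j * a j r) - (\<Sum>j\<in>J'. c j * a j s) / a p s * a p r"
        by (simp add: right_diff_distrib sum_subtractf sum_distrib_right sum_divide_distrib mult.assoc)
      then show ?thesis using c(2)[of r] that False by (simp add: s)
    qed
    moreover have "\<exists>j\<in>J. c' j \<noteq> 0" using c(1) J' by (auto simp: c'_def)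
    ultimately show ?thesis by blast
  qed
qed

lemma card_le_dim_independent_family:
  fixes g :: "'j \<Rightarrow> complex^'n"
  assumes fin: "finite J" and sub: "vec.subspace T" and gT: "\<And>j. j \<in> J \<Longrightarrow> g j \<in> T"
    and indep: "\<And>t. (\<Sum>j\<in>J. t j *s g j) = 0 \<Longrightarrow> \<forall>j\<in>J. t j = 0"
  shows "card J \<le> vec.dim T"
proof (rule ccontr)
  assume "\<not> card J \<le> vec.dim T"
  moreover obtain B where B: "B \<subseteq> T" "vec.independent B" "T \<subseteq> vec.span B" "card B = vec.dim T"
    using vec.basis_exists by blast
  ultimately have lt: "card B < card J" by simp
  have fB: "finite B" using B(2) by (rule vec.finiteI_independent)
  have "\<exists>a. \<forall>j\<in>J. g j = (\<Sum>b\<in>B. a j b *s b)"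
  proof -
    have "\<exists>u. g j = (\<Sum>b\<in>B. u b *s b)" if "j \<in> J" for j
      using gT[OF that] B(3) vec.span_finite[OF fB] by auto
    then show ?thesis by metis
  qed
  then obtain a where a: "\<And>j. j \<in> J \<Longrightarrow> g j = (\<Sum>b\<in>B. a j b *s b)" by blast
  obtain c where c: "\<exists>j\<in>J. c j \<noteq> 0" "\<And>b. b \<in> B \<Longrightarrow> (\<Sum>j\<in>J. c j * a j b) = 0"
    using homogeneous_system_nontrivial_solution[OF fB fin lt, of a] by blast
  have "(\<Sum>j\<in>J. c j *s g j) = (\<Sum>j\<in>J. \<Sum>b\<in>B. (c j * a j b) *s b)"
    by (intro sum.cong) (simp_all add: a vec.scale_sum_right)
  also have "\<dots> = (\<Sum>b\<in>B. (\<Sum>j\<in>J. c j * a j b) *s b)"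
    by (subst sum.swap) (simp add: vec.scale_sum_left)
  also have "\<dots> = 0" using c(2) by (intro sum.neutral) auto
  finally show False using indep c(1) by blast
qed

lemma scaleR_eq_scale: "t *\<^sub>R w = complex_of_real t *s (w :: complex^'k)"
  unfolding vec_eq_iff by (simp add: scaleR_conv_of_real[where 'a = complex])

text \<open>The pairing between points and equations, without complex conjugation, as in \<open>linear_equation\<close>.\<close>

definition bil :: "complex^'n \<Rightarrow> complex^'n \<Rightarrow> complex" where
  "bil u v = (\<Sum>j\<in>UNIV. u $ j * v $ j)"

lemma bil_simps [simp]:
  "bil (u + v) w = bil u w + bil v w" "bil u (v + w) = bil u v + bil u w"
  "bil (u - v) w = bil u w - bil v w" "bil u (v - w) = bil u v - bil u w"
  "bil (c *s u) v = c * bil u v" "bil u (c *s v) = c * bil u v"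
  "bil 0 v = 0" "bil u 0 = 0" "bil (-u) v = - bil u v" "bil u (-v) = - bil u v"
  by (simp_all add: bil_def sum.distrib distrib_left distrib_right left_diff_distrib
      right_diff_distrib sum_distrib_left mult.assoc mult.left_commute sum_subtractf sum_negf)

lemma bil_commute: "bil u v = bil v u"
  by (simp add: bil_def mult.commute)

lemma bil_sum_left: "bil (sum f A) v = (\<Sum>a\<in>A. bil (f a) v)"
  by (induction A rule: infinite_finite_induct) auto

lemma bil_axis: "bil u (axis k c) = u $ k * c"
proof -
  have "bil u (axis k c) = (\<Sum>j\<in>UNIV. if j = k then u $ j * c else 0)"
    unfolding bil_def by (intro sum.cong) (auto simp: axis_def)
  then show ?thesis by simp
qed

lemma bil_eq_0_imp_eq_0: "(\<And>v. bil u v = 0) \<Longrightarrow> u = 0"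
  using bil_axis[of u _ 1] by (simp add: vec_eq_iff)

lemma dim_span_pair:
  fixes x y :: "complex^'n"
  assumes "\<And>p q. p *s x + q *s y = 0 \<Longrightarrow> p = 0 \<and> q = 0"
  shows "vec.independent {x, y}" "card {x, y} = 2" "vec.dim (vec.span {x, y}) = 2"
proof -
  have y: "y \<noteq> 0" using assms[of 0 1] by auto
  have x: "x \<notin> vec.span {y}"
  proof
    assume "x \<in> vec.span {y}"
    then obtain k where "x = k *s y" by (auto simp: vec.span_singleton)
    then show False using assms[of 1 "-k"] by simp
  qed
  then have "x \<noteq> y" using vec.span_base[of y "{y}"] by auto
  then show "vec.independent {x, y}" "card {x, y} = 2" using x y by (simp_all add: vec.independent_insert)
  then show "vec.dim (vec.span {x, y}) = 2" by (simp add: vec.dim_eq_card_independent)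
qed

text \<open>The bilinear pairing has isotropic vectors, so the span of the \<open>g j\<close> may meet their common kernel.
  The span of the conjugates of the \<open>g j\<close> does not, because the hermitian product is definite.\<close>

lemma dim_common_kernel_le:
  fixes g :: "'j \<Rightarrow> complex^'n"
  assumes fin: "finite J"
    and indep: "\<And>t. (\<Sum>j\<in>J. t j *s g j) = 0 \<Longrightarrow> \<forall>j\<in>J. t j = 0"
  shows "vec.dim {v. \<forall>j\<in>J. bil (g j) v = 0} + card J \<le> CARD('n)"
proof -
  define V where "V = {v. \<forall>j\<in>J. bil (g j) v = 0}"
  define conj :: "complex^'n \<Rightarrow> complex^'n" where "conj = (\<lambda>u. \<chi> k. cnj (u $ k))"
  define U where "U = vec.span (conj ` g ` J)"
  have conj_sum: "conj (\<Sum>j\<in>A. t j *s u j) = (\<Sum>j\<in>A. cnj (t j) *s conj (u j))" for t and u :: "'a \<Rightarrow> complex^'n" and A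
    by (simp add: conj_def vec_eq_iff)
  have conj_conj: "conj (conj u) = u" for u by (simp add: conj_def)
  have sV: "vec.subspace V"
    by (auto simp: V_def vec.subspace_def)
  have sU: "vec.subspace U" by (simp add: U_def vec.subspace_span)
  have "card J \<le> vec.dim U"
  proof (rule card_le_dim_independent_family[OF fin sU, of "\<lambda>j. conj (g j)"])
    show "conj (g j) \<in> U" if "j \<in> J" for j using that by (simp add: U_def vec.span_base)
    fix t assume "(\<Sum>j\<in>J. t j *s conj (g j)) = 0"
    then have "conj (\<Sum>j\<in>J. t j *s conj (g j)) = 0" by (simp add: conj_def vec_eq_iff)
    then have "(\<Sum>j\<in>J. cnj (t j) *s g j) = 0" by (simp add: conj_sum conj_conj)
    then show "\<forall>j\<in>J. t j = 0" using indep[of "\<lambda>j. cnj (t j)"] by simp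
  qed
  moreover have "V \<inter> U \<subseteq> {0}"
  proof
    fix u assume u: "u \<in> V \<inter> U"
    have "finite (conj ` g ` J)" using fin by blast
    then obtain t where t: "u = (\<Sum>b\<in>conj ` g ` J. t b *s b)"
      using u unfolding U_def by (auto simp: vec.span_finite)
    have "bil (conj u) u = (\<Sum>b\<in>conj ` g ` J. cnj (t b) * bil (conj b) u)"
      by (subst t) (simp add: conj_sum bil_sum_left)
    also have "\<dots> = 0" using u by (intro sum.neutral) (auto simp: V_def conj_conj)
    finally have "(\<Sum>k\<in>UNIV. cnj (u $ k) * u $ k) = 0" by (simp add: bil_def conj_def)
    then have "(\<Sum>k\<in>UNIV. of_real ((cmod (u $ k))\<^sup>2)) = (0::complex)"
      by (simp only: complex_norm_square mult.commute)
    then have "(\<Sum>k\<in>UNIV. (cmod (u $ k))\<^sup>2) = 0"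
      by (metis of_real_eq_0_iff of_real_sum)
    then have "\<forall>k. u $ k = 0" by (subst (asm) sum_nonneg_eq_0_iff) auto
    then show "u \<in> {0}" by (simp add: vec_eq_iff)
  qed
  then have "vec.dim (V \<inter> U) = 0" by (simp add: vec.dim_eq_0)
  moreover have "vec.dim {x + y |x y. x \<in> V \<and> y \<in> U} \<le> CARD('n)"
    using dim_subset_UNIV_cart_gen by blast
  ultimately show ?thesis
    using vec.dim_sums_Int[OF sV sU] unfolding V_def[symmetric] by linarith
qed

section \<open>Polynomial functions\<close>

definition monomial_fun :: "('k::finite \<Rightarrow> nat) \<Rightarrow> complex^'k \<Rightarrow> complex" where
  "monomial_fun \<mu> x = (\<Prod>k\<in>UNIV. (x $ k) ^ \<mu> k)"

text \<open>Polynomials are treated as functions: products and pullbacks are then pointwise. The set \<open>S\<close> of allowed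
  exponents records bounds on the degree.\<close>

inductive_set poly_fun :: "('k::finite \<Rightarrow> nat) set \<Rightarrow> (complex^'k \<Rightarrow> complex) set" for S where
  zero: "(\<lambda>_. 0) \<in> poly_fun S"
| step: "\<mu> \<in> S \<Longrightarrow> f \<in> poly_fun S \<Longrightarrow> (\<lambda>x. c * monomial_fun \<mu> x + f x) \<in> poly_fun S"

lemma poly_fun_add: "f \<in> poly_fun S \<Longrightarrow> g \<in> poly_fun S \<Longrightarrow> (\<lambda>x. f x + g x) \<in> poly_fun S"
  by (induction rule: poly_fun.induct) (auto simp: add.assoc intro: poly_fun.intros)

lemma poly_fun_scale: "f \<in> poly_fun S \<Longrightarrow> (\<lambda>x. c * f x) \<in> poly_fun S"
proof (induction rule: poly_fun.induct)
  case zero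
  then show ?case by (simp add: poly_fun.zero)
next
  case (step \<mu> f d)
  from poly_fun.step[OF step(1) step(3), of "c * d"] show ?case by (simp add: algebra_simps)
qed

lemma poly_fun_monomial: "\<mu> \<in> S \<Longrightarrow> monomial_fun \<mu> \<in> poly_fun S"
  using poly_fun.step[OF _ poly_fun.zero, of \<mu> S 1] by simp

lemma poly_fun_sum: "(\<And>i. i \<in> I \<Longrightarrow> f i \<in> poly_fun S) \<Longrightarrow> (\<lambda>x. \<Sum>i\<in>I. f i x) \<in> poly_fun S"
  by (induction I rule: infinite_finite_induct) (auto intro: poly_fun.zero poly_fun_add)

lemma monomial_fun_add: "monomial_fun (\<lambda>k. \<mu> k + \<nu> k) x = monomial_fun \<mu> x * monomial_fun \<nu> x"
  by (simp add: monomial_fun_def power_add prod.distrib)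

lemma poly_fun_mult:
  assumes "f \<in> poly_fun S" "g \<in> poly_fun T" and "\<And>\<mu> \<nu>. \<mu> \<in> S \<Longrightarrow> \<nu> \<in> T \<Longrightarrow> (\<lambda>k. \<mu> k + \<nu> k) \<in> R"
  shows "(\<lambda>x. f x * g x) \<in> poly_fun R"
  using assms(1)
proof (induction rule: poly_fun.induct)
  case zero
  then show ?case by (simp add: poly_fun.zero)
next
  case (step \<mu> f c)
  have "(\<lambda>x. c * monomial_fun \<mu> x * g x) \<in> poly_fun R"
    using assms(2)
  proof (induction rule: poly_fun.induct)
    case zero
    then show ?case by (simp add: poly_fun.zero)
  next
    case (step \<nu> g d)
    from poly_fun.step[OF assms(3)[OF \<open>\<mu> \<in> S\<close> step(1)] step(3), of "c * d"]
    show ?case by (simp add: monomial_fun_add algebra_simps)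
  qed
  from poly_fun_add[OF this step(3)] show ?case by (simp add: algebra_simps)
qed

lemma poly_fun_finite_rep:
  assumes "f \<in> poly_fun S" "finite S"
  shows "\<exists>c. \<forall>x. f x = (\<Sum>\<mu>\<in>S. c \<mu> * monomial_fun \<mu> x)"
  using assms(1)
proof (induction rule: poly_fun.induct)
  case zero
  show ?case by (auto intro!: exI[of _ "\<lambda>_. 0"])
next
  case (step \<mu> f d)
  then obtain c where c: "\<And>x. f x = (\<Sum>\<mu>\<in>S. c \<mu> * monomial_fun \<mu> x)" by blast
  have "(\<Sum>\<nu>\<in>S. (c(\<mu> := c \<mu> + d)) \<nu> * monomial_fun \<nu> x) = d * monomial_fun \<mu> x + f x" for x
  proof -
    have "(\<Sum>\<nu>\<in>S. (c(\<mu> := c \<mu> + d)) \<nu> * monomial_fun \<nu> x)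
       = (\<Sum>\<nu>\<in>S. c \<nu> * monomial_fun \<nu> x + (if \<nu> = \<mu> then d * monomial_fun \<nu> x else 0))"
      by (intro sum.cong) (auto simp: algebra_simps)
    then show ?thesis using step(1) assms(2) by (simp add: sum.distrib c)
  qed
  then show ?case by (metis (no_types))
qed

text \<open>The count behind the upper bound for the dimension: there are only as many independent polynomials as
  monomials.\<close>

lemma poly_fun_linear_dependence:
  fixes G :: "'j \<Rightarrow> complex^'k::finite \<Rightarrow> complex"
  assumes "finite S" "finite J" "card S < card J" "\<And>j. j \<in> J \<Longrightarrow> G j \<in> poly_fun S"
  shows "\<exists>c. (\<exists>j\<in>J. c j \<noteq> 0) \<and> (\<forall>x. (\<Sum>j\<in>J. c j * G j x) = 0)"
proof -
  have "\<exists>a. \<forall>j\<in>J. \<forall>x. G j x = (\<Sum>\<mu>\<in>S. a j \<mu> * monomial_fun \<mu> x)"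
    using poly_fun_finite_rep[OF assms(4) assms(1)] by metis
  then obtain a where a: "\<And>j x. j \<in> J \<Longrightarrow> G j x = (\<Sum>\<mu>\<in>S. a j \<mu> * monomial_fun \<mu> x)" by blast
  obtain c where c: "\<exists>j\<in>J. c j \<noteq> 0" "\<And>\<mu>. \<mu> \<in> S \<Longrightarrow> (\<Sum>j\<in>J. c j * a j \<mu>) = 0"
    using homogeneous_system_nontrivial_solution[OF assms(1-3), of a] by blast
  have "(\<Sum>j\<in>J. c j * G j x) = 0" for x
  proof -
    have "(\<Sum>j\<in>J. c j * G j x) = (\<Sum>j\<in>J. \<Sum>\<mu>\<in>S. (c j * a j \<mu>) * monomial_fun \<mu> x)"
      by (intro sum.cong) (simp_all add: a sum_distrib_left mult.assoc)
    also have "\<dots> = (\<Sum>\<mu>\<in>S. (\<Sum>j\<in>J. c j * a j \<mu>) * monomial_fun \<mu> x)"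
      by (subst sum.swap) (simp add: sum_distrib_right)
    also have "\<dots> = 0" using c(2) by (intro sum.neutral) auto
    finally show ?thesis .
  qed
  with c(1) show ?thesis by blast
qed

subsection \<open>Multihomogeneous functions\<close>

text \<open>The functions given by polynomials of multidegree \<open>d\<close>, the zero function included.\<close>

definition multihom :: "('m::finite \<Rightarrow> nat) \<Rightarrow> (complex^('m \<times> 'n::finite) \<Rightarrow> complex) set" where
  "multihom d = poly_fun {\<mu>. \<forall>i. (\<Sum>j\<in>UNIV. \<mu> (i, j)) = d i}"

lemma multihom_mult: "f \<in> multihom d \<Longrightarrow> g \<in> multihom e \<Longrightarrow> (\<lambda>x. f x * g x) \<in> multihom (\<lambda>i. d i + e i)"
  unfolding multihom_def by (erule poly_fun_mult, assumption) (auto simp: sum.distrib)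

lemma multihom_one: "(\<lambda>_. 1) \<in> multihom (\<lambda>_. 0)"
proof -
  have "monomial_fun (\<lambda>_. 0) \<in> multihom (\<lambda>_. 0)" unfolding multihom_def by (rule poly_fun_monomial) simp
  then show ?thesis by (simp add: monomial_fun_def[abs_def])
qed

lemma multihom_power: "f \<in> multihom d \<Longrightarrow> (\<lambda>x. f x ^ n) \<in> multihom (\<lambda>i. n * d i)"
  by (induction n) (auto intro: multihom_one dest: multihom_mult)

lemma multihom_prod:
  "(\<And>a. a \<in> A \<Longrightarrow> f a \<in> multihom (d a)) \<Longrightarrow> (\<lambda>x. \<Prod>a\<in>A. f a x) \<in> multihom (\<lambda>i. \<Sum>a\<in>A. d a i)"
  by (induction A rule: infinite_finite_induct) (auto intro: multihom_one multihom_mult)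

lemma multihom_add: "f \<in> multihom d \<Longrightarrow> g \<in> multihom d \<Longrightarrow> (\<lambda>x. f x + g x) \<in> multihom d"
  unfolding multihom_def by (rule poly_fun_add)

lemma multihom_scale: "f \<in> multihom d \<Longrightarrow> (\<lambda>x. c * f x) \<in> multihom d"
  unfolding multihom_def by (rule poly_fun_scale)

lemma multihom_diff: "f \<in> multihom d \<Longrightarrow> g \<in> multihom d \<Longrightarrow> (\<lambda>x. f x - g x) \<in> multihom d"
  using multihom_add[of f d "\<lambda>x. -1 * g x"] multihom_scale[of g d "-1"] by simp

lemma multihom_sum: "(\<And>i. i \<in> I \<Longrightarrow> f i \<in> multihom d) \<Longrightarrow> (\<lambda>x. \<Sum>i\<in>I. f i x) \<in> multihom d"
  unfolding multihom_def by (rule poly_fun_sum)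

lemma multihom_coord: "(\<lambda>x. x $ (i, j)) \<in> multihom (\<lambda>k. if k = i then 1 else 0)"
proof -
  have "monomial_fun (\<lambda>k. if k = (i, j) then 1 else 0) \<in> multihom (\<lambda>k. if k = i then 1 else 0)"
    unfolding multihom_def by (rule poly_fun_monomial) (auto simp: if_distrib cong: if_cong)
  moreover have "monomial_fun (\<lambda>k. if k = (i, j) then 1 else 0) = (\<lambda>x. x $ (i, j))"
  proof
    fix x :: "complex^('a \<times> 'b)"
    have "monomial_fun (\<lambda>k. if k = (i, j) then 1 else 0) x = (\<Prod>k\<in>UNIV. if k = (i,j) then x $ k else 1)"
      unfolding monomial_fun_def by (intro prod.cong) auto
    then show "monomial_fun (\<lambda>k. if k = (i, j) then 1 else 0) x = x $ (i, j)" by simp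
  qed
  ultimately show ?thesis by simp
qed

lemma multihom_scaling:
  assumes "f \<in> multihom d"
  shows "f (\<chi> k. c (fst k) * x $ k) = (\<Prod>i\<in>UNIV. c i ^ d i) * f x"
  using assms unfolding multihom_def
proof (induction rule: poly_fun.induct)
  case zero
  then show ?case by simp
next
  case (step \<mu> f a)
  have "monomial_fun \<mu> (\<chi> k. c (fst k) * x $ k) = (\<Prod>k\<in>UNIV. c (fst k) ^ \<mu> k) * monomial_fun \<mu> x"
    by (simp add: monomial_fun_def power_mult_distrib prod.distrib)
  also have "(\<Prod>k\<in>UNIV. c (fst k) ^ \<mu> k) = (\<Prod>i\<in>UNIV. \<Prod>j\<in>UNIV. c i ^ \<mu> (i, j))"
    by (subst prod.cartesian_product) (simp add: case_prod_unfold)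
  also have "\<dots> = (\<Prod>i\<in>UNIV. c i ^ d i)"
    using step(1) by (simp add: power_sum[symmetric])
  finally show ?case using step by (simp add: algebra_simps)
qed

lemma mpoly_eval_superset:
  assumes "finite A" "Poly_Mapping.keys f \<subseteq> A"
  shows "mpoly_eval f x = (\<Sum>\<mu>\<in>A. Poly_Mapping.lookup f \<mu> * monomial_fun (Poly_Mapping.lookup \<mu>) x)"
  unfolding mpoly_eval_def monomial_fun_def
  by (rule sum.mono_neutral_left[OF assms]) (auto simp: in_keys_iff)

lemma mpoly_eval_add: "mpoly_eval (f + g) x = mpoly_eval f x + mpoly_eval g x"
  using mpoly_eval_superset[of "Poly_Mapping.keys f \<union> Poly_Mapping.keys g" f x]
    mpoly_eval_superset[of "Poly_Mapping.keys f \<union> Poly_Mapping.keys g" g x]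
    mpoly_eval_superset[of "Poly_Mapping.keys f \<union> Poly_Mapping.keys g" "f + g" x]
    Poly_Mapping.keys_add[of f g]
  by (simp add: lookup_add distrib_right sum.distrib)

lemma mpoly_eval_in_poly_fun:
  "mpoly_eval f \<in> poly_fun (Poly_Mapping.lookup ` Poly_Mapping.keys f)"
proof -
  have "(\<lambda>x. \<Sum>\<mu>\<in>Poly_Mapping.keys f. Poly_Mapping.lookup f \<mu> * monomial_fun (Poly_Mapping.lookup \<mu>) x)
      \<in> poly_fun (Poly_Mapping.lookup ` Poly_Mapping.keys f)"
    by (intro poly_fun_sum poly_fun_scale poly_fun_monomial) auto
  moreover have "mpoly_eval f = (\<lambda>x. \<Sum>\<mu>\<in>Poly_Mapping.keys f.
      Poly_Mapping.lookup f \<mu> * monomial_fun (Poly_Mapping.lookup \<mu>) x)"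
    by (rule ext) (simp add: mpoly_eval_superset[of "Poly_Mapping.keys f" f])
  ultimately show ?thesis by simp
qed

lemma poly_fun_mono: "f \<in> poly_fun S \<Longrightarrow> S \<subseteq> T \<Longrightarrow> f \<in> poly_fun T"
  by (induction rule: poly_fun.induct) (auto intro: poly_fun.intros)

lemma multihomogeneous_multihom:
  assumes "multihomogeneous f"
  obtains d where "mpoly_eval f \<in> multihom d"
proof -
  obtain d where "\<forall>\<mu>\<in>Poly_Mapping.keys f. \<forall>i. (\<Sum>j\<in>UNIV. Poly_Mapping.lookup \<mu> (i, j)) = d i"
    using assms by (auto simp: multihomogeneous_def)
  then have "mpoly_eval f \<in> multihom d" unfolding multihom_def
    by (intro poly_fun_mono[OF mpoly_eval_in_poly_fun]) auto
  then show ?thesis using that by blast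
qed

lemma multihom_multihomogeneous:
  assumes "f \<in> multihom d"
  obtains F where "multihomogeneous F" "mpoly_eval F = f"
proof -
  have "\<exists>F. (\<forall>\<mu>\<in>Poly_Mapping.keys F. \<forall>i. (\<Sum>j\<in>UNIV. Poly_Mapping.lookup \<mu> (i, j)) = d i) \<and> mpoly_eval F = f"
    using assms unfolding multihom_def
  proof (induction rule: poly_fun.induct)
    case zero
    show ?case by (rule exI[of _ 0]) (auto simp: mpoly_eval_def)
  next
    case (step \<mu> f c)
    then obtain F where F: "\<forall>\<mu>\<in>Poly_Mapping.keys F. \<forall>i. (\<Sum>j\<in>UNIV. Poly_Mapping.lookup \<mu> (i, j)) = d i"
      "mpoly_eval F = f" by blast
    define M where "M = Poly_Mapping.Abs_poly_mapping \<mu>"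
    have M: "Poly_Mapping.lookup M = \<mu>" by (simp add: M_def)
    define G where "G = Poly_Mapping.single M c"
    have G: "mpoly_eval G x = c * monomial_fun \<mu> x" for x
      using mpoly_eval_superset[of "{M}" G x] by (simp add: G_def M)
    have k: "Poly_Mapping.keys (G + F) \<subseteq> insert M (Poly_Mapping.keys F)"
      using Poly_Mapping.keys_add[of G F] by (auto simp: G_def split: if_splits)
    show ?case
    proof (intro exI[of _ "G + F"] conjI ballI)
      fix \<nu> assume "\<nu> \<in> Poly_Mapping.keys (G + F)"
      then show "\<forall>i. (\<Sum>j\<in>UNIV. Poly_Mapping.lookup \<nu> (i, j)) = d i" using k F(1) step(1) M by auto
    next
      show "mpoly_eval (G + F) = (\<lambda>x. c * monomial_fun \<mu> x + f x)"
        by (auto simp: mpoly_eval_add G F(2))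
    qed
  qed
  then show ?thesis using that by (auto simp: multihomogeneous_def)
qed

section \<open>Functions that are polynomial along lines\<close>

text \<open>Polynomial dependence on several vectors at once, without coordinates. Real lines suffice, since a complex
  polynomial that vanishes on the real numbers is zero.\<close>

definition line_poly :: "('a::real_vector \<Rightarrow> complex) \<Rightarrow> bool" where
  "line_poly F \<longleftrightarrow> (\<forall>u w. \<exists>p. \<forall>t::real. F (u + t *\<^sub>R w) = poly p (of_real t))"

lemma line_poly_const: "line_poly (\<lambda>_. c)"
  unfolding line_poly_def by (metis poly_pCons poly_0 mult_zero_right add.right_neutral)

lemma line_poly_add: "line_poly F \<Longrightarrow> line_poly G \<Longrightarrow> line_poly (\<lambda>u. F u + G u)"
  unfolding line_poly_def by (metis poly_add)

lemma line_poly_mult: "line_poly F \<Longrightarrow> line_poly G \<Longrightarrow> line_poly (\<lambda>u. F u * G u)"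
  unfolding line_poly_def by (metis poly_mult)

lemma line_poly_diff: "line_poly F \<Longrightarrow> line_poly G \<Longrightarrow> line_poly (\<lambda>u. F u - G u)"
  unfolding line_poly_def by (metis poly_diff)

lemma line_poly_power: "line_poly F \<Longrightarrow> line_poly (\<lambda>u. F u ^ n)"
  by (induction n) (auto intro: line_poly_const line_poly_mult)

lemma line_poly_prod: "(\<And>i. i \<in> I \<Longrightarrow> line_poly (F i)) \<Longrightarrow> line_poly (\<lambda>u. \<Prod>i\<in>I. F i u)"
  by (induction I rule: infinite_finite_induct) (auto intro: line_poly_const line_poly_mult)

lemma line_poly_linear:
  assumes "linear F"
  shows "line_poly F"
  unfolding line_poly_def
proof (intro allI)
  fix u w
  show "\<exists>p. \<forall>t::real. F (u + t *\<^sub>R w) = poly p (of_real t)"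
    by (rule exI[of _ "[:F u, F w:]"])
      (simp add: linear_add[OF assms] linear_scale[OF assms] scaleR_conv_of_real)
qed

lemma line_poly_poly_fun:
  assumes "f \<in> poly_fun S" "\<And>k. line_poly (\<lambda>u. \<phi> u $ k)"
  shows "line_poly (\<lambda>u. f (\<phi> u))"
  using assms(1)
  by (induction rule: poly_fun.induct)
    (auto simp: monomial_fun_def intro!: line_poly_const line_poly_add line_poly_mult line_poly_prod line_poly_power assms(2))

text \<open>If one function is nonzero at \<open>u\<close> and another at \<open>w\<close>, then their product is a nonzero polynomial on the
  line joining \<open>u\<close> and \<open>w\<close>, and so it is nonzero at some point of this line.\<close>

lemma line_poly_common_nonzero:
  assumes "finite I" "\<And>i. i \<in> I \<Longrightarrow> line_poly (F i)" "\<And>i. i \<in> I \<Longrightarrow> \<exists>u\<in>S. F i u \<noteq> 0"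
    and line: "\<And>u w t. u \<in> S \<Longrightarrow> w \<in> S \<Longrightarrow> u + t *\<^sub>R (w - u) \<in> S" and ne: "S \<noteq> {}"
  shows "\<exists>u\<in>S. \<forall>i\<in>I. F i u \<noteq> 0"
  using assms(1-3)
proof (induction I rule: finite_induct)
  case empty
  then show ?case using ne by auto
next
  case (insert i I)
  then obtain u where u: "u \<in> S" "\<forall>j\<in>I. F j u \<noteq> 0" by auto
  obtain w where w: "w \<in> S" "F i w \<noteq> 0" using insert.prems(2)[of i] by auto
  define G where "G = (\<lambda>u. \<Prod>j\<in>I. F j u)"
  have "line_poly G" unfolding G_def using insert by (intro line_poly_prod) auto
  then obtain p where p: "\<And>t::real. G (u + t *\<^sub>R (w - u)) = poly p (of_real t)"
    unfolding line_poly_def by metis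
  obtain q where q: "\<And>t::real. F i (u + t *\<^sub>R (w - u)) = poly q (of_real t)"
    using insert(4)[of i] unfolding line_poly_def by auto metis
  have "p \<noteq> 0" using p[of 0] u insert(1) by (auto simp: G_def)
  moreover have "q \<noteq> 0" using q[of 1] w by auto
  ultimately have "finite {z. poly (p * q) z = 0}" by (intro poly_roots_finite) auto
  then have "finite (of_real ` (UNIV :: real set) \<inter> {z::complex. poly (p * q) z = 0})" by blast
  moreover have "infinite (of_real ` (UNIV :: real set) :: complex set)"
    using infinite_UNIV_char_0 finite_imageD[of of_real "UNIV :: real set"]
    by (auto simp: inj_on_def)
  ultimately obtain t :: real where t: "poly (p * q) (of_real t) \<noteq> 0"
    by (metis (mono_tags, lifting) Int_absorb2 image_subset_iff mem_Collect_eq)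
  show ?case
  proof (rule bexI[of _ "u + t *\<^sub>R (w - u)"])
    have "G (u + t *\<^sub>R (w - u)) \<noteq> 0" using t p[of t] by auto
    then have "\<forall>j\<in>I. F j (u + t *\<^sub>R (w - u)) \<noteq> 0"
      unfolding G_def prod_zero_iff[OF insert(1)] by blast
    then show "\<forall>j\<in>insert i I. F j (u + t *\<^sub>R (w - u)) \<noteq> 0"
      using t q[of t] by auto
    show "u + t *\<^sub>R (w - u) \<in> S" using line u w by blast
  qed
qed

section \<open>Closed sets and homogeneous coordinates\<close>

text \<open>A vector of homogeneous coordinates has one block of coordinates in each factor.\<close>

definition block :: "complex^('m::finite \<times> 'n::finite) \<Rightarrow> 'm \<Rightarrow> complex^'n" where
  "block x i = (\<chi> j. x $ (i, j))"

definition proj :: "complex^('m::finite \<times> 'n::finite) \<Rightarrow> 'm \<Rightarrow> (complex^'n) set" where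
  "proj x = (\<lambda>i. vec.span {block x i})"

definition nonzero_blocks :: "complex^('m::finite \<times> 'n::finite) \<Rightarrow> bool" where
  "nonzero_blocks x \<longleftrightarrow> (\<forall>i. block x i \<noteq> 0)"

definition multicone :: "('m::finite \<Rightarrow> (complex^'n::finite) set) set \<Rightarrow> (complex^('m::finite \<times> 'n::finite)) set" where
  "multicone X = {x. nonzero_blocks x \<and> proj x \<in> X}"

lemma vec_block_eqI: "(\<And>i. block x i = block y i) \<Longrightarrow> x = y"
  by (auto simp: block_def vec_eq_iff)

lemma span_singleton_in_proj_points:
  fixes v :: "complex^'n"
  assumes "v \<noteq> 0" shows "vec.span {v} \<in> proj_points"
proof -
  have "vec.independent {v}" using assms by (simp add: vec.independent_insert)
  then have "vec.dim {v} = card {v}" by (rule vec.dim_eq_card_independent)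
  then show ?thesis by (auto simp: proj_flats_def vec.subspace_span)
qed

lemma proj_point_eq_span:
  fixes v :: "complex^'n"
  assumes "P \<in> proj_points" "v \<in> P" "v \<noteq> 0"
  shows "P = vec.span {v}"
proof -
  have "vec.independent {v}" using assms by (simp add: vec.independent_insert)
  moreover have "vec.subspace P" "vec.dim P = 1" using assms by (auto simp: proj_flats_def)
  ultimately have "P \<subseteq> vec.span {v}"
    using vec.card_ge_dim_independent[of "{v}" P] assms(2) by simp
  moreover have "vec.span {v} \<subseteq> P"
    using \<open>vec.subspace P\<close> assms(2) by (intro vec.span_minimal) auto
  ultimately show ?thesis by blast
qed

lemma proj_point_nonzero:
  fixes P :: "(complex^'n) set"
  assumes "P \<in> proj_points" obtains v where "v \<in> P" "v \<noteq> 0"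
proof -
  have "vec.dim P \<noteq> 0" using assms by (simp add: proj_flats_def)
  then have "\<not> P \<subseteq> {0}" by (simp add: vec.dim_eq_0)
  then show ?thesis using that by blast
qed

lemma proj_multi_points: "nonzero_blocks x \<Longrightarrow> proj x \<in> multi_points"
  by (simp add: nonzero_blocks_def proj_def multi_points_def span_singleton_in_proj_points)

lemma homogeneous_coords_proj: "nonzero_blocks x \<Longrightarrow> x \<in> homogeneous_coords (proj x)"
  by (auto simp: nonzero_blocks_def proj_def homogeneous_coords_def block_def vec.span_base)

lemma homogeneous_coords_imp:
  fixes p :: "'m::finite \<Rightarrow> (complex^'n::finite) set"
  assumes "p \<in> multi_points" "x \<in> homogeneous_coords p"
  shows "nonzero_blocks x" "p = proj x"
proof -
  have "block x i \<in> p i - {0}" for i using assms(2) by (simp add: homogeneous_coords_def block_def)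
  then have *: "block x i \<in> p i" "block x i \<noteq> 0" for i by auto
  then show "nonzero_blocks x" by (simp add: nonzero_blocks_def)
  have "p i \<in> proj_points" for i using assms(1) by (simp add: multi_points_def)
  from proj_point_eq_span[OF this *] show "p = proj x" by (simp add: proj_def fun_eq_iff)
qed

lemma multi_points_coords:
  fixes p :: "'m::finite \<Rightarrow> (complex^'n::finite) set"
  assumes "p \<in> multi_points" obtains x where "nonzero_blocks x" "p = proj x"
proof -
  have "\<exists>v. v \<in> p i \<and> v \<noteq> 0" for i
  proof -
    have "p i \<in> proj_points" using assms by (simp add: multi_points_def)
    from proj_point_nonzero[OF this] show ?thesis by blast
  qed
  then obtain v where v: "\<And>i. v i \<in> p i \<and> v i \<noteq> 0" by metis
  have "(\<chi> k. v (fst k) $ snd k) \<in> homogeneous_coords p"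
    using v by (simp add: homogeneous_coords_def)
  from homogeneous_coords_imp[OF assms this] show ?thesis using that by blast
qed

lemma proj_coords_scaling:
  fixes x y :: "complex^('m::finite \<times> 'n::finite)"
  assumes "nonzero_blocks x" "y \<in> homogeneous_coords (proj x)"
  obtains c where "\<And>i. c i \<noteq> 0" "y = (\<chi> k. c (fst k) * x $ k)"
proof -
  have "block y i \<in> vec.span {block x i}" "block y i \<noteq> 0" for i
    using assms by (auto simp: homogeneous_coords_def proj_def block_def)
  then have "\<exists>c. block y i = c *s block x i" for i by (auto simp: vec.span_singleton)
  then obtain c where c: "\<And>i. block y i = c i *s block x i" by metis
  have "c i \<noteq> 0" for i using c[of i] \<open>block y i \<noteq> 0\<close> by auto
  moreover have "y = (\<chi> k. c (fst k) * x $ k)"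
    using c by (simp add: vec_eq_iff block_def)
  ultimately show ?thesis using that by blast
qed

lemma vanishes_at_proj:
  assumes "mpoly_eval F \<in> multihom d" "nonzero_blocks x"
  shows "vanishes_at F (proj x) \<longleftrightarrow> mpoly_eval F x = 0"
proof
  assume "vanishes_at F (proj x)"
  then show "mpoly_eval F x = 0" using homogeneous_coords_proj[OF assms(2)] by (simp add: vanishes_at_def)
next
  assume 0: "mpoly_eval F x = 0"
  show "vanishes_at F (proj x)" unfolding vanishes_at_def
  proof
    fix y assume "y \<in> homogeneous_coords (proj x)"
    then obtain c where "y = (\<chi> k. c (fst k) * x $ k)"
      using proj_coords_scaling[OF assms(2)] by metis
    then show "mpoly_eval F y = 0" using multihom_scaling[OF assms(1), of c x] 0 by simp
  qed
qed

text \<open>A multihomogeneous polynomial vanishes at all homogeneous coordinates of a point or at none, so closed sets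
  are determined by conditions on a single coordinate vector of each point.\<close>

lemma zariski_closed_iff:
  "zariski_closed Z \<longleftrightarrow> Z \<subseteq> multi_points \<and>
    (\<exists>G. (\<forall>g\<in>G. \<exists>d. g \<in> multihom d) \<and> (\<forall>x. nonzero_blocks x \<longrightarrow> (proj x \<in> Z \<longleftrightarrow> (\<forall>g\<in>G. g x = 0))))"
proof
  assume "zariski_closed Z"
  then obtain F where F: "\<forall>f\<in>F. multihomogeneous f" "Z = {p \<in> multi_points. \<forall>f\<in>F. vanishes_at f p}"
    by (auto simp: zariski_closed_def)
  have deg: "\<exists>d. mpoly_eval f \<in> multihom d" if "f \<in> F" for f
    using F(1) that by (blast elim: multihomogeneous_multihom)
  have "vanishes_at f (proj x) \<longleftrightarrow> mpoly_eval f x = 0" if "f \<in> F" "nonzero_blocks x" for f x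
  proof -
    have "multihomogeneous f" using F(1) that(1) by blast
    then obtain d where "mpoly_eval f \<in> multihom d" by (rule multihomogeneous_multihom)
    then show ?thesis using that(2) by (rule vanishes_at_proj)
  qed
  then have "\<forall>x. nonzero_blocks x \<longrightarrow> (proj x \<in> Z \<longleftrightarrow> (\<forall>g\<in>mpoly_eval ` F. g x = 0))"
    using F(2) proj_multi_points by auto
  then show "Z \<subseteq> multi_points \<and>
    (\<exists>G. (\<forall>g\<in>G. \<exists>d. g \<in> multihom d) \<and> (\<forall>x. nonzero_blocks x \<longrightarrow> (proj x \<in> Z \<longleftrightarrow> (\<forall>g\<in>G. g x = 0))))"
    using F deg by (intro conjI exI[of _ "mpoly_eval ` F"]) auto
next
  assume "Z \<subseteq> multi_points \<and>
    (\<exists>G. (\<forall>g\<in>G. \<exists>d. g \<in> multihom d) \<and> (\<forall>x. nonzero_blocks x \<longrightarrow> (proj x \<in> Z \<longleftrightarrow> (\<forall>g\<in>G. g x = 0))))"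
  then obtain G where G: "Z \<subseteq> multi_points" "\<And>g. g \<in> G \<Longrightarrow> \<exists>d. g \<in> multihom d"
    "\<And>x. nonzero_blocks x \<Longrightarrow> proj x \<in> Z \<longleftrightarrow> (\<forall>g\<in>G. g x = 0)" by blast
  define F where "F = {f. multihomogeneous f \<and> mpoly_eval f \<in> G}"
  have "proj x \<in> Z \<longleftrightarrow> (\<forall>f\<in>F. vanishes_at f (proj x))" if "nonzero_blocks x" for x
  proof -
    have "(\<forall>f\<in>F. vanishes_at f (proj x)) \<longleftrightarrow> (\<forall>f\<in>F. mpoly_eval f x = 0)"
      using vanishes_at_proj[OF _ that] multihomogeneous_multihom unfolding F_def by blast
    also have "\<dots> \<longleftrightarrow> (\<forall>g\<in>G. g x = 0)"
      using G(2) multihom_multihomogeneous unfolding F_def by blast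
    finally show ?thesis using G(3)[OF that] by simp
  qed
  then have "p \<in> Z \<longleftrightarrow> p \<in> multi_points \<and> (\<forall>f\<in>F. vanishes_at f p)" for p
    using G(1) multi_points_coords[of p] by (metis subsetD)
  then have "Z = {p \<in> multi_points. \<forall>f\<in>F. vanishes_at f p}" by blast
  moreover have "\<forall>f\<in>F. multihomogeneous f" by (simp add: F_def)
  ultimately show "zariski_closed Z" unfolding zariski_closed_def by (intro exI[of _ F] conjI)
qed

lemma zariski_closed_subset: "zariski_closed Z \<Longrightarrow> Z \<subseteq> multi_points"
  by (simp add: zariski_closed_iff)

lemma closed_separate:
  assumes "zariski_closed Z" "nonzero_blocks x" "proj x \<notin> Z"
  obtains d f where "f \<in> multihom d" "f x \<noteq> 0" "\<And>y. y \<in> multicone Z \<Longrightarrow> f y = 0"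
proof -
  obtain G where G: "\<And>g. g \<in> G \<Longrightarrow> \<exists>d. g \<in> multihom d"
    "\<And>x. nonzero_blocks x \<Longrightarrow> proj x \<in> Z \<longleftrightarrow> (\<forall>g\<in>G. g x = 0)"
    using assms(1) unfolding zariski_closed_iff by blast
  obtain g where g: "g \<in> G" "g x \<noteq> 0" using G(2) assms by blast
  obtain d where d: "g \<in> multihom d" using G(1) g(1) by blast
  show ?thesis by (rule that[OF d g(2)]) (use G(2) g(1) in \<open>auto simp: multicone_def\<close>)
qed

lemma closed_cut:
  assumes "zariski_closed Z" "f \<in> multihom d"
  obtains Y where "zariski_closed Y" "Y \<subseteq> Z" "multicone Y = {x \<in> multicone Z. f x = 0}"
proof -
  obtain G where G: "\<And>g. g \<in> G \<Longrightarrow> \<exists>d. g \<in> multihom d"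
    "\<And>x. nonzero_blocks x \<Longrightarrow> proj x \<in> Z \<longleftrightarrow> (\<forall>g\<in>G. g x = 0)"
    using assms(1) unfolding zariski_closed_iff by blast
  obtain F where F: "multihomogeneous F" "mpoly_eval F = f" using multihom_multihomogeneous[OF assms(2)] .
  have v: "nonzero_blocks x \<Longrightarrow> vanishes_at F (proj x) \<longleftrightarrow> f x = 0" for x
    using vanishes_at_proj[of F d x] F assms(2) by simp
  define Y where "Y = {p \<in> Z. vanishes_at F p}"
  show ?thesis
  proof (rule that)
    show "Y \<subseteq> Z" by (auto simp: Y_def)
    show "multicone Y = {x \<in> multicone Z. f x = 0}" using v by (auto simp: Y_def multicone_def)
    show "zariski_closed Y" unfolding zariski_closed_iff
      using zariski_closed_subset[OF assms(1)] G v assms(2)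
      by (intro conjI exI[of _ "insert f G"]) (auto simp: Y_def)
  qed
qed

lemma multicone_subset_iff:
  assumes "A \<subseteq> multi_points"
  shows "A \<subseteq> B \<longleftrightarrow> multicone A \<subseteq> multicone B"
proof
  assume *: "multicone A \<subseteq> multicone B"
  show "A \<subseteq> B"
  proof
    fix p assume "p \<in> A"
    then obtain x where x: "nonzero_blocks x" "p = proj x" using assms multi_points_coords by blast
    then have "x \<in> multicone A" using \<open>p \<in> A\<close> by (simp add: multicone_def)
    then show "p \<in> B" using * x by (auto simp: multicone_def)
  qed
qed (auto simp: multicone_def)

text \<open>The hull is the zero set of all functions that vanish on \<open>A\<close>. It lies in the product of projective
  spaces only because \<open>A\<close> does.\<close>

lemma zariski_closed_hull:
  assumes "A \<subseteq> multi_points"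
  shows "zariski_closed (zariski_closed hull A)"
proof -
  define G where "G = {g. (\<exists>d. g \<in> multihom d) \<and> (\<forall>x\<in>multicone A. g x = 0)}"
  define Z where "Z = {p. \<exists>x. nonzero_blocks x \<and> p = proj x \<and> (\<forall>g\<in>G. g x = 0)}"
  have Zi: "proj x \<in> Z \<longleftrightarrow> (\<forall>g\<in>G. g x = 0)" if "nonzero_blocks x" for x
  proof
    assume "proj x \<in> Z"
    then obtain y where y: "nonzero_blocks y" "proj x = proj y" "\<forall>g\<in>G. g y = 0" by (auto simp: Z_def)
    have "x \<in> homogeneous_coords (proj y)" using homogeneous_coords_proj[OF that] y(2) by simp
    then obtain c where "x = (\<chi> k. c (fst k) * y $ k)" using proj_coords_scaling[OF y(1)] by metis
    then show "\<forall>g\<in>G. g x = 0" using y(3) multihom_scaling unfolding G_def by fastforce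
  qed (use that in \<open>auto simp: Z_def\<close>)
  have Z: "zariski_closed Z" unfolding zariski_closed_iff
    by (intro conjI exI[of _ G]) (auto simp: Zi, auto simp: Z_def G_def proj_multi_points)
  have AZ: "A \<subseteq> Z"
    using multicone_subset_iff[OF assms, of Z] Zi by (auto simp: multicone_def G_def)
  have "Z \<subseteq> T" if T: "zariski_closed T" "A \<subseteq> T" for T
  proof (rule ccontr)
    assume "\<not> Z \<subseteq> T"
    then obtain x where x: "nonzero_blocks x" "proj x \<in> Z" "proj x \<notin> T" by (auto simp: Z_def)
    obtain d f where f: "f \<in> multihom d" "f x \<noteq> 0" "\<And>y. y \<in> multicone T \<Longrightarrow> f y = 0"
      using closed_separate[OF T(1) x(1,3)] by metis
    have "f \<in> G" using f T(2) by (auto simp: G_def multicone_def)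
    then show False using Zi[OF x(1)] x f by auto
  qed
  then have "zariski_closed hull A = Z" using Z AZ by (intro hull_unique) auto
  then show ?thesis using Z by simp
qed

lemma vanish_on_hull:
  assumes A: "A \<subseteq> multi_points" and f: "f \<in> multihom d" "\<And>x. x \<in> multicone A \<Longrightarrow> f x = 0"
    and x: "x \<in> multicone (zariski_closed hull A)"
  shows "f x = 0"
proof -
  obtain Y where Y: "zariski_closed Y" "multicone Y = {x \<in> multicone (zariski_closed hull A). f x = 0}"
    using closed_cut[OF zariski_closed_hull[OF A] f(1)] by metis
  have "A \<subseteq> zariski_closed hull A" by (rule hull_subset)
  then have "A \<subseteq> Y" unfolding multicone_subset_iff[OF A] using f(2) Y(2) by auto
  then have "zariski_closed hull A \<subseteq> Y" using Y(1) by (rule hull_minimal)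
  then have "x \<in> multicone Y" using x by (auto simp: multicone_def)
  then show ?thesis using Y(2) by auto
qed

section \<open>Irreducible closed sets\<close>

lemma irreducible_closedD: "irreducible_closed W \<Longrightarrow> zariski_closed W"
  by (simp add: irreducible_closed_def)

text \<open>The zero sets of the two factors cover \<open>W\<close>, so one of them is all of \<open>W\<close>.\<close>

lemma irreducible_no_zero_divisors:
  assumes W: "irreducible_closed W" and f: "f \<in> multihom d" and g: "g \<in> multihom e"
    and fg: "\<And>x. x \<in> multicone W \<Longrightarrow> f x * g x = 0"
    and y: "y \<in> multicone W" "g y \<noteq> 0" and x: "x \<in> multicone W"
  shows "f x = 0"
proof -
  have cl: "zariski_closed W" using W by (rule irreducible_closedD)
  obtain A where A: "zariski_closed A" "A \<subseteq> W" "multicone A = {x \<in> multicone W. f x = 0}"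
    using closed_cut[OF cl f] .
  obtain B where B: "zariski_closed B" "B \<subseteq> W" "multicone B = {x \<in> multicone W. g x = 0}"
    using closed_cut[OF cl g] .
  have "W \<subseteq> A \<union> B"
    unfolding multicone_subset_iff[OF zariski_closed_subset[OF cl]]
  proof
    fix x assume "x \<in> multicone W"
    then have "x \<in> multicone A \<or> x \<in> multicone B" using fg[of x] A(3) B(3) by auto
    then show "x \<in> multicone (A \<union> B)" by (auto simp: multicone_def)
  qed
  then have "W = A \<union> B" using A B by blast
  then have "W = A \<or> W = B" using W A(1) B(1) by (auto simp: irreducible_closed_def)
  moreover have "W \<noteq> B" using y B(3) by auto
  ultimately show ?thesis using A(3) x by auto
qed

text \<open>The whole of \<open>X\<close> is the largest irreducible closed subset through every point.\<close>

lemma local_dim_irreducible: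
  assumes "irreducible_closed X" "p \<in> X"
  shows "local_dim X p = krull_dim X"
proof (rule antisym)
  have "krull_dim Z \<le> krull_dim X" if "Z \<subseteq> X" for Z
    unfolding krull_dim_def by (intro Sup_subset_mono) (use that in blast)
  then show "local_dim X p \<le> krull_dim X"
    unfolding local_dim_def by (intro Sup_least) auto
  show "krull_dim X \<le> local_dim X p"
    unfolding local_dim_def by (intro Sup_upper) (use assms in auto)
qed

text \<open>Suppose the closure is covered by two smaller closed sets. For each of the two there is a function that
  vanishes on it but not on the whole family. By \<open>line_poly_common_nonzero\<close> some member of the family is a zero of neither
  function.\<close>

lemma irreducible_param:
  fixes \<phi> :: "'a::real_vector \<Rightarrow> complex^('m::finite \<times> 'n::finite)"
  assumes line_poly: "\<And>k. line_poly (\<lambda>u. \<phi> u $ k)"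
    and line: "\<And>u w t. u \<in> S \<Longrightarrow> w \<in> S \<Longrightarrow> u + t *\<^sub>R (w - u) \<in> S"
    and u0: "u0 \<in> S" "nonzero_blocks (\<phi> u0)"
  shows "irreducible_closed (zariski_closed hull {proj (\<phi> u) |u. u \<in> S \<and> nonzero_blocks (\<phi> u)})"
proof -
  define A where "A = {proj (\<phi> u) |u. u \<in> S \<and> nonzero_blocks (\<phi> u)}"
  define W where "W = zariski_closed hull A"
  have A: "A \<subseteq> multi_points" by (auto simp: A_def proj_multi_points)
  have cl: "zariski_closed W" unfolding W_def using A by (rule zariski_closed_hull)
  have AW: "A \<subseteq> W" unfolding W_def by (rule hull_subset)
  have "proj (\<phi> u0) \<in> A" using u0 by (auto simp: A_def)
  then have ne: "W \<noteq> {}" using AW by auto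
  have "W = P \<or> W = Q" if PQ: "zariski_closed P" "zariski_closed Q" "W = P \<union> Q" for P Q
  proof (rule ccontr)
    assume *: "\<not> (W = P \<or> W = Q)"
    have sep: "\<exists>d f u. f \<in> multihom d \<and> u \<in> S \<and> f (\<phi> u) \<noteq> 0 \<and> (\<forall>y\<in>multicone Z. f y = 0)"
      if Z: "zariski_closed Z" "Z \<subseteq> W" "W \<noteq> Z" for Z
    proof -
      have "\<not> A \<subseteq> Z"
        using hull_minimal[of A Z zariski_closed] Z by (auto simp: W_def)
      then obtain u where u: "u \<in> S" "nonzero_blocks (\<phi> u)" "proj (\<phi> u) \<notin> Z" by (auto simp: A_def)
      show ?thesis using closed_separate[OF Z(1) u(2,3)] u(1) by metis
    qed
    obtain d f u where f: "f \<in> multihom d" "u \<in> S" "f (\<phi> u) \<noteq> 0" "\<forall>y\<in>multicone P. f y = 0"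
      using sep[of P] PQ * by blast
    obtain e g w where g: "g \<in> multihom e" "w \<in> S" "g (\<phi> w) \<noteq> 0" "\<forall>y\<in>multicone Q. g y = 0"
      using sep[of Q] PQ * by blast
    obtain j where j: "\<And>i. \<phi> u0 $ (i, j i) \<noteq> 0"
      using u0(2) unfolding nonzero_blocks_def block_def vec_eq_iff by (simp, metis)
    define F where "F = (\<lambda>b. case b of None \<Rightarrow> (\<lambda>u. f (\<phi> u) * g (\<phi> u)) | Some i \<Rightarrow> (\<lambda>u. \<phi> u $ (i, j i)))"
    have lf: "line_poly (\<lambda>u. f (\<phi> u))" "line_poly (\<lambda>u. g (\<phi> u))"
      using f(1) g(1) line_poly unfolding multihom_def by (auto intro: line_poly_poly_fun)
    have "\<exists>v\<in>S. \<forall>b\<in>{True,False}. (if b then f (\<phi> v) else g (\<phi> v)) \<noteq> 0"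
    proof (rule line_poly_common_nonzero)
      show "line_poly (\<lambda>v. if b then f (\<phi> v) else g (\<phi> v))" for b by (cases b) (use lf in auto)
      show "\<exists>v\<in>S. (if b then f (\<phi> v) else g (\<phi> v)) \<noteq> 0" for b
        by (cases b) (use f(2,3) g(2,3) in auto)
    qed (use line u0 in auto)
    then have fg: "\<exists>v\<in>S. f (\<phi> v) * g (\<phi> v) \<noteq> 0" by auto
    have "\<exists>v\<in>S. \<forall>b\<in>UNIV. F b v \<noteq> 0"
    proof (rule line_poly_common_nonzero)
      show "line_poly (F b)" for b by (cases b) (auto simp: F_def intro: line_poly line_poly_mult lf)
      show "\<exists>v\<in>S. F b v \<noteq> 0" for b using fg u0 j by (cases b) (auto simp: F_def)
    qed (use line u0 in auto)
    then obtain v where v: "v \<in> S" "\<And>b. F b v \<noteq> 0" by auto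
    have "\<phi> v $ (i, j i) \<noteq> 0" for i using v(2)[of "Some i"] by (simp add: F_def)
    then have nzv: "nonzero_blocks (\<phi> v)" unfolding nonzero_blocks_def block_def vec_eq_iff by auto
    then have "proj (\<phi> v) \<in> W" using v(1) AW by (auto simp: A_def)
    then have "\<phi> v \<in> multicone P \<or> \<phi> v \<in> multicone Q" using PQ(3) nzv by (auto simp: multicone_def)
    then show False using v(2)[of None] f(4) g(4) by (auto simp: F_def)
  qed
  then show ?thesis using cl ne by (auto simp: irreducible_closed_def W_def A_def)
qed

section \<open>Krull dimension\<close>

text \<open>Independence survives multiplication by powers of \<open>g\<close>: a relation on \<open>W'\<close> is divided by the least power of
  \<open>g\<close> that occurs in it and then restricted to \<open>W\<close>, where \<open>g\<close> vanishes. What remains is a relation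
  between the \<open>G q\<close>. The powers of \<open>f\<close> make all terms multihomogeneous of the same multidegree.\<close>

lemma growth_step:
  assumes W: "irreducible_closed W" "irreducible_closed W'" "W \<subseteq> W'"
    and b: "b \<in> multicone W" "f b \<noteq> 0" and f: "f \<in> multihom e" and g: "g \<in> multihom e"
    and g0: "\<And>x. x \<in> multicone W \<Longrightarrow> g x = 0" and y: "y \<in> multicone W'" "g y \<noteq> 0"
    and J: "finite J" "\<And>q. q \<in> J \<Longrightarrow> G q \<in> multihom D"
    and ind: "\<And>c. (\<And>x. x \<in> multicone W \<Longrightarrow> (\<Sum>q\<in>J. c q * G q x) = 0) \<Longrightarrow> \<forall>q\<in>J. c q = 0"
    and c0: "\<And>x. x \<in> multicone W' \<Longrightarrow>
      (\<Sum>r\<le>N. \<Sum>q\<in>J. c r q * (G q x * g x ^ r * f x ^ (N - r))) = 0"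
    and r: "r \<le> N"
  shows "\<forall>q\<in>J. c r q = 0"
  using r
proof (induction r rule: less_induct)
  case (less r)
  define P where "P = (\<lambda>r x. \<Sum>q\<in>J. c r q * G q x)"
  have P: "P s \<in> multihom D" for s unfolding P_def by (intro multihom_sum multihom_scale J)
  define R where "R = (\<lambda>x. \<Sum>s=r..N. P s x * (g x ^ (s - r) * f x ^ (N - s)))"
  have R: "R \<in> multihom (\<lambda>i. D i + (N - r) * e i)" unfolding R_def
  proof (rule multihom_sum)
    fix s assume "s \<in> {r..N}"
    then have "(\<lambda>i. D i + ((s - r) * e i + (N - s) * e i)) = (\<lambda>i. D i + (N - r) * e i)"
      by (auto simp: add_mult_distrib[symmetric])
    moreover have "(\<lambda>x. P s x * (g x ^ (s - r) * f x ^ (N - s))) \<in> multihom (\<lambda>i. D i + ((s - r) * e i + (N - s) * e i))"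
      by (intro multihom_mult P multihom_power f g)
    ultimately show "(\<lambda>x. P s x * (g x ^ (s - r) * f x ^ (N - s))) \<in> multihom (\<lambda>i. D i + (N - r) * e i)" by simp
  qed
  have split: "R x * g x ^ r = 0" if "x \<in> multicone W'" for x
  proof -
    have "(\<Sum>s\<le>N. \<Sum>q\<in>J. c s q * (G q x * g x ^ s * f x ^ (N - s))) = (\<Sum>s\<le>N. P s x * (g x ^ s * f x ^ (N - s)))"
      by (intro sum.cong) (simp_all add: P_def sum_distrib_right mult.assoc)
    also have "\<dots> = (\<Sum>s=r..N. P s x * (g x ^ s * f x ^ (N - s)))"
    proof (rule sum.mono_neutral_right)
      show "\<forall>s\<in>{..N} - {r..N}. P s x * (g x ^ s * f x ^ (N - s)) = 0"
      proof
        fix s assume "s \<in> {..N} - {r..N}"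
        then have "s < r" "s \<le> N" by auto
        then have "P s x = 0" using less.IH[of s] by (simp add: P_def)
        then show "P s x * (g x ^ s * f x ^ (N - s)) = 0" by simp
      qed
    qed auto
    also have "\<dots> = R x * g x ^ r"
      unfolding R_def sum_distrib_right
      by (intro sum.cong) (auto simp: power_add[symmetric] mult_ac)
    finally show ?thesis using c0[OF that] by simp
  qed
  have R0: "R x = 0" if "x \<in> multicone W'" for x
    by (rule irreducible_no_zero_divisors[OF W(2) R multihom_power[OF g] split y(1) _ that])
      (simp_all add: y(2))
  have "P r x * f x ^ (N - r) = 0" if "x \<in> multicone W" for x
  proof -
    have "x \<in> multicone W'" using that W(3) by (auto simp: multicone_def)
    then have "R x = 0" by (rule R0)
    moreover have "R x = (\<Sum>s=r..N. if s = r then P s x * f x ^ (N - s) else 0)"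
      unfolding R_def using g0[OF that] by (intro sum.cong) auto
    ultimately show ?thesis using less.prems by simp
  qed
  then have "P r x = 0" if "x \<in> multicone W" for x
    by (rule irreducible_no_zero_divisors[OF W(1) P multihom_power[OF f] _ b(1) _ that])
      (simp_all add: b(2))
  then show ?case using ind[of "c r"] unfolding P_def by blast
qed

text \<open>The Hilbert function of the top of a chain of length \<open>n\<close> grows at least like \<open>N^n\<close>. An index \<open>q\<close> lists the
  exponents of a monomial in the functions that separate consecutive members of the chain.\<close>

lemma chain_growth:
  fixes W :: "nat \<Rightarrow> ('m::finite \<Rightarrow> (complex^'n::finite) set) set"
  assumes irr: "\<And>k. k \<le> n \<Longrightarrow> irreducible_closed (W k)" and lt: "\<And>k. k < n \<Longrightarrow> W k \<subset> W (Suc k)"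
  obtains e where "\<And>N. \<exists>(J :: nat list set) G. finite J \<and> card J = (N + 1) ^ n \<and>
      (\<forall>q\<in>J. G q \<in> multihom (\<lambda>i. n * N * e i)) \<and>
      (\<forall>c. (\<forall>x\<in>multicone (W n). (\<Sum>q\<in>J. c q * G q x) = 0) \<longrightarrow> (\<forall>q\<in>J. c q = 0))"
proof -
  have mono: "W 0 \<subseteq> W k" if "k \<le> n" for k
    using that
  proof (induction k)
    case (Suc k)
    then show ?case using lt[of k] by auto
  qed simp
  have "\<exists>f d. f \<in> multihom d \<and> (\<forall>x\<in>multicone (W k). f x = 0) \<and> (\<exists>y\<in>multicone (W (Suc k)). f y \<noteq> 0)"
    if "k < n" for k
  proof -
    have "W (Suc k) \<subseteq> multi_points"
      using irr[of "Suc k"] that by (simp add: irreducible_closedD zariski_closed_subset)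
    then have "\<not> multicone (W (Suc k)) \<subseteq> multicone (W k)"
      using multicone_subset_iff lt[OF that] by blast
    then obtain y where y: "y \<in> multicone (W (Suc k))" "nonzero_blocks y" "proj y \<notin> W k"
      by (auto simp: multicone_def)
    have "zariski_closed (W k)" using irr[of k] that by (simp add: irreducible_closedD)
    from closed_separate[OF this y(2,3)] y(1) show ?thesis by metis
  qed
  then obtain f d where f: "\<And>k. k < n \<Longrightarrow> f k \<in> multihom (d k)"
    "\<And>k x. k < n \<Longrightarrow> x \<in> multicone (W k) \<Longrightarrow> f k x = 0"
    "\<And>k. k < n \<Longrightarrow> \<exists>y\<in>multicone (W (Suc k)). f k y \<noteq> 0" by metis
  obtain p where p: "p \<in> W 0" using irr[of 0] by (auto simp: irreducible_closed_def)
  then obtain x0 where x0: "nonzero_blocks x0" "p = proj x0"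
    using irr[of 0] zariski_closed_subset multi_points_coords by (metis irreducible_closedD le0 subsetD)
  have x0W: "x0 \<in> multicone (W k)" if "k \<le> n" for k
    using x0 p mono[OF that] by (auto simp: multicone_def)
  obtain j where j: "\<And>i. x0 $ (i, j i) \<noteq> 0"
    using x0(1) unfolding nonzero_blocks_def block_def vec_eq_iff by (simp, metis)
  define M where "M = (\<lambda>(a :: 'm \<Rightarrow> nat) x. \<Prod>i\<in>UNIV. (x :: complex^('m \<times> 'n)) $ (i, j i) ^ a i)"
  have M: "M a \<in> multihom a" for a
  proof -
    have "M a \<in> multihom (\<lambda>i. \<Sum>k\<in>UNIV. a k * (if i = k then 1 else 0))"
      unfolding M_def by (intro multihom_prod multihom_power multihom_coord)
    moreover have "(\<Sum>k\<in>UNIV. a k * (if i = k then 1 else 0)) = a i" for i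
      by (simp add: if_distrib cong: if_cong)
    ultimately show ?thesis by simp
  qed
  have M0: "M a x0 \<noteq> 0" for a using j by (simp add: M_def)
  \<comment> \<open>Powers of coordinates that are nonzero at a point of \<open>W 0\<close> bring all functions to one multidegree.\<close>
  define e where "e = (\<lambda>i. \<Sum>k<n. d k i)"
  have de: "d k i \<le> e i" if "k < n" for k i
    unfolding e_def using that by (intro member_le_sum) auto
  define g where "g = (\<lambda>k x. f k x * M (\<lambda>i. e i - d k i) x)"
  have g: "g k \<in> multihom e" if "k < n" for k
  proof -
    have "g k \<in> multihom (\<lambda>i. d k i + (e i - d k i))" unfolding g_def by (intro multihom_mult f M that)
    moreover have "(\<lambda>i. d k i + (e i - d k i)) = e" using de[OF that] by auto
    ultimately show ?thesis by simp
  qed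
  have g0: "g k x = 0" if "k < n" "x \<in> multicone (W k)" for k x using f(2)[OF that] by (simp add: g_def)
  have gy: "\<exists>y\<in>multicone (W (Suc k)). g k y \<noteq> 0" if "k < n" for k
  proof (rule ccontr)
    assume "\<not> ?thesis"
    then have *: "f k x * M (\<lambda>i. e i - d k i) x = 0" if "x \<in> multicone (W (Suc k))" for x using that by (auto simp: g_def)
    have "f k x = 0" if "x \<in> multicone (W (Suc k))" for x
      by (rule irreducible_no_zero_divisors[OF irr f(1) M * x0W _ that]) (use \<open>k < n\<close> M0 in auto)
    then show False using f(3)[OF that] by blast
  qed
  have "\<exists>(J :: nat list set) G. finite J \<and> card J = (N + 1) ^ k \<and>
      (\<forall>q\<in>J. G q \<in> multihom (\<lambda>i. k * N * e i)) \<and>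
      (\<forall>c. (\<forall>x\<in>multicone (W k). (\<Sum>q\<in>J. c q * G q x) = 0) \<longrightarrow> (\<forall>q\<in>J. c q = 0))"
    if "k \<le> n" for k N
    using that
  proof (induction k)
    case 0
    show ?case
      by (rule exI[of _ "{[]}"], rule exI[of _ "\<lambda>_ _. 1"]) (use multihom_one x0W[of 0] in auto)
  next
    case (Suc k)
    have "k \<le> n" using Suc.prems by simp
    from Suc.IH[OF this] obtain J :: "nat list set" and G where J: "finite J" "card J = (N + 1) ^ k"
      "\<And>q. q \<in> J \<Longrightarrow> G q \<in> multihom (\<lambda>i. k * N * e i)"
      "\<And>c. (\<And>x. x \<in> multicone (W k) \<Longrightarrow> (\<Sum>q\<in>J. c q * G q x) = 0) \<Longrightarrow> \<forall>q\<in>J. c q = 0"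
      by blast
    have k: "k < n" using Suc.prems by simp
    define J' where "J' = (\<lambda>(r, q). r # q) ` ({..N} \<times> J)"
    define G' where "G' = (\<lambda>s x. G (tl s) x * g k x ^ hd s * M e x ^ (N - hd s))"
    have inj: "inj_on (\<lambda>(r, q). r # q) ({..N} \<times> J)" by (auto simp: inj_on_def)
    have sumJ': "(\<Sum>s\<in>J'. h s) = (\<Sum>r\<le>N. \<Sum>q\<in>J. h (r # q))" for h :: "nat list \<Rightarrow> complex"
      unfolding J'_def sum.reindex[OF inj] by (simp add: sum.cartesian_product case_prod_unfold)
    obtain y where y: "y \<in> multicone (W (Suc k))" "g k y \<noteq> 0" using gy[OF k] by blast
    show ?case
    proof (intro exI conjI allI impI ballI)
      show "finite J'" using J(1) by (simp add: J'_def)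
      show "card J' = (N + 1) ^ Suc k" unfolding J'_def card_image[OF inj] using J by (simp add: card_cartesian_product)
      show "G' s \<in> multihom (\<lambda>i. Suc k * N * e i)" if "s \<in> J'" for s
      proof -
        obtain r q where rq: "s = r # q" "r \<le> N" "q \<in> J" using \<open>s \<in> J'\<close> by (auto simp: J'_def)
        have "G' s \<in> multihom (\<lambda>i. k * N * e i + r * e i + (N - r) * e i)"
          unfolding G'_def rq list.sel by (intro multihom_mult multihom_power J rq g k M)
        moreover have "(\<lambda>i. k * N * e i + r * e i + (N - r) * e i) = (\<lambda>i. Suc k * N * e i)"
          using rq(2) by (auto simp: add_mult_distrib[symmetric])
        ultimately show ?thesis by simp
      qed
      fix c s assume c: "\<forall>x\<in>multicone (W (Suc k)). (\<Sum>q\<in>J'. c q * G' q x) = 0" and "s \<in> J'"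
      then obtain r q where rq: "s = r # q" "r \<le> N" "q \<in> J" by (auto simp: J'_def)
      have "\<forall>q\<in>J. c (r # q) = 0"
      proof (rule growth_step[where W = "W k" and W' = "W (Suc k)" and f = "M e" and g = "g k"
            and G = G and c = "\<lambda>r q. c (r # q)" and b = x0 and y = y])
        show "(\<Sum>r\<le>N. \<Sum>q\<in>J. c (r # q) * (G q x * g k x ^ r * M e x ^ (N - r))) = 0"
          if "x \<in> multicone (W (Suc k))" for x
          using c that by (simp add: sumJ' G'_def)
        show "\<forall>q\<in>J. c q = 0" if "\<And>x. x \<in> multicone (W k) \<Longrightarrow> (\<Sum>q\<in>J. c q * G q x) = 0" for c
          using J(4) that by blast
      qed (use irr lt k x0W M0 M g g0 y J rq in \<open>auto simp: less_imp_le\<close>)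
      then show "c s = 0" using rq by simp
    qed
  qed
  then show ?thesis using that[of e] by blast
qed

lemma card_bounded_exponents:
  "finite {\<mu> :: 'k::finite \<Rightarrow> nat. \<forall>j. \<mu> j \<le> M}"
  "card {\<mu> :: 'k::finite \<Rightarrow> nat. \<forall>j. \<mu> j \<le> M} = (M + 1) ^ CARD('k)"
proof -
  have *: "{\<mu> :: 'k \<Rightarrow> nat. \<forall>j. \<mu> j \<le> M} = PiE UNIV (\<lambda>_. {..M})" by (auto simp: PiE_def)
  show "finite {\<mu> :: 'k \<Rightarrow> nat. \<forall>j. \<mu> j \<le> M}" unfolding * by (rule finite_PiE) auto
  show "card {\<mu> :: 'k \<Rightarrow> nat. \<forall>j. \<mu> j \<le> M} = (M + 1) ^ CARD('k)" unfolding * by (simp add: card_PiE)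
qed

lemma multihom_compose_degree:
  fixes \<phi> :: "complex^'k::finite \<Rightarrow> complex^('m::finite \<times> 'n::finite)"
  assumes \<phi>: "\<And>k. (\<lambda>u. \<phi> u $ k) \<in> poly_fun {\<mu>. \<forall>j. \<mu> j \<le> 1}" and f: "f \<in> multihom d"
  shows "(\<lambda>u. f (\<phi> u)) \<in> poly_fun {\<mu>. \<forall>j. \<mu> j \<le> (\<Sum>i\<in>UNIV. d i)}"
proof -
  define B where "B = (\<lambda>M. poly_fun {\<mu> :: 'k \<Rightarrow> nat. \<forall>j. \<mu> j \<le> M})"
  have one: "(\<lambda>_. 1) \<in> B 0"
  proof -
    have "monomial_fun (\<lambda>_. 0) \<in> B 0" unfolding B_def by (rule poly_fun_monomial) simp
    then show ?thesis by (simp add: monomial_fun_def[abs_def])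
  qed
  have mult: "(\<lambda>u. f u * g u) \<in> B (M + N)" if "f \<in> B M" "g \<in> B N" for f g M N
    using that unfolding B_def by (rule poly_fun_mult) (auto intro: add_mono)
  have pow: "(\<lambda>u. f u ^ n) \<in> B n" if "f \<in> B 1" for f n
    by (induction n) (use one mult[OF that] in auto)
  have prod: "(\<lambda>u. \<Prod>k\<in>A. f k u) \<in> B (\<Sum>k\<in>A. N k)" if "\<And>k. k \<in> A \<Longrightarrow> f k \<in> B (N k)"
    for f N and A :: "('m \<times> 'n) set"
    using finite[of A] that by (induction A rule: finite_induct) (auto intro: one mult)
  have "(\<lambda>u. f (\<phi> u)) \<in> B (\<Sum>i\<in>UNIV. d i)"
    using f unfolding multihom_def
  proof (induction rule: poly_fun.induct)
    case zero
    then show ?case by (simp add: B_def poly_fun.zero)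
  next
    case (step \<mu> f c)
    have "(\<lambda>u. monomial_fun \<mu> (\<phi> u)) \<in> B (\<Sum>k\<in>UNIV. \<mu> k)"
      unfolding monomial_fun_def by (intro prod pow) (use \<phi> in \<open>simp add: B_def\<close>)
    also have "(\<Sum>k\<in>UNIV. \<mu> k) = (\<Sum>i\<in>UNIV. d i)"
    proof -
      have "(\<Sum>k\<in>UNIV. \<mu> k) = (\<Sum>i\<in>UNIV. \<Sum>j\<in>UNIV. \<mu> (i, j))"
        by (simp add: sum.cartesian_product)
      then show ?thesis using step(1) by simp
    qed
    finally show ?case using step(3) unfolding B_def by (intro poly_fun_add poly_fun_scale)
  qed
  then show ?thesis by (simp add: B_def)
qed

text \<open>The functions from \<open>chain_growth\<close> stay independent after the substitution \<open>\<phi>\<close>, because its image is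
  dense. There they are polynomials of degree \<open>O(N)\<close> in \<open>CARD('k)\<close> variables.\<close>

lemma krull_dim_le_parameters:
  fixes \<phi> :: "complex^'k::finite \<Rightarrow> complex^('m::finite \<times> 'n::finite)"
  assumes \<phi>: "\<And>k. (\<lambda>u. \<phi> u $ k) \<in> poly_fun {\<mu>. \<forall>j. \<mu> j \<le> 1}"
    and dense: "\<And>d f x. f \<in> multihom d \<Longrightarrow> (\<And>u. f (\<phi> u) = 0) \<Longrightarrow> x \<in> multicone X \<Longrightarrow> f x = 0"
  shows "krull_dim X \<le> enat CARD('k)"
  unfolding krull_dim_def
proof (rule Sup_least, clarify)
  fix n W assume W: "\<forall>k\<le>n. irreducible_closed (W k) \<and> W k \<subseteq> X" "\<forall>k<n. W k \<subset> W (Suc k)"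
  obtain e where e: "\<And>N. \<exists>(J :: nat list set) G. finite J \<and> card J = (N + 1) ^ n \<and>
      (\<forall>q\<in>J. G q \<in> multihom (\<lambda>i. n * N * e i)) \<and>
      (\<forall>c. (\<forall>x\<in>multicone (W n). (\<Sum>q\<in>J. c q * G q x) = 0) \<longrightarrow> (\<forall>q\<in>J. c q = 0))"
    by (rule chain_growth[of n W]) (use W in auto)
  define E where "E = (\<Sum>i\<in>UNIV. e i)"
  have bound: "(N + 1) ^ n \<le> (n * N * E + 1) ^ CARD('k)" for N
  proof (rule ccontr)
    assume *: "\<not> ?thesis"
    obtain J :: "nat list set" and G where J: "finite J" "card J = (N + 1) ^ n"
      "\<And>q. q \<in> J \<Longrightarrow> G q \<in> multihom (\<lambda>i. n * N * e i)"
      "\<And>c. (\<forall>x\<in>multicone (W n). (\<Sum>q\<in>J. c q * G q x) = 0) \<Longrightarrow> (\<forall>q\<in>J. c q = 0)"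
      using e[of N] by blast
    have "\<exists>c. (\<exists>q\<in>J. c q \<noteq> 0) \<and> (\<forall>u. (\<Sum>q\<in>J. c q * G q (\<phi> u)) = 0)"
    proof (rule poly_fun_linear_dependence[OF card_bounded_exponents(1)[of "n * N * E"] J(1)])
      show "card {\<mu> :: 'k \<Rightarrow> nat. \<forall>j. \<mu> j \<le> n * N * E} < card J"
        using * by (simp only: card_bounded_exponents J(2))
      show "(\<lambda>u. G q (\<phi> u)) \<in> poly_fun {\<mu>. \<forall>j. \<mu> j \<le> n * N * E}" if "q \<in> J" for q
        using multihom_compose_degree[OF \<phi> J(3)[OF that]] by (simp add: E_def sum_distrib_left)
    qed
    then obtain c where c: "\<exists>q\<in>J. c q \<noteq> 0" "\<And>u. (\<Sum>q\<in>J. c q * G q (\<phi> u)) = 0" by blast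
    have "(\<Sum>q\<in>J. c q * G q x) = 0" if "x \<in> multicone (W n)" for x
    proof (rule dense)
      show "(\<lambda>x. \<Sum>q\<in>J. c q * G q x) \<in> multihom (\<lambda>i. n * N * e i)"
        by (intro multihom_sum multihom_scale J)
      show "x \<in> multicone X" using that W(1) by (auto simp: multicone_def)
    qed (rule c(2))
    then show False using J(4) c(1) by blast
  qed
  show "enat n \<le> enat CARD('k)"
  proof (rule ccontr)
    assume "\<not> ?thesis"
    then have n: "Suc CARD('k) \<le> n" by (simp only: enat_ord_simps)
    \<comment> \<open>With this \<open>N\<close> the bound for a chain that is too long reads
      \<open>(N + 1)^(k + 1) \<le> N (N + 1)^k\<close>, where \<open>k = CARD('k)\<close>.\<close>
    define N where "N = (n * E + 1) ^ CARD('k)"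
    have "(N + 1) ^ Suc CARD('k) \<le> (N + 1) ^ n" using n by (intro power_increasing) auto
    also have "\<dots> \<le> (n * N * E + 1) ^ CARD('k)" by (rule bound)
    also have "\<dots> \<le> ((n * E + 1) * (N + 1)) ^ CARD('k)" by (intro power_mono) (auto simp: algebra_simps)
    also have "\<dots> = N * (N + 1) ^ CARD('k)" by (simp only: power_mult_distrib N_def)
    finally have "(N + 1) * (N + 1) ^ CARD('k) \<le> N * (N + 1) ^ CARD('k)" by simp
    then show False by simp
  qed
qed

section \<open>Tangent spaces\<close>

text \<open>The differential is continuous in the point and the direction together; the semicontinuity of the tangent
  space rests on this.\<close>

lemma poly_fun_differential:
  fixes f :: "complex^'k::finite \<Rightarrow> complex"
  assumes "f \<in> poly_fun S"
  shows "\<exists>D. (\<forall>\<phi> v z. (\<forall>k. ((\<lambda>t. \<phi> t $ k) has_field_derivative v $ k) (at z)) \<longrightarrow>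
        ((\<lambda>t. f (\<phi> t)) has_field_derivative D (\<phi> z) v) (at z)) \<and>
    (\<forall>x v w. D x (v + w) = D x v + D x w) \<and> (\<forall>x c v. D x (c *s v) = c * D x v) \<and>
    continuous_on UNIV (\<lambda>p. D (fst p) (snd p))"
  using assms
proof (induction rule: poly_fun.induct)
  case zero
  show ?case by (rule exI[of _ "\<lambda>_ _. 0"]) auto
next
  case (step \<mu> f c)
  then obtain D where D:
    "\<And>\<phi> v z. (\<And>k. ((\<lambda>t. \<phi> t $ k) has_field_derivative v $ k) (at z)) \<Longrightarrow>
        ((\<lambda>t. f (\<phi> t)) has_field_derivative D (\<phi> z) v) (at z)"
    "\<And>x v w. D x (v + w) = D x v + D x w" "\<And>x c v. D x (c *s v) = c * D x v"
    "continuous_on UNIV (\<lambda>p. D (fst p) (snd p))" by blast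
  define E where "E = (\<lambda>(x::complex^'k) (v::complex^'k). \<Sum>k\<in>UNIV.
    of_nat (\<mu> k) * (x $ k) ^ (\<mu> k - 1) * v $ k * (\<Prod>j\<in>UNIV - {k}. (x $ j) ^ \<mu> j))"
  have E: "((\<lambda>t. monomial_fun \<mu> (\<phi> t)) has_field_derivative E (\<phi> z) v) (at z)"
    if "\<And>k. ((\<lambda>t. \<phi> t $ k) has_field_derivative v $ k) (at z)" for \<phi> :: "complex \<Rightarrow> complex^'k" and v z
  proof -
    have 1: "((\<lambda>t. (\<phi> t $ k) ^ \<mu> k) has_field_derivative of_nat (\<mu> k) * (\<phi> z $ k) ^ (\<mu> k - 1) * v $ k) (at z)" for k
      by (rule DERIV_cong[OF DERIV_power[OF that]]) (simp add: mult_ac)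
    show ?thesis unfolding monomial_fun_def E_def
      by (rule DERIV_cong[OF has_field_derivative_prod[OF 1]]) (simp add: mult_ac)
  qed
  show ?case
  proof (intro exI[of _ "\<lambda>x v. c * E x v + D x v"] conjI allI impI)
    fix \<phi> :: "complex \<Rightarrow> complex^'k" and v z
    assume "\<forall>k. ((\<lambda>t. \<phi> t $ k) has_field_derivative v $ k) (at z)"
    then show "((\<lambda>t. c * monomial_fun \<mu> (\<phi> t) + f (\<phi> t)) has_field_derivative c * E (\<phi> z) v + D (\<phi> z) v) (at z)"
      by (intro DERIV_add DERIV_cmult E D(1)) auto
  next
    fix x v w :: "complex^'k" and a
    show "c * E x (v + w) + D x (v + w) = c * E x v + D x v + (c * E x w + D x w)"
      by (simp add: E_def D(2) algebra_simps sum.distrib)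
    show "c * E x (a *s v) + D x (a *s v) = a * (c * E x v + D x v)"
      by (simp add: E_def D(3) algebra_simps sum_distrib_left)
  next
    show "continuous_on UNIV (\<lambda>p. c * E (fst p) (snd p) + D (fst p) (snd p))"
      unfolding E_def by (intro continuous_intros D(4))
  qed
qed


definition differential :: "(complex^'k \<Rightarrow> complex) \<Rightarrow> complex^'k \<Rightarrow> complex^'k \<Rightarrow> complex" where
  "differential f x v = deriv (\<lambda>t. f (x + t *s v)) 0"

lemma differential_facts:
  fixes f :: "complex^'k::finite \<Rightarrow> complex"
  assumes "f \<in> poly_fun S"
  shows "(\<And>k. ((\<lambda>t. \<phi> t $ k) has_field_derivative v $ k) (at z)) \<Longrightarrow>
      ((\<lambda>t. f (\<phi> t)) has_field_derivative differential f (\<phi> z) v) (at z)"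
    and "differential f x (v + w) = differential f x v + differential f x w"
    and "differential f x (c *s v) = c * differential f x v"
    and "continuous_on UNIV (\<lambda>p. differential f (fst p) (snd p))"
proof -
  obtain D where D:
    "\<And>\<phi> v z. (\<And>k. ((\<lambda>t. \<phi> t $ k) has_field_derivative v $ k) (at z)) \<Longrightarrow>
        ((\<lambda>t. f (\<phi> t)) has_field_derivative D (\<phi> z) v) (at z)"
    "\<And>x v w. D x (v + w) = D x v + D x w"
    "\<And>x c v. D x (c *s v) = c * D x v"
    "continuous_on UNIV (\<lambda>p. D (fst p) (snd p))"
    using poly_fun_differential[OF assms] by blast
  have "differential f x v = D x v" for x v
  proof -
    have "((\<lambda>t. (x + t *s v) $ k) has_field_derivative v $ k) (at 0)" for k
      by (auto intro!: derivative_eq_intros)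
    from D(1)[of "\<lambda>t. x + t *s v", OF this]
    have "((\<lambda>t. f (x + t *s v)) has_field_derivative D (x + 0 *s v) v) (at 0)" .
    then show ?thesis unfolding differential_def by (simp add: DERIV_imp_deriv)
  qed
  then have *: "differential f = D" by (intro ext)
  show "(\<And>k. ((\<lambda>t. \<phi> t $ k) has_field_derivative v $ k) (at z)) \<Longrightarrow>
      ((\<lambda>t. f (\<phi> t)) has_field_derivative differential f (\<phi> z) v) (at z)"
    "differential f x (v + w) = differential f x v + differential f x w"
    "differential f x (c *s v) = c * differential f x v"
    "continuous_on UNIV (\<lambda>p. differential f (fst p) (snd p))"
    unfolding * by (fact D)+
qed

lemma mem_cone_tangent_space:
  fixes X :: "('m::finite \<Rightarrow> (complex^'n::finite) set) set"
  assumes "X \<subseteq> multi_points"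
  shows "v \<in> cone_tangent_space X x \<longleftrightarrow>
    (\<forall>d f. f \<in> multihom d \<longrightarrow> (\<forall>y\<in>multicone X. f y = 0) \<longrightarrow> differential f x v = 0)"
proof -
  have van: "(\<forall>p\<in>X. vanishes_at F p) \<longleftrightarrow> (\<forall>y\<in>multicone X. mpoly_eval F y = 0)"
    if F: "mpoly_eval F \<in> multihom d" for F :: "('m, 'n) mpoly" and d
  proof
    assume *: "\<forall>p\<in>X. vanishes_at F p"
    show "\<forall>y\<in>multicone X. mpoly_eval F y = 0"
      using * vanishes_at_proj[OF F] by (auto simp: multicone_def)
  next
    assume *: "\<forall>y\<in>multicone X. mpoly_eval F y = 0"
    show "\<forall>p\<in>X. vanishes_at F p"
    proof
      fix p assume "p \<in> X"
      then obtain y where y: "nonzero_blocks y" "p = proj y" using assms by (blast elim: multi_points_coords)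
      then show "vanishes_at F p" using vanishes_at_proj[OF F y(1)] * \<open>p \<in> X\<close> by (simp add: multicone_def)
    qed
  qed
  have "v \<in> cone_tangent_space X x \<longleftrightarrow> (\<forall>F\<in>vanishing_polys X. differential (mpoly_eval F) x v = 0)"
    by (simp add: cone_tangent_space_def differential_def)
  also have "\<dots> \<longleftrightarrow> (\<forall>d f. f \<in> multihom d \<longrightarrow> (\<forall>y\<in>multicone X. f y = 0) \<longrightarrow> differential f x v = 0)"
  proof (intro iffI allI impI ballI)
    fix d f
    assume *: "\<forall>F\<in>vanishing_polys X. differential (mpoly_eval F) x v = 0"
      and f: "f \<in> multihom d" "\<forall>y\<in>multicone X. f y = 0"
    obtain F where F: "multihomogeneous F" "mpoly_eval F = f" by (rule multihom_multihomogeneous[OF f(1)])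
    have "F \<in> vanishing_polys X"
      using van[of F d] F f by (simp add: vanishing_polys_def)
    then show "differential f x v = 0" using * F(2) by auto
  next
    fix F
    assume *: "\<forall>d f. f \<in> multihom d \<longrightarrow> (\<forall>y\<in>multicone X. f y = 0) \<longrightarrow> differential f x v = 0"
      and F: "F \<in> vanishing_polys X"
    obtain d where d: "mpoly_eval F \<in> multihom d"
      using F multihomogeneous_multihom[of F] by (auto simp: vanishing_polys_def)
    then show "differential (mpoly_eval F) x v = 0"
      using * van[OF d] F by (auto simp: vanishing_polys_def)
  qed
  finally show ?thesis .
qed

lemma subspace_cone_tangent_space:
  fixes X :: "('m::finite \<Rightarrow> (complex^'n::finite) set) set"
  assumes "X \<subseteq> multi_points"
  shows "vec.subspace (cone_tangent_space X x)"
proof (rule vec.subspaceI)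
  show "0 \<in> cone_tangent_space X x" unfolding mem_cone_tangent_space[OF assms]
  proof (intro allI impI)
    fix d and f :: "complex^('m \<times> 'n) \<Rightarrow> complex" assume f: "f \<in> multihom d"
    show "differential f x 0 = 0"
      using differential_facts(3)[OF f[unfolded multihom_def], of x 0 0] by simp
  qed
next
  fix v w assume vw: "v \<in> cone_tangent_space X x" "w \<in> cone_tangent_space X x"
  show "v + w \<in> cone_tangent_space X x" unfolding mem_cone_tangent_space[OF assms]
  proof (intro allI impI)
    fix d and f :: "complex^('m \<times> 'n) \<Rightarrow> complex"
    assume f: "f \<in> multihom d" "\<forall>y\<in>multicone X. f y = 0"
    have "differential f x v = 0" "differential f x w = 0"
      using vw f unfolding mem_cone_tangent_space[OF assms] by blast+
    then show "differential f x (v + w) = 0"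
      unfolding differential_facts(2)[OF f(1)[unfolded multihom_def]] by simp
  qed
next
  fix c v assume v: "v \<in> cone_tangent_space X x"
  show "c *s v \<in> cone_tangent_space X x" unfolding mem_cone_tangent_space[OF assms]
  proof (intro allI impI)
    fix d and f :: "complex^('m \<times> 'n) \<Rightarrow> complex"
    assume f: "f \<in> multihom d" "\<forall>y\<in>multicone X. f y = 0"
    have "differential f x v = 0"
      using v f unfolding mem_cone_tangent_space[OF assms] by blast
    then show "differential f x (c *s v) = 0"
      unfolding differential_facts(3)[OF f(1)[unfolded multihom_def]] by simp
  qed
qed

lemma curve_tangent:
  assumes "X \<subseteq> multi_points"
    and \<phi>: "\<And>k. ((\<lambda>t. \<phi> t $ k) has_field_derivative v $ k) (at 0)" "\<phi> 0 = x"
    and 0: "\<And>d f t. f \<in> multihom d \<Longrightarrow> (\<And>y. y \<in> multicone X \<Longrightarrow> f y = 0) \<Longrightarrow> f (\<phi> t) = 0"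
  shows "v \<in> cone_tangent_space X x"
  unfolding mem_cone_tangent_space[OF assms(1)]
proof (intro allI impI)
  fix d f assume f: "f \<in> multihom d" "\<forall>y\<in>multicone X. f y = 0"
  have "((\<lambda>t. f (\<phi> t)) has_field_derivative differential f (\<phi> 0) v) (at 0)"
    by (rule differential_facts(1)[OF f(1)[unfolded multihom_def] \<phi>(1)])
  moreover have "(\<lambda>t. f (\<phi> t)) = (\<lambda>_. 0)" using 0[OF f(1)] f(2) by auto
  ultimately have "((\<lambda>t. 0) has_field_derivative differential f x v) (at 0)" using \<phi>(2) by simp
  then show "differential f x v = 0" by (rule DERIV_unique) (rule DERIV_const)
qed

lemma vec_complement:
  fixes T :: "(complex^'k) set"
  assumes "vec.subspace T"
  obtains U where "vec.subspace U" "T \<inter> U = {0}" "vec.dim T + vec.dim U = CARD('k)"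
proof -
  obtain B where B: "B \<subseteq> T" "vec.independent B" "T \<subseteq> vec.span B" "card B = vec.dim T"
    using vec.basis_exists by blast
  define B' where "B' = vec.extend_basis B"
  have B': "B \<subseteq> B'" "vec.independent B'" "vec.span B' = UNIV"
    using vec.extend_basis_superset[OF B(2)] vec.independent_extend_basis[OF B(2)] vec.span_extend_basis[OF B(2)]
    by (simp_all add: B'_def)
  have fin: "finite B'" using B'(2) by (rule vec.finiteI_independent)
  have "card B' = CARD('k)"
    using vec.dim_eq_card_independent[OF B'(2)] vec.dim_span[of B'] B'(3) by (simp add: vec_dim_card card_cart_basis)
  have T: "T = vec.span B" using B(1,3) assms vec.span_minimal[of B T] by blast
  define U where "U = vec.span (B' - B)"
  have "vec.independent (B' - B)" using B'(2) vec.independent_mono by blast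
  then have "vec.dim U = card (B' - B)" by (simp add: U_def vec.dim_eq_card_independent)
  then have d: "vec.dim T + vec.dim U = CARD('k)"
    using B(4) fin B'(1) \<open>card B' = CARD('k)\<close> by (metis card_Diff_subset card_mono finite_subset le_add_diff_inverse)
  have "{x + y |x y. x \<in> T \<and> y \<in> U} = UNIV"
  proof -
    have "B \<union> (B' - B) = B'" using B'(1) by blast
    then have "vec.span (B \<union> (B' - B)) = UNIV" using B'(3) by simp
    then show ?thesis unfolding vec.span_Un T U_def by simp
  qed
  then have "vec.dim (T \<inter> U) = 0"
    using vec.dim_sums_Int[of T U] assms d by (simp add: U_def vec.subspace_span vec_dim_card card_cart_basis)
  then have "T \<inter> U \<subseteq> {0}" by (simp add: vec.dim_eq_0)
  then have "T \<inter> U = {0}" using assms by (auto simp: U_def vec.subspace_0 vec.span_zero)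
  then show ?thesis using that[of U] d by (simp add: U_def vec.subspace_span)
qed

lemma vec_subspace_closed:
  fixes U :: "(complex^'k) set"
  assumes "vec.subspace U"
  shows "closed U"
proof (rule closed_subspace)
  show "subspace U" unfolding subspace_def scaleR_eq_scale
    using assms by (auto simp: vec.subspace_def)
qed

text \<open>Let \<open>U\<close> be a complement of the tangent space at the limit. If the tangent spaces along the sequence were
  larger, each would meet \<open>U\<close> in a unit vector. A limit of these vectors lies in \<open>U\<close> and is tangent at
  the limit.\<close>

lemma dim_tangent_semicontinuous:
  fixes X :: "('m::finite \<Rightarrow> (complex^'n::finite) set) set"
  assumes X: "X \<subseteq> multi_points" and lim: "xs \<longlonglongrightarrow> x"
    and d: "\<And>n :: nat. d \<le> vec.dim (cone_tangent_space X (xs n))"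
  shows "d \<le> vec.dim (cone_tangent_space X x)"
proof (rule ccontr)
  assume *: "\<not> ?thesis"
  note sub = subspace_cone_tangent_space[OF X]
  obtain U where U: "vec.subspace U" "cone_tangent_space X x \<inter> U = {0}"
    "vec.dim (cone_tangent_space X x) + vec.dim U = CARD('m \<times> 'n)"
    by (rule vec_complement[OF sub]) (rule that)
  have "\<exists>u. u \<in> U \<inter> cone_tangent_space X (xs n) \<and> norm u = 1" for n
  proof -
    have "vec.dim {a + b |a b. a \<in> cone_tangent_space X (xs n) \<and> b \<in> U} \<le> CARD('m \<times> 'n)"
      by (rule dim_subset_UNIV_cart_gen)
    then have "vec.dim (cone_tangent_space X (xs n) \<inter> U) \<noteq> 0"
      using vec.dim_sums_Int[OF sub[of "xs n"] U(1)] U(3) * d[of n] by linarith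
    then obtain u where u: "u \<in> cone_tangent_space X (xs n)" "u \<in> U" "u \<noteq> 0"
      by (auto simp: vec.dim_eq_0)
    have "(1 / norm u) *\<^sub>R u \<in> cone_tangent_space X (xs n)" "(1 / norm u) *\<^sub>R u \<in> U"
      unfolding scaleR_eq_scale using u U(1) sub by (auto intro: vec.subspace_scale)
    then show ?thesis using u(3) by (intro exI[of _ "(1 / norm u) *\<^sub>R u"]) auto
  qed
  then obtain u where u: "\<And>n. u n \<in> U" "\<And>n. u n \<in> cone_tangent_space X (xs n)" "\<And>n. u n \<in> sphere 0 1"
    by (simp add: dist_norm) metis
  have "compact (sphere 0 1 :: (complex^('m \<times> 'n)) set)" by (rule compact_sphere)
  then obtain l r where l: "l \<in> sphere 0 1" "strict_mono r" "(u \<circ> r) \<longlonglongrightarrow> l"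
    using u(3) unfolding compact_def by metis
  have "l \<in> U"
    by (rule closed_sequentially[OF vec_subspace_closed[OF U(1)] _ l(3)]) (simp add: u(1))
  moreover have "l \<in> cone_tangent_space X x"
    unfolding mem_cone_tangent_space[OF X]
  proof (intro allI impI)
    fix d f assume f: "f \<in> multihom d" "\<forall>y\<in>multicone X. f y = 0"
    have "(\<lambda>n. ((xs \<circ> r) n, (u \<circ> r) n)) \<longlonglongrightarrow> (x, l)"
      by (intro tendsto_Pair l(3) LIMSEQ_subseq_LIMSEQ[OF lim l(2)])
    then have "(\<lambda>n. differential f (fst ((xs \<circ> r) n, (u \<circ> r) n)) (snd ((xs \<circ> r) n, (u \<circ> r) n)))
        \<longlonglongrightarrow> differential f (fst (x, l)) (snd (x, l))"
      by (rule continuous_on_tendsto_compose[OF differential_facts(4)[OF f(1)[unfolded multihom_def]]]) auto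
    moreover have "differential f (xs (r n)) (u (r n)) = 0" for n
      using u(2)[of "r n"] f unfolding mem_cone_tangent_space[OF X] by blast
    ultimately have "(\<lambda>n. 0) \<longlonglongrightarrow> differential f x l" by simp
    then show "differential f x l = 0" by (simp add: LIMSEQ_const_iff)
  qed
  ultimately have "l = 0" using U(2) by blast
  then show False using l(1) by simp
qed

definition of_blocks :: "('m::finite \<Rightarrow> complex^'n::finite) \<Rightarrow> complex^('m \<times> 'n)" where
  "of_blocks l = (\<chi> k. l (fst k) $ snd k)"

lemma block_of_blocks [simp]: "block (of_blocks l) i = l i"
  by (simp add: block_def of_blocks_def vec_eq_iff)

lemma block_simps [simp]:
  "block (x + y) i = block x i + block y i" "block (x - y) i = block x i - block y i"
  "block (c *s x) i = c *s block x i" "block 0 i = 0"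
  by (simp_all add: block_def vec_eq_iff)

lemma block_sum: "block (sum f A) i = (\<Sum>a\<in>A. block (f a) i)"
  by (induction A rule: infinite_finite_induct) auto

lemma has_derivative_of_blocks:
  "(\<And>i j. ((\<lambda>t. l t i $ j) has_field_derivative v i $ j) (at z)) \<Longrightarrow>
    ((\<lambda>t. of_blocks (l t) $ k) has_field_derivative of_blocks v $ k) (at z)"
  by (simp add: of_blocks_def)

text \<open>Rescaling one block of coordinates does not leave the multicone.\<close>

lemma scale_block_tangent:
  fixes X :: "('m::finite \<Rightarrow> (complex^'n::finite) set) set"
  assumes X: "X \<subseteq> multi_points" and x: "x \<in> multicone X"
  shows "of_blocks (\<lambda>i. if i = k then block x k else 0) \<in> cone_tangent_space X x"
proof (rule curve_tangent[OF X, where \<phi> = "\<lambda>t. of_blocks (\<lambda>i. (if i = k then 1 + t else 1) *s block x i)"])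
  show "((\<lambda>t. of_blocks (\<lambda>i. (if i = k then 1 + t else 1) *s block x i) $ q)
      has_field_derivative of_blocks (\<lambda>i. if i = k then block x k else 0) $ q) (at 0)" for q
    by (rule has_derivative_of_blocks) (auto intro!: derivative_eq_intros)
  show "of_blocks (\<lambda>i. (if i = k then 1 + 0 else 1) *s block x i) = x"
    by (rule vec_block_eqI) simp
  fix d t and f :: "complex^('m \<times> 'n) \<Rightarrow> complex"
  assume f: "f \<in> multihom d" "\<And>y. y \<in> multicone X \<Longrightarrow> f y = 0"
  have "of_blocks (\<lambda>i. (if i = k then 1 + t else 1) *s block x i)
      = (\<chi> q. (if fst q = k then 1 + t else 1) * x $ q)"
    by (simp add: of_blocks_def block_def)
  then show "f (of_blocks (\<lambda>i. (if i = k then 1 + t else 1) *s block x i)) = 0"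
    using multihom_scaling[OF f(1), of "\<lambda>i. if i = k then 1 + t else 1" x] f(2)[OF x] by simp
qed

section \<open>The cross product and pinhole cameras\<close>

lemma bil_3: "bil u v = u $ 1 * v $ 1 + u $ 2 * v $ 2 + u $ 3 * v $ (3::3)"
  by (simp add: bil_def sum_3)

definition cross :: "complex^3 \<Rightarrow> complex^3 \<Rightarrow> complex^3" where
  "cross u v = vector [u$2 * v$3 - u$3 * v$2, u$3 * v$1 - u$1 * v$3, u$1 * v$2 - u$2 * v$1]"

lemma cross_nth [simp]:
  "cross u v $ 1 = u$2 * v$3 - u$3 * v$2" "cross u v $ 2 = u$3 * v$1 - u$1 * v$3"
  "cross u v $ 3 = u$1 * v$2 - u$2 * v$1"
  by (simp_all add: cross_def)

lemma cross_simps [simp]: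
  "cross (u + v) w = cross u w + cross v w" "cross u (v + w) = cross u v + cross u w"
  "cross (u - v) w = cross u w - cross v w" "cross u (v - w) = cross u v - cross u w"
  "cross (c *s u) v = c *s cross u v" "cross u (c *s v) = c *s cross u v"
  "cross 0 v = 0" "cross u 0 = 0" "cross u u = 0"
  by (simp_all add: vec_eq_iff forall_3 algebra_simps)

lemma cross_commute: "cross v u = - cross u v"
  by (simp add: vec_eq_iff forall_3)

lemma bil_cross [simp]: "bil (cross u v) u = 0" "bil (cross u v) v = 0"
  by (simp_all add: bil_3 algebra_simps)

lemmas camera_simps = matrix_vector_right_distrib matrix_vector_mult_diff_distrib vector_scalar_commute

lemma cross_eq_0_parallel:
  assumes "cross u v = 0" "u \<noteq> 0"
  obtains c where "v = c *s u"
proof -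
  have e: "u$2 * v$3 = u$3 * v$2" "u$3 * v$1 = u$1 * v$3" "u$1 * v$2 = u$2 * v$1"
    using assms(1) by (simp_all add: vec_eq_iff forall_3)
  obtain k where "u $ k \<noteq> 0" using assms(2) by (auto simp: vec_eq_iff)
  moreover have "k = 1 \<or> k = 2 \<or> k = 3" by (rule exhaust_3)
  ultimately have "v = (v $ k / u $ k) *s u" using e
    by (auto simp: vec_eq_iff forall_3 field_simps)
  then show ?thesis using that by blast
qed

lemma orthogonal_to_two:
  assumes "bil l u = 0" "bil l v = 0" "cross u v \<noteq> 0"
  obtains c where "l = c *s cross u v"
proof -
  define n where "n = cross u v"
  have "cross n l = 0"
  proof -
    have "cross n l = bil l u *s v - bil l v *s u"
      by (simp add: n_def vec_eq_iff forall_3 bil_3 algebra_simps)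
    then show ?thesis using assms by simp
  qed
  then show ?thesis using cross_eq_0_parallel[of n l] assms(3) that by (metis n_def)
qed

lemma cramer_3:
  assumes "bil (cross u v) w \<noteq> 0"
  obtains p q r where "z = p *s u + q *s v + r *s w"
proof -
  define D where "D = bil (cross u v) w"
  have "D *s z = bil (cross v w) z *s u + bil (cross w u) z *s v + bil (cross u v) z *s w"
    by (simp add: D_def vec_eq_iff forall_3 bil_3 algebra_simps)
  then have "z = (1 / D) *s (bil (cross v w) z *s u + bil (cross w u) z *s v + bil (cross u v) z *s w)"
    using assms by (metis D_def divide_self_if vec.scale_one vec.scale_scale times_divide_eq_left mult_1)
  then show ?thesis using that by (simp add: vec.scale_right_distrib)
qed

lemma pinhole_camera_kernel:
  assumes "pinhole_camera C"
  obtains e where "e \<noteq> 0" "\<And>z. C *v z = 0 \<longleftrightarrow> (\<exists>c. z = c *s e)" "\<And>w. \<exists>z. C *v z = w"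
    "center C = vec.span {e}"
proof -
  have rk: "vec.dim (rows C) = 3"
    using assms by (simp add: pinhole_camera_def row_rank_def_gen)
  have indep: "\<forall>i. c i = 0" if "(\<Sum>i\<in>UNIV. c i *s row i C) = 0" for c
  proof (rule ccontr)
    assume "\<not> ?thesis"
    then obtain k where k: "c k \<noteq> 0" by blast
    define R where "R = (\<lambda>i. row i C) ` (UNIV - {k})"
    have "c k *s row k C = - (\<Sum>i\<in>UNIV - {k}. c i *s row i C)"
      using that by (simp add: sum.remove[of UNIV k] add_eq_0_iff)
    then have "row k C = (- 1 / c k) *s (\<Sum>i\<in>UNIV - {k}. c i *s row i C)"
      using k by (simp add: vec_eq_iff field_simps)
    moreover have "(\<Sum>i\<in>UNIV - {k}. c i *s row i C) \<in> vec.span R"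
      by (intro vec.span_sum vec.span_scale vec.span_base) (auto simp: R_def)
    ultimately have "row k C \<in> vec.span R" by (simp only: vec.span_scale)
    then have "rows C \<subseteq> vec.span R"
      by (auto simp: rows_def R_def intro: vec.span_base)
    then have "vec.dim (rows C) \<le> card R" by (intro vec.dim_le_card) (auto simp: R_def)
    also have "card R \<le> card (UNIV - {k})" unfolding R_def by (intro card_image_le) simp
    also have "\<dots> = 2" by simp
    finally show False using rk by simp
  qed
  have "\<exists>B. C ** B = mat 1"
    unfolding matrix_right_invertible_independent_rows using indep by blast
  then obtain B where B: "C ** B = mat 1" by blast
  then have surj: "C *v (B *v w) = w" for w by (simp add: matrix_vector_mul_assoc)
  define K where "K = {z. C *v z = 0}"
  have sK: "vec.subspace K" by (auto simp: K_def vec.subspace_def camera_simps)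
  define I where "I = range (\<lambda>w. B *v w)"
  have sI: "vec.subspace I" unfolding I_def
    by (rule matrix_vector_mul_linear_gen[THEN Vector_Spaces.linear.axioms(3), THEN module_hom.subspace_image]) (rule vec.subspace_UNIV)
  have "inj (\<lambda>w. B *v w)" by (rule inj_on_inverseI[of _ "\<lambda>z. C *v z"]) (rule surj)
  then have dI: "vec.dim I = 3"
    unfolding I_def by (subst vec.dim_image_eq) (auto simp: card_cart_basis)
  have "K \<inter> I = {0}"
    by (auto simp: K_def I_def surj) (metis matrix_vector_mult_0_right surj rangeI)
  moreover have "{x + y |x y. x \<in> K \<and> y \<in> I} = UNIV"
  proof -
    have "\<exists>x y. z = x + y \<and> x \<in> K \<and> y \<in> I" for z
      by (rule exI[of _ "z - B *v (C *v z)"], rule exI[of _ "B *v (C *v z)"])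
        (auto simp: K_def I_def matrix_vector_mult_diff_distrib surj)
    then show ?thesis by auto
  qed
  ultimately have dK: "vec.dim K = 1"
    using vec.dim_sums_Int[OF sK sI] dI by (simp add: card_cart_basis)
  then have "K \<in> proj_points" using sK by (simp add: proj_flats_def)
  then obtain e where e: "e \<in> K" "e \<noteq> 0" by (rule proj_point_nonzero)
  have K: "K = vec.span {e}" using proj_point_eq_span[OF \<open>K \<in> proj_points\<close> e] .
  show ?thesis
  proof (rule that[OF e(2)])
    show "C *v z = 0 \<longleftrightarrow> (\<exists>c. z = c *s e)" for z
      using K by (auto simp: K_def vec.span_singleton set_eq_iff)
    show "\<exists>z. C *v z = w" for w using surj by blast
    show "center C = vec.span {e}" using K by (simp add: center_def K_def)
  qed
qed

text \<open>A vector \<open>e i\<close> is chosen in each kernel, so that the hypothesis on collinear centers becomes linear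
  independence.\<close>

locale camera_arrangement =
  fixes C :: "'m::finite \<Rightarrow> complex^4^3" and e :: "'m \<Rightarrow> complex^4"
  assumes e0: "e i \<noteq> 0"
    and kernel: "C i *v z = 0 \<longleftrightarrow> (\<exists>c. z = c *s e i)"
    and surj: "\<exists>z. C i *v z = w"
    and center: "center (C i) = vec.span {e i}"
    and no_three_collinear: "i \<noteq> j \<Longrightarrow> i \<noteq> k \<Longrightarrow> j \<noteq> k \<Longrightarrow>
      p *s e i + q *s e j + r *s e k = 0 \<Longrightarrow> p = 0 \<and> q = 0 \<and> r = 0"
    and card3: "CARD('m) \<ge> 3"
begin

lemma third_camera:
  fixes i j :: 'm
  obtains k where "k \<noteq> i" "k \<noteq> j"
proof -
  have "\<not> UNIV \<subseteq> {i, j}"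
  proof
    assume "UNIV \<subseteq> {i, j}"
    then have "CARD('m) \<le> card {i, j}" by (metis card_mono finite.emptyI finite.insertI)
    also have "\<dots> \<le> 2" by (simp add: card_insert_if)
    finally show False using card3 by simp
  qed
  then show ?thesis using that by blast
qed

lemma distinct_centers:
  assumes "i \<noteq> j" "p *s e i + q *s e j = 0" shows "p = 0 \<and> q = 0"
proof -
  obtain k where "k \<noteq> i" "k \<noteq> j" by (rule third_camera)
  then show ?thesis using no_three_collinear[of i j k p q 0] assms by auto
qed

lemma image_of_center [simp]: "C i *v e i = 0"
  using kernel[of i "e i"] by (metis vec.scale_one)

lemma image_of_other_center:
  assumes "i \<noteq> j" shows "C i *v e j \<noteq> 0"
proof
  assume "C i *v e j = 0"
  then obtain c where "e j = c *s e i" using kernel by blast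
  then have "(-c) *s e i + 1 *s e j = 0" by simp
  then show False using distinct_centers[OF assms, of "-c" 1] by simp
qed

abbreviation image_line :: "'m \<Rightarrow> complex^4 \<Rightarrow> complex^4 \<Rightarrow> complex^3" where
  "image_line i x y \<equiv> cross (C i *v x) (C i *v y)"

text \<open>A determinant: it vanishes when \<open>x\<close>, \<open>y\<close>, \<open>z\<close> and the center of camera \<open>i\<close> are coplanar.\<close>

abbreviation vol :: "'m \<Rightarrow> complex^4 \<Rightarrow> complex^4 \<Rightarrow> complex^4 \<Rightarrow> complex" where
  "vol i x y z \<equiv> bil (image_line i x y) (C i *v z)"

text \<open>A nontrivial combination in the kernel is the center, if it lies on the line, or zero, if \<open>x\<close> and \<open>y\<close>
  are proportional.\<close>

lemma cross_ne_iff: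
  "image_line i x y \<noteq> 0 \<longleftrightarrow> (\<forall>p q. C i *v (p *s x + q *s y) = 0 \<longrightarrow> p = 0 \<and> q = 0)"
proof
  assume c: "image_line i x y \<noteq> 0"
  show "\<forall>p q. C i *v (p *s x + q *s y) = 0 \<longrightarrow> p = 0 \<and> q = 0"
  proof (intro allI impI)
    fix p q assume "C i *v (p *s x + q *s y) = 0"
    then have 0: "p *s (C i *v x) + q *s (C i *v y) = 0"
      by (simp add: camera_simps)
    have "cross (p *s (C i *v x) + q *s (C i *v y)) (C i *v y) = p *s image_line i x y"
      "cross (C i *v x) (p *s (C i *v x) + q *s (C i *v y)) = q *s image_line i x y"
      by simp_all
    then have "p *s image_line i x y = 0" "q *s image_line i x y = 0"
      by (simp_all only: 0 cross_simps)
    then show "p = 0 \<and> q = 0" using c by simp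
  qed
next
  assume *: "\<forall>p q. C i *v (p *s x + q *s y) = 0 \<longrightarrow> p = 0 \<and> q = 0"
  show "image_line i x y \<noteq> 0"
  proof
    assume c: "image_line i x y = 0"
    have "C i *v x \<noteq> 0" using *[rule_format, of 1 0] by auto
    then obtain r where "C i *v y = r *s (C i *v x)" using cross_eq_0_parallel[OF c] by blast
    then have "C i *v ((-r) *s x + 1 *s y) = 0"
      by (simp add: camera_simps)
    then show False using *[rule_format, of "-r" 1] by simp
  qed
qed

section \<open>The joint camera map in coordinates\<close>

text \<open>The joint camera map as a polynomial map. It is defined for all pairs of vectors; where the joint camera map
  is undefined, some block is zero.\<close>

definition Psi :: "complex^4 \<Rightarrow> complex^4 \<Rightarrow> complex^('m \<times> 3)" where
  "Psi x y = (\<chi> k. cross (C (fst k) *v x) (C (fst k) *v y) $ snd k)"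

lemma block_Psi [simp]: "block (Psi x y) i = image_line i x y"
  by (simp add: block_def Psi_def vec_eq_iff)

lemma in_span_pair: "z \<in> vec.span {x, y} \<longleftrightarrow> (\<exists>p q. z = p *s x + q *s (y :: complex^4))"
proof -
  have "z \<in> vec.span {x, y} \<longleftrightarrow> (\<exists>p q. z - p *s x = q *s y)"
    by (auto simp: vec.span_insert vec.span_singleton)
  then show ?thesis by (simp add: diff_eq_eq add.commute)
qed

lemma camera_line_span:
  assumes "image_line i x y \<noteq> 0"
  shows "camera_line (C i) (vec.span {x, y}) = vec.span {image_line i x y}"
proof -
  have "l \<in> camera_line (C i) (vec.span {x, y}) \<longleftrightarrow> bil l (C i *v x) = 0 \<and> bil l (C i *v y) = 0" for l
  proof -
    have s: "(\<Sum>j\<in>UNIV. z $ j * l $ j) = bil l z" for z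
      unfolding bil_def by (intro sum.cong) (simp_all add: mult.commute)
    have "l \<in> camera_line (C i) (vec.span {x, y}) \<longleftrightarrow> (\<forall>z\<in>vec.span {x, y}. bil l (C i *v z) = 0)"
      unfolding camera_line_def linear_equation_def by (simp only: s mem_Collect_eq ball_simps)
    also have "\<dots> \<longleftrightarrow> bil l (C i *v x) = 0 \<and> bil l (C i *v y) = 0"
    proof
      assume "\<forall>z\<in>vec.span {x, y}. bil l (C i *v z) = 0"
      then show "bil l (C i *v x) = 0 \<and> bil l (C i *v y) = 0" by (simp add: vec.span_base)
    next
      assume "bil l (C i *v x) = 0 \<and> bil l (C i *v y) = 0"
      then show "\<forall>z\<in>vec.span {x, y}. bil l (C i *v z) = 0"
        by (auto simp: in_span_pair camera_simps)
    qed
    finally show ?thesis .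
  qed
  note * = this
  show ?thesis
  proof (intro equalityI subsetI)
    fix l assume "l \<in> camera_line (C i) (vec.span {x, y})"
    then have "bil l (C i *v x) = 0" "bil l (C i *v y) = 0" using * by blast+
    then obtain c where "l = c *s image_line i x y"
      using orthogonal_to_two[OF _ _ assms] by blast
    then show "l \<in> vec.span {image_line i x y}" by (auto simp: vec.span_singleton)
  next
    fix l assume "l \<in> vec.span {image_line i x y}"
    then obtain c where "l = c *s image_line i x y" by (auto simp: vec.span_singleton)
    then show "l \<in> camera_line (C i) (vec.span {x, y})" unfolding * by simp
  qed
qed

lemma span_pair_in_domain:
  assumes "nonzero_blocks (Psi x y)"
  shows "vec.span {x, y} \<in> camera_domain C" "joint_camera_map C (vec.span {x, y}) = proj (Psi x y)"
proof -
  have c: "image_line i x y \<noteq> 0" for i using assms by (simp add: nonzero_blocks_def)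
  have i: "p = 0 \<and> q = 0" if "p *s x + q *s y = 0" for p q
  proof -
    have "C undefined *v (p *s x + q *s y) = 0" by (simp add: that)
    then show ?thesis using c[of undefined] unfolding cross_ne_iff by blast
  qed
  have L: "vec.span {x, y} \<in> proj_lines"
    using dim_span_pair(3)[of x y, OF i] by (simp add: proj_flats_def vec.subspace_span)
  have "\<not> center (C i) \<subseteq> vec.span {x, y}" for i
  proof
    assume "center (C i) \<subseteq> vec.span {x, y}"
    then have "e i \<in> vec.span {x, y}" by (auto simp: center vec.span_base)
    then obtain p q where pq: "e i = p *s x + q *s y" unfolding in_span_pair by blast
    have "C i *v (p *s x + q *s y) = 0" unfolding pq[symmetric] by (rule image_of_center)
    then have "p = 0 \<and> q = 0" using c[of i] unfolding cross_ne_iff by blast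
    then show False using pq e0[of i] by simp
  qed
  then show "vec.span {x, y} \<in> camera_domain C" using L by (simp add: camera_domain_def)
  show "joint_camera_map C (vec.span {x, y}) = proj (Psi x y)"
    unfolding joint_camera_map_def proj_def block_Psi by (intro ext camera_line_span c)
qed

lemma camera_domain_pair:
  assumes "L \<in> camera_domain C"
  obtains x y where "L = vec.span {x, y}" "nonzero_blocks (Psi x y)"
proof -
  have L: "vec.subspace L" "vec.dim L = 2" "\<And>i. \<not> center (C i) \<subseteq> L"
    using assms by (auto simp: camera_domain_def proj_flats_def)
  obtain B where B: "B \<subseteq> L" "vec.independent B" "L \<subseteq> vec.span B" "card B = vec.dim L"
    using vec.basis_exists by blast
  then obtain x y where xy: "B = {x, y}" "x \<noteq> y" using L(2) by (auto simp: card_2_iff)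
  have Ls: "L = vec.span {x, y}"
    using B xy L(1) vec.span_minimal[of B L] by blast
  have ind: "p = 0 \<and> q = 0" if "p *s x + q *s y = 0" for p q
  proof -
    have "vec.independent {x, y}" using B xy by simp
    then have "\<forall>u. (\<Sum>v\<in>{x, y}. u v *s v) = 0 \<longrightarrow> (\<forall>v\<in>{x, y}. u v = 0)"
      unfolding vec.independent_explicit by blast
    from this[rule_format, of "\<lambda>v. if v = x then p else q"] that xy(2)
    have "\<forall>v\<in>{x, y}. (if v = x then p else q) = 0" by auto
    then show ?thesis using xy(2) by auto
  qed
  have "image_line i x y \<noteq> 0" for i
    unfolding cross_ne_iff
  proof (intro allI impI)
    fix p q assume "C i *v (p *s x + q *s y) = 0"
    then obtain c where c: "p *s x + q *s y = c *s e i" using kernel by blast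
    show "p = 0 \<and> q = 0"
    proof (cases "c = 0")
      case True
      then show ?thesis using c ind by simp
    next
      case False
      have "p *s x + q *s y \<in> L" unfolding Ls in_span_pair by blast
      then have "(1 / c) *s (c *s e i) \<in> L" unfolding c using L(1) by (metis vec.subspace_scale)
      then have "e i \<in> L" using False by simp
      then have "vec.span {e i} \<subseteq> L" using L(1) by (intro vec.span_minimal) auto
      then show ?thesis using L(3)[of i] by (simp add: center)
    qed
  qed
  then have "nonzero_blocks (Psi x y)" by (simp add: nonzero_blocks_def)
  then show ?thesis using that Ls by blast
qed

lemma joint_image: "joint_camera_map C ` camera_domain C = {proj (Psi x y) |x y. nonzero_blocks (Psi x y)}"
proof (intro equalityI subsetI)
  fix P assume "P \<in> joint_camera_map C ` camera_domain C"
  then obtain L where L: "L \<in> camera_domain C" "P = joint_camera_map C L" by blast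
  from L(1) obtain x y where "L = vec.span {x, y}" "nonzero_blocks (Psi x y)" by (rule camera_domain_pair)
  then show "P \<in> {proj (Psi x y) |x y. nonzero_blocks (Psi x y)}" using L(2) span_pair_in_domain by auto
next
  fix P assume "P \<in> {proj (Psi x y) |x y. nonzero_blocks (Psi x y)}"
  then obtain x y where "P = proj (Psi x y)" "nonzero_blocks (Psi x y)" by blast
  then show "P \<in> joint_camera_map C ` camera_domain C"
    using span_pair_in_domain by (intro image_eqI[of _ _ "vec.span {x, y}"]) simp_all
qed

lemma line_poly_Psi: "line_poly (\<lambda>u. Psi (fst u) (snd u) $ k)"
proof -
  have l: "line_poly (\<lambda>u. (C i *v fst u) $ j)" "line_poly (\<lambda>u. (C i *v snd u) $ j)" for i j
    by (rule line_poly_linear, rule linearI,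
        simp_all add: matrix_vector_right_distrib scaleR_eq_scale vector_scalar_commute scaleR_conv_of_real)+
  obtain i j where k: "k = (i, j)" by (cases k)
  have "j = 1 \<or> j = 2 \<or> j = 3" by (rule exhaust_3)
  then show ?thesis unfolding Psi_def k by (auto intro!: line_poly_diff line_poly_mult l)
qed

lemma line_poly_compose_Psi: "f \<in> multihom d \<Longrightarrow> line_poly (\<lambda>u. f (Psi (fst u) (snd u)))"
  unfolding multihom_def by (erule line_poly_poly_fun) (rule line_poly_Psi)

abbreviation X where "X \<equiv> line_multiview_variety C"

lemma multihom_bil_block: "(\<lambda>x. bil (block x i) w) \<in> multihom (\<lambda>k. if k = i then 1 else 0)"
proof -
  have "(\<lambda>x. bil (block x i) w) = (\<lambda>x. \<Sum>j\<in>UNIV. w $ j * x $ (i, j))"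
    by (simp add: bil_def block_def mult.commute)
  then show ?thesis by (simp only:) (intro multihom_sum multihom_scale multihom_coord)
qed

lemma line_poly_det: "line_poly (\<lambda>u. bil (image_line i (fst u) (snd u)) w)"
  using line_poly_compose_Psi[OF multihom_bil_block[of i w]] by simp

text \<open>Each condition says that a polynomial in the pair \<open>(x, y)\<close> is nonzero, and each of these polynomials is
  nonzero somewhere. The function \<open>F\<close> allows for one further condition.\<close>

lemma generic_line:
  assumes "a \<noteq> b"
    and F: "line_poly F" "F u0 \<noteq> 0"
  obtains x y where "nonzero_blocks (Psi x y)" "vol a x y (e b) \<noteq> 0"
    "vol b x y (e a) \<noteq> 0" "F (x, y) \<noteq> 0"
proof -
  define D where "D = (\<lambda>i w u. bil (image_line i (fst u) (snd u)) w)"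
  have D: "\<exists>u. D i w u \<noteq> 0" if w: "w \<noteq> 0" for i and w :: "complex^3"
  proof -
    have "\<exists>k. w $ k \<noteq> 0" using w by (simp add: vec_eq_iff)
    then obtain k where k: "w $ k \<noteq> 0" by blast
    have "\<exists>p q. bil (cross p q) w \<noteq> 0"
    proof -
      have "bil (cross (axis 2 1) (axis 3 1)) w = w $ 1" "bil (cross (axis 3 1) (axis 1 1)) w = w $ 2"
        "bil (cross (axis 1 1) (axis 2 1)) w = w $ 3" by (simp_all add: bil_3 axis_def)
      moreover have "k = 1 \<or> k = 2 \<or> k = 3" by (rule exhaust_3)
      ultimately show ?thesis using k by metis
    qed
    then obtain p q where pq: "bil (cross p q) w \<noteq> 0" by blast
    obtain x y where "C i *v x = p" "C i *v y = q" using surj by metis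
    then show ?thesis using pq by (intro exI[of _ "(x, y)"]) (simp add: D_def)
  qed
  define I where "I = insert F (insert (D a (C a *v e b)) (insert (D b (C b *v e a)) ((\<lambda>i. D i (axis 3 1)) ` UNIV)))"
  have "\<exists>u\<in>UNIV. \<forall>G\<in>I. G u \<noteq> 0"
  proof (rule line_poly_common_nonzero)
    show "line_poly G" if "G \<in> I" for G using that F line_poly_det by (auto simp: I_def D_def)
    have a: "axis 3 1 \<noteq> (0 :: complex^3)" by (simp add: vec_eq_iff axis_def)
    show "\<exists>u\<in>UNIV. G u \<noteq> 0" if "G \<in> I" for G
      using that D F(2) image_of_other_center[OF assms(1)] image_of_other_center[OF assms(1)[symmetric]] D[OF a] by (auto simp: I_def simp del: split_paired_Ex)
  qed (auto simp: I_def)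
  then obtain u where u: "\<And>G. G \<in> I \<Longrightarrow> G u \<noteq> 0" by blast
  obtain x y where xy: "u = (x, y)" by (cases u)
  have "D i (axis 3 1) u \<noteq> 0" for i using u by (simp add: I_def)
  then have "nonzero_blocks (Psi x y)" unfolding nonzero_blocks_def block_Psi D_def xy by (metis bil_simps(7) fst_conv snd_conv)
  moreover have "D a (C a *v e b) u \<noteq> 0" "D b (C b *v e a) u \<noteq> 0" "F u \<noteq> 0" using u by (simp_all add: I_def)
  ultimately show ?thesis using that by (simp add: xy D_def)
qed

lemma skew_line:
  assumes "a \<noteq> b"
  obtains x y where "nonzero_blocks (Psi x y)" "vol a x y (e b) \<noteq> 0"
    "vol b x y (e a) \<noteq> 0"
  by (rule generic_line[OF assms line_poly_const[of 1] one_neq_zero]) (rule that)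

lemma basis_with_two_centers:
  assumes "vol a x y (e b) \<noteq> 0"
  obtains p q r s where "z = p *s x + q *s y + r *s e a + s *s e b"
proof -
  obtain p q s where "C a *v z = p *s (C a *v x) + q *s (C a *v y) + s *s (C a *v e b)"
    using cramer_3[OF assms] by metis
  then have "C a *v (z - p *s x - q *s y - s *s e b) = 0"
    by (simp add: camera_simps)
  then obtain r where "z - p *s x - q *s y - s *s e b = r *s e a" using kernel by blast
  then have "z = p *s x + q *s y + r *s e a + s *s e b" by (simp add: algebra_simps)
  then show ?thesis by (rule that)
qed

text \<open>An affine chart around the line through \<open>x\<close> and \<open>y\<close>, if this line is skew to the one through the two
  centers: the two points move parallel to the plane that the vectors \<open>e a\<close> and \<open>e b\<close> span.\<close>

definition chart :: "'m \<Rightarrow> 'm \<Rightarrow> complex^4 \<Rightarrow> complex^4 \<Rightarrow> complex^4 \<Rightarrow> complex^('m \<times> 3)" where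
  "chart a b x y u = Psi (x + u$1 *s e a + u$2 *s e b) (y + u$3 *s e a + u$4 *s e b)"

text \<open>A line skew to the one through the two centers contains a pair of points of the chart. Passing to this pair
  multiplies all blocks of \<open>Psi\<close> by one determinant, so \<open>f\<close> vanishes at the line. The remaining pairs
  follow by density.\<close>

lemma vanishing_on_chart:
  assumes "a \<noteq> b" and base: "vol a x0 y0 (e b) \<noteq> 0"
    and f: "f \<in> multihom d" "\<And>u. nonzero_blocks (chart a b x0 y0 u) \<Longrightarrow> f (chart a b x0 y0 u) = 0"
  shows "f (Psi x y) = 0"
proof (rule ccontr)
  assume *: "f (Psi x y) \<noteq> 0"
  define g where "g = (\<lambda>u. f (Psi (fst u) (snd u)))"
  have "line_poly g" unfolding g_def by (rule line_poly_compose_Psi[OF f(1)])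
  moreover have "g (x, y) \<noteq> 0" using * by (simp add: g_def)
  ultimately obtain x y where xy: "nonzero_blocks (Psi x y)"
      "vol a x y (e b) \<noteq> 0" "g (x, y) \<noteq> 0"
    by (rule generic_line[OF assms(1)]) (rule that)
  have fxy: "f (Psi x y) \<noteq> 0" using xy(3) by (simp add: g_def)
  obtain p q u1 u2 where 1: "x0 = p *s x + q *s y + u1 *s e a + u2 *s e b"
    using basis_with_two_centers[OF xy(2)] by blast
  obtain r s u3 u4 where 2: "y0 = r *s x + s *s y + u3 *s e a + u4 *s e b"
    using basis_with_two_centers[OF xy(2)] by blast
  define u :: "complex^4" where "u = vector [-u1, -u2, -u3, -u4]"
  define D where "D = p * s - q * r"
  have u: "u$1 = -u1" "u$2 = -u2" "u$3 = -u3" "u$4 = -u4" by (simp_all add: u_def vector_def)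
  have xy0: "x0 + u$1 *s e a + u$2 *s e b = p *s x + q *s y" "y0 + u$3 *s e a + u$4 *s e b = r *s x + s *s y"
    by (simp_all add: u 1 2)
  have ch: "block (chart a b x0 y0 u) i = D *s block (Psi x y) i" for i
  proof -
    have "image_line i y x = - image_line i x y" by (rule cross_commute)
    then show ?thesis unfolding chart_def block_Psi xy0
      by (simp add: camera_simps D_def vec.scale_left_diff_distrib mult.commute)
  qed
  have "bil (block (chart a b x0 y0 u) a) (C a *v e b) = vol a x0 y0 (e b)"
    by (simp add: chart_def camera_simps)
  then have D0: "D \<noteq> 0" using base unfolding ch by auto
  have "nonzero_blocks (chart a b x0 y0 u)" using xy(1) D0 unfolding nonzero_blocks_def ch by simp
  then have "f (chart a b x0 y0 u) = 0" by (rule f(2))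
  moreover have "chart a b x0 y0 u = (\<chi> k. D * Psi x y $ k)"
  proof (rule vec_block_eqI)
    show "block (chart a b x0 y0 u) i = block (\<chi> k. D * Psi x y $ k) i" for i
      unfolding ch by (simp add: block_def vec_eq_iff del: block_Psi)
  qed
  ultimately have "f (\<chi> k. D * Psi x y $ k) = 0" by (simp only:)
  then have "(\<Prod>i\<in>UNIV. D ^ d i) * f (Psi x y) = 0"
    by (simp only: multihom_scaling[OF f(1), of "\<lambda>_. D" "Psi x y"])
  then show False using fxy D0 by simp
qed

lemma X_hull: "X = zariski_closed hull {proj (Psi x y) |x y. nonzero_blocks (Psi x y)}"
  unfolding line_multiview_variety_def joint_image ..

lemma Psi_in_X: "nonzero_blocks (Psi x y) \<Longrightarrow> proj (Psi x y) \<in> X"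
  unfolding X_hull by (intro hull_inc) blast

lemma image_multi_points: "{proj (Psi x y) |x y. nonzero_blocks (Psi x y)} \<subseteq> multi_points"
  using proj_multi_points by auto

lemma vanish_on_X:
  assumes f: "f \<in> multihom d" "\<And>x y. nonzero_blocks (Psi x y) \<Longrightarrow> f (Psi x y) = 0" and x: "x \<in> multicone X"
  shows "f x = 0"
proof (rule vanish_on_hull[OF image_multi_points f(1)])
  fix z assume "z \<in> multicone {proj (Psi x y) |x y. nonzero_blocks (Psi x y)}"
  then obtain x y where xy: "nonzero_blocks z" "nonzero_blocks (Psi x y)" "proj z = proj (Psi x y)" by (auto simp: multicone_def)
  have "z \<in> homogeneous_coords (proj (Psi x y))" using homogeneous_coords_proj[OF xy(1)] xy(3) by simp
  then obtain c where "z = (\<chi> k. c (fst k) * Psi x y $ k)" using proj_coords_scaling[OF xy(2)] by metis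
  then show "f z = 0" using multihom_scaling[OF f(1), of c "Psi x y"] f(2)[OF xy(2)] by simp
qed (use x in \<open>simp add: X_hull\<close>)

lemma two_cameras: obtains a b :: 'm where "a \<noteq> b"
  by (rule third_camera[of undefined undefined]) (rule that)

text \<open>By density also the pairs for which some block of \<open>Psi\<close> is zero are covered. This gives curves through
  points of the multicone without any check that the curve stays in the domain.\<close>

lemma vanishing_Psi:
  assumes "f \<in> multihom d" "\<And>x. x \<in> multicone X \<Longrightarrow> f x = 0"
  shows "f (Psi x y) = 0"
proof -
  obtain a b :: 'm where ab: "a \<noteq> b" by (rule two_cameras)
  obtain x0 y0 where 0: "vol a x0 y0 (e b) \<noteq> 0"
    by (rule skew_line[OF ab]) (rule that)
  show ?thesis
  proof (rule vanishing_on_chart[OF ab 0 assms(1)])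
    fix u assume *: "nonzero_blocks (chart a b x0 y0 u)"
    show "f (chart a b x0 y0 u) = 0"
    proof (rule assms(2))
      have "proj (chart a b x0 y0 u) \<in> X" using Psi_in_X[OF *[unfolded chart_def]] by (simp only: chart_def)
      then show "chart a b x0 y0 u \<in> multicone X" using * by (simp only: multicone_def mem_Collect_eq)
    qed
  qed
qed

section \<open>The variety is irreducible of dimension four\<close>

lemma irreducible_X: "irreducible_closed X"
proof -
  obtain a b :: 'm where ab: "a \<noteq> b" by (rule two_cameras)
  obtain x0 y0 where 0: "nonzero_blocks (Psi x0 y0)"
    by (rule skew_line[OF ab]) (rule that)
  have "irreducible_closed (zariski_closed hull
      {proj (Psi (fst u) (snd u)) |u. u \<in> UNIV \<and> nonzero_blocks (Psi (fst u) (snd u))})"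
  proof (rule irreducible_param[OF line_poly_Psi])
    show "(x0, y0) \<in> UNIV" "nonzero_blocks (Psi (fst (x0, y0)) (snd (x0, y0)))"
      using 0 by (simp_all only: fst_conv snd_conv UNIV_I)
  qed simp
  moreover have "{proj (Psi (fst u) (snd u)) |u. u \<in> UNIV \<and> nonzero_blocks (Psi (fst u) (snd u))}
      = {proj (Psi x y) |x y. nonzero_blocks (Psi x y)}"
  proof (intro equalityI subsetI)
    fix p assume "p \<in> {proj (Psi x y) |x y. nonzero_blocks (Psi x y)}"
    then obtain x y where "p = proj (Psi x y)" "nonzero_blocks (Psi x y)" by blast
    then have "p = proj (Psi (fst (x, y)) (snd (x, y)))" "nonzero_blocks (Psi (fst (x, y)) (snd (x, y)))"
      by (simp_all only: fst_conv snd_conv)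
    then show "p \<in> {proj (Psi (fst u) (snd u)) |u. u \<in> UNIV \<and> nonzero_blocks (Psi (fst u) (snd u))}" by blast
  qed blast
  ultimately show ?thesis unfolding X_hull by (simp only:)
qed

lemma X_subset_multi_points: "X \<subseteq> multi_points"
  using irreducible_X by (simp add: irreducible_closedD zariski_closed_subset)

lemma chart_coordinate: "(\<lambda>u. chart a b x y u $ k) \<in> poly_fun {\<mu>. \<forall>j. \<mu> j \<le> 1}"
proof -
  define A where "A = (\<lambda>J. {\<mu> :: 4 \<Rightarrow> nat. \<forall>j. \<mu> j \<le> (if j \<in> J then 1 else 0)})"
  have const: "(\<lambda>_. c) \<in> poly_fun (A J)" for c J
  proof -
    have "(\<lambda>u. c * monomial_fun (\<lambda>_. 0) u) \<in> poly_fun (A J)"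
      by (intro poly_fun_scale poly_fun_monomial) (simp add: A_def)
    then show ?thesis by (simp add: monomial_fun_def)
  qed
  have coord: "(\<lambda>u. u $ j * c) \<in> poly_fun (A J)" if "j \<in> J" for j c J
  proof -
    have "(\<lambda>u. c * monomial_fun (\<lambda>k. if k = j then 1 else 0) u) \<in> poly_fun (A J)"
      by (intro poly_fun_scale poly_fun_monomial) (use that in \<open>auto simp: A_def\<close>)
    moreover have "monomial_fun (\<lambda>k. if k = j then 1 else 0) u = u $ j" for u :: "complex^4"
    proof -
      have "monomial_fun (\<lambda>k. if k = j then 1 else 0) u = (\<Prod>k\<in>UNIV. if k = j then u $ k else 1)"
        unfolding monomial_fun_def by (intro prod.cong) auto
      then show ?thesis by simp
    qed
    ultimately show ?thesis by (simp add: mult.commute)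
  qed
  have x: "(\<lambda>u. (C i *v (x + u$1 *s e a + u$2 *s e b)) $ j) \<in> poly_fun (A {1, 2})" for i j
    by (simp add: camera_simps) (intro poly_fun_add const coord, auto)
  have y: "(\<lambda>u. (C i *v (y + u$3 *s e a + u$4 *s e b)) $ j) \<in> poly_fun (A {3, 4})" for i j
    by (simp add: camera_simps) (intro poly_fun_add const coord, auto)
  have *: "(\<lambda>u. f u * g u) \<in> poly_fun {\<mu>. \<forall>j. \<mu> j \<le> 1}" if "f \<in> poly_fun (A {1, 2})" "g \<in> poly_fun (A {3, 4})" for f g
  proof (rule poly_fun_mult[OF that])
    fix \<mu> \<nu> assume "\<mu> \<in> A {1, 2}" "\<nu> \<in> A {3, 4}"
    then have "\<mu> j + \<nu> j \<le> (if j \<in> {1, 2} then 1 else 0) + (if j \<in> {3, 4} then 1 else 0)" for j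
      unfolding A_def by (intro add_mono) blast+
    also have "\<dots> j \<le> 1" for j :: 4 by auto
    finally show "(\<lambda>k. \<mu> k + \<nu> k) \<in> {\<mu>. \<forall>j. \<mu> j \<le> 1}" by simp
  qed
  have diff: "(\<lambda>u. f u - g u) \<in> poly_fun {\<mu>. \<forall>j. \<mu> j \<le> 1}" if "f \<in> poly_fun {\<mu>. \<forall>j. \<mu> j \<le> 1}"
    "g \<in> poly_fun {\<mu>. \<forall>j. \<mu> j \<le> 1}" for f g :: "complex^4 \<Rightarrow> complex"
    using poly_fun_add[OF that(1) poly_fun_scale[OF that(2), of "-1"]] by simp
  obtain i j where k: "k = (i, j)" by (cases k)
  have "j = 1 \<or> j = 2 \<or> j = 3" by (rule exhaust_3)
  then show ?thesis unfolding chart_def Psi_def k vec_lambda_beta fst_conv snd_conv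
  proof (elim disjE)
    assume "j = 1"
    then show "(\<lambda>u :: complex^4. image_line i (x + u$1 *s e a + u$2 *s e b) (y + u$3 *s e a + u$4 *s e b) $ j)
        \<in> poly_fun {\<mu>. \<forall>j. \<mu> j \<le> 1}" by (simp only: cross_nth) (intro diff * x y)
  next
    assume "j = 2"
    then show "(\<lambda>u :: complex^4. image_line i (x + u$1 *s e a + u$2 *s e b) (y + u$3 *s e a + u$4 *s e b) $ j)
        \<in> poly_fun {\<mu>. \<forall>j. \<mu> j \<le> 1}" by (simp only: cross_nth) (intro diff * x y)
  next
    assume "j = 3"
    then show "(\<lambda>u :: complex^4. image_line i (x + u$1 *s e a + u$2 *s e b) (y + u$3 *s e a + u$4 *s e b) $ j)
        \<in> poly_fun {\<mu>. \<forall>j. \<mu> j \<le> 1}" by (simp only: cross_nth) (intro diff * x y)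
  qed
qed

lemma krull_dim_X_le: "krull_dim X \<le> 4"
proof -
  obtain a b :: 'm where ab: "a \<noteq> b" by (rule two_cameras)
  obtain x0 y0 where 0: "vol a x0 y0 (e b) \<noteq> 0"
    by (rule skew_line[OF ab]) (rule that)
  have "krull_dim X \<le> enat CARD(4)"
  proof (rule krull_dim_le_parameters[OF chart_coordinate])
    fix d f x assume f: "f \<in> multihom d" "\<And>u. f (chart a b x0 y0 u) = 0" and x: "x \<in> multicone X"
    show "f x = 0"
      by (rule vanish_on_X[OF f(1) vanishing_on_chart[OF ab 0 f(1)] x]) (rule f(2))
  qed
  then show ?thesis by (simp add: numeral_eq_enat)
qed

text \<open>The parameters of the chart are released one after another. Up to a nonzero factor the \<open>k\<close>-th parameter is a
  coordinate of the image in camera \<open>a\<close> or \<open>b\<close>, which sees the movement along the other center only; so each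
  step enlarges the closure.\<close>

lemma krull_dim_X_ge: "krull_dim X \<ge> 4"
proof -
  obtain a b :: 'm where ab: "a \<noteq> b" by (rule two_cameras)
  obtain x0 y0 where good: "nonzero_blocks (Psi x0 y0)" "vol a x0 y0 (e b) \<noteq> 0"
    "vol b x0 y0 (e a) \<noteq> 0"
    by (rule skew_line[OF ab]) (rule that)
  \<comment> \<open>The chart, with the parameters numbered so that the first \<open>k\<close> of them are free on \<open>S k\<close>.\<close>
  define P where "P = (\<lambda>v :: nat \<Rightarrow> complex. (x0 + v 0 *s e a + v 1 *s e b, y0 + v 2 *s e a + v 3 *s e b))"
  define S where "S = (\<lambda>k. P ` {v. \<forall>j\<ge>k. v j = 0})"
  define A where "A = (\<lambda>k. {proj (Psi (fst u) (snd u)) |u. u \<in> S k \<and> nonzero_blocks (Psi (fst u) (snd u))})"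
  define W where "W = (\<lambda>k. zariski_closed hull A k)"
  have base: "(x0, y0) \<in> S k" for k
    unfolding S_def by (rule image_eqI[of _ _ "\<lambda>_. 0"]) (simp_all add: P_def)
  have line: "u + t *\<^sub>R (w - u) \<in> S k" if uw: "u \<in> S k" "w \<in> S k" for u w and t :: real and k
  proof -
    obtain v v' where v: "u = P v" "w = P v'" "\<forall>j\<ge>k. v j = 0" "\<forall>j\<ge>k. v' j = 0" using uw by (auto simp: S_def)
    show ?thesis unfolding S_def
    proof (rule image_eqI[of _ _ "\<lambda>j. v j + of_real t * (v' j - v j)"])
      show "u + t *\<^sub>R (w - u) = P (\<lambda>j. v j + of_real t * (v' j - v j))"
        unfolding v P_def by (simp add: scaleR_eq_scale vec_eq_iff algebra_simps)
    qed (use v in simp)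
  qed
  have irr: "irreducible_closed (W k)" for k
    unfolding W_def A_def
    by (rule irreducible_param[OF line_poly_Psi line base]) (use good in auto)
  have AX: "A k \<subseteq> X" for k using Psi_in_X by (auto simp: A_def)
  have WX: "W k \<subseteq> X" for k
    unfolding W_def by (rule hull_minimal[OF AX]) (simp add: irreducible_closedD irreducible_X)
  have "S k \<subseteq> S (Suc k)" for k unfolding S_def by (intro image_mono) auto
  then have AA: "A k \<subseteq> A (Suc k)" for k unfolding A_def by blast
  have WW: "W k \<subseteq> W (Suc k)" for k unfolding W_def by (rule hull_mono[OF AA])
  have Am: "A k \<subseteq> multi_points" for k using AX X_subset_multi_points by blast
  have coord: "\<exists>i w c. c \<noteq> 0 \<and> (\<forall>v. bil (block (Psi (fst (P v)) (snd (P v))) i) w = c * v k)" if "k < 4" for k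
  proof -
    have a: "bil (block (Psi (fst (P v)) (snd (P v))) a) (C a *v x0) = - vol a x0 y0 (e b) * v 1"
      and a': "bil (block (Psi (fst (P v)) (snd (P v))) a) (C a *v y0) = - vol a x0 y0 (e b) * v 3"
      and b: "bil (block (Psi (fst (P v)) (snd (P v))) b) (C b *v x0) = - vol b x0 y0 (e a) * v 0"
      and b': "bil (block (Psi (fst (P v)) (snd (P v))) b) (C b *v y0) = - vol b x0 y0 (e a) * v 2" for v
      by (simp_all add: P_def camera_simps) (simp_all add: bil_3 algebra_simps)
    have n: "- vol a x0 y0 (e b) \<noteq> 0"
      "- vol b x0 y0 (e a) \<noteq> 0" using good(2,3) by simp_all
    have "k = 0 \<or> k = 1 \<or> k = 2 \<or> k = 3" using that by auto
    then show ?thesis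
    proof (elim disjE)
      assume "k = 0" then show ?thesis using b n(2) by blast
    next
      assume "k = 1" then show ?thesis using a n(1) by blast
    next
      assume "k = 2" then show ?thesis using b' n(2) by blast
    next
      assume "k = 3" then show ?thesis using a' n(1) by blast
    qed
  qed
  have ne: "W k \<noteq> W (Suc k)" if k: "k < 4" for k
  proof
    assume eq: "W k = W (Suc k)"
    obtain i w c where c: "c \<noteq> 0" "\<And>v. bil (block (Psi (fst (P v)) (snd (P v))) i) w = c * v k"
      using coord[OF k] by blast
    define F where "F = (\<lambda>u. bil (block (Psi (fst u) (snd u)) i) w)"
    define v where "v = (\<lambda>j. if j = k then 1 else 0 :: complex)"
    have vS: "P v \<in> S (Suc k)" unfolding S_def by (intro imageI) (auto simp: v_def)
    obtain j where j: "\<And>i. Psi x0 y0 $ (i, j i) \<noteq> 0"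
      using good(1) unfolding nonzero_blocks_def block_def vec_eq_iff by (simp, metis)
    have "\<exists>u\<in>S (Suc k). \<forall>G\<in>insert F ((\<lambda>i u. Psi (fst u) (snd u) $ (i, j i)) ` UNIV). G u \<noteq> 0"
    proof (rule line_poly_common_nonzero)
      show "line_poly G" if "G \<in> insert F ((\<lambda>i u. Psi (fst u) (snd u) $ (i, j i)) ` UNIV)" for G
        using that line_poly_Psi line_poly_compose_Psi[OF multihom_bil_block] by (auto simp: F_def)
      show "\<exists>u\<in>S (Suc k). G u \<noteq> 0" if "G \<in> insert F ((\<lambda>i u. Psi (fst u) (snd u) $ (i, j i)) ` UNIV)" for G
        using that
      proof
        assume "G = F"
        then have "G (P v) \<noteq> 0" using c by (simp add: F_def v_def del: block_Psi)
        then show ?thesis using vS by blast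
      next
        assume "G \<in> (\<lambda>i u. Psi (fst u) (snd u) $ (i, j i)) ` UNIV"
        then have "G (x0, y0) \<noteq> 0" using j by auto
        then show ?thesis using base by blast
      qed
      show "S (Suc k) \<noteq> {}" using base by blast
      show "finite (insert F ((\<lambda>i u. Psi (fst u) (snd u) $ (i, j i)) ` UNIV))" by simp
    qed (rule line)
    then obtain u where u: "u \<in> S (Suc k)" "F u \<noteq> 0" "\<And>i. Psi (fst u) (snd u) $ (i, j i) \<noteq> 0" by auto
    have nzu: "nonzero_blocks (Psi (fst u) (snd u))" using u(3) unfolding nonzero_blocks_def block_def vec_eq_iff by auto
    have "proj (Psi (fst u) (snd u)) \<in> A (Suc k)" unfolding A_def using u(1) nzu by blast
    then have "Psi (fst u) (snd u) \<in> multicone (W (Suc k))"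
      unfolding W_def multicone_def using nzu by (simp add: hull_inc)
    then have "Psi (fst u) (snd u) \<in> multicone (W k)" by (simp only: eq)
    then have "bil (block (Psi (fst u) (snd u)) i) w = 0" unfolding W_def
    proof (rule vanish_on_hull[OF Am multihom_bil_block, rotated])
      fix z assume "z \<in> multicone (A k)"
      then obtain u where u: "nonzero_blocks z" "u \<in> S k" "nonzero_blocks (Psi (fst u) (snd u))" "proj z = proj (Psi (fst u) (snd u))"
        by (auto simp: multicone_def A_def)
      have "z \<in> homogeneous_coords (proj (Psi (fst u) (snd u)))"
        using homogeneous_coords_proj[OF u(1)] unfolding u(4) .
      then obtain s where s: "z = (\<chi> k. s (fst k) * Psi (fst u) (snd u) $ k)"
        by (rule proj_coords_scaling[OF u(3)]) (rule that)
      have z: "block z i = s i *s block (Psi (fst u) (snd u)) i"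
      proof -
        have "block (\<chi> k. s (fst k) * y $ k) i = s i *s block y i" for y :: "complex^('m \<times> 3)"
          by (simp add: block_def vec_eq_iff)
        then show ?thesis unfolding s .
      qed
      obtain v where v: "u = P v" "v k = 0" using u(2) by (auto simp: S_def)
      show "bil (block z i) w = 0" unfolding z v(1) bil_simps c(2) v(2) by simp
    qed
    then show False using u(2) by (simp add: F_def)
  qed
  have "enat 4 \<le> krull_dim X" unfolding krull_dim_def
    by (rule Sup_upper, rule CollectI, rule exI[of _ "4 :: nat"], intro conjI refl exI[of _ W] allI impI)
      (use irr WX WW ne in \<open>auto simp: psubset_eq\<close>)
  then show ?thesis by (simp add: numeral_eq_enat)
qed

lemma local_dim_X: "p \<in> X \<Longrightarrow> local_dim X p = 4"
  using local_dim_irreducible[OF irreducible_X] krull_dim_X_le krull_dim_X_ge by (simp add: antisym)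

section \<open>Tangent vectors from moving lines\<close>

abbreviation T where "T \<equiv> cone_tangent_space X"

lemmas subspace_T = subspace_cone_tangent_space[OF X_subset_multi_points]

text \<open>The velocity of the image when the two points of the line move with velocities \<open>dx\<close> and \<open>dy\<close>.\<close>

lemma moving_line_tangent:
  "of_blocks (\<lambda>i. s i *s (image_line i dx y + image_line i x dy))
    \<in> T (of_blocks (\<lambda>i. s i *s image_line i x y))"
proof (rule curve_tangent[OF X_subset_multi_points,
      where \<phi> = "\<lambda>t. of_blocks (\<lambda>i. s i *s image_line i (x + t *s dx) (y + t *s dy))"])
  have cd: "((\<lambda>t. (s *s cross (p + t *s p') (q + t *s q')) $ j) has_field_derivative
      (s *s (cross p' q + cross p q')) $ j) (at 0)" for s p p' q q' and j :: 3
  proof -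
    have "j = 1 \<or> j = 2 \<or> j = 3" by (rule exhaust_3)
    then show ?thesis by (elim disjE) (auto intro!: derivative_eq_intros simp: algebra_simps simp del: cross_simps)
  qed
  show "((\<lambda>t. of_blocks (\<lambda>i. s i *s image_line i (x + t *s dx) (y + t *s dy)) $ q)
      has_field_derivative
      of_blocks (\<lambda>i. s i *s (image_line i dx y + image_line i x dy)) $ q) (at 0)" for q
    by (rule has_derivative_of_blocks) (simp only: camera_simps cd)
  fix d t and f :: "complex^('m \<times> 3) \<Rightarrow> complex"
  assume f: "f \<in> multihom d" "\<And>y. y \<in> multicone X \<Longrightarrow> f y = 0"
  have "of_blocks (\<lambda>i. s i *s image_line i (x + t *s dx) (y + t *s dy))
      = (\<chi> q. s (fst q) * Psi (x + t *s dx) (y + t *s dy) $ q)"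
    by (simp only: of_blocks_def Psi_def vec_lambda_beta vector_smult_component)
  then show "f (of_blocks (\<lambda>i. s i *s image_line i (x + t *s dx) (y + t *s dy))) = 0"
    using multihom_scaling[OF f(1), of s "Psi (x + t *s dx) (y + t *s dy)"] vanishing_Psi[OF f]
    by (simp only: mult_zero_right)
qed (simp only: vec.scale_zero_left add_0_right)

lemma scaled_Psi_in_multicone:
  assumes "\<And>i. s i \<noteq> 0" "nonzero_blocks (Psi x y)"
  shows "of_blocks (\<lambda>i. s i *s image_line i x y) \<in> multicone X"
proof -
  let ?w = "of_blocks (\<lambda>i. s i *s image_line i x y)"
  have "nonzero_blocks ?w" using assms by (simp add: nonzero_blocks_def)
  moreover have "proj ?w = proj (Psi x y)"
  proof
    fix i
    have "vec.span {s i *s v} = vec.span {v}" for v :: "complex^3"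
    proof -
      have "v = (1 / s i) *s (s i *s v)" using assms(1)[of i] by simp
      then have "v \<in> vec.span {s i *s v}" by (metis insertI1 vec.span_base vec.span_scale)
      then show ?thesis
        by (intro equalityI vec.span_minimal) (auto simp: vec.subspace_span vec.span_base vec.span_scale)
    qed
    then show "proj ?w i = proj (Psi x y) i" by (simp add: proj_def)
  qed
  ultimately show ?thesis using Psi_in_X[OF assms(2)] by (simp add: multicone_def)
qed

text \<open>The tangent vectors are the \<open>m\<close> rescalings and the velocities for the four directions of the chart. Camera
  \<open>a\<close> sees the two directions along \<open>e b\<close>, and camera \<open>b\<close> sees those along \<open>e a\<close>, so they are
  independent.\<close>

lemma dim_tangent_generic_ge:
  assumes s: "\<And>i. s i \<noteq> 0" and xy: "nonzero_blocks (Psi x y)" and "a \<noteq> b"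
    and a: "vol a x y (e b) \<noteq> 0"
    and b: "vol b x y (e a) \<noteq> 0"
  shows "CARD('m) + 4 \<le> vec.dim (T (of_blocks (\<lambda>i. s i *s image_line i x y)))"
proof -
  let ?w = "of_blocks (\<lambda>i. s i *s image_line i x y)"
  define E where "E = (\<lambda>q. if q then e a else e b)"
  define g where "g = (\<lambda>j :: 'm + bool \<times> bool. case j of
      Inl k \<Rightarrow> of_blocks (\<lambda>i. if i = k then block ?w k else 0)
    | Inr (p, q) \<Rightarrow> of_blocks (\<lambda>i. s i *s (image_line i (if p then E q else 0) y
        + image_line i x (if p then 0 else E q))))"
  have "card (UNIV :: ('m + bool \<times> bool) set) \<le> vec.dim (T ?w)"
  proof (rule card_le_dim_independent_family[OF _ subspace_T, where g = g])
    show "g j \<in> T ?w" for j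
    proof (cases j)
      case (Inl k)
      then show ?thesis unfolding g_def Inl sum.case
        by (simp only: scale_block_tangent[OF X_subset_multi_points scaled_Psi_in_multicone[OF s xy]])
    next
      case (Inr pq)
      then show ?thesis unfolding g_def Inr sum.case by (cases pq) (simp only: prod.case moving_line_tangent)
    qed
    fix t assume 0: "(\<Sum>j\<in>UNIV. t j *s g j) = 0"
    define u where "u = (\<lambda>p q. t (Inr (p, q)))"
    define dx where "dx = u True True *s e a + u True False *s e b"
    define dy where "dy = u False True *s e a + u False False *s e b"
    have sum: "(\<Sum>j\<in>UNIV. t j *s g j) = (\<Sum>k\<in>UNIV. t (Inl k) *s g (Inl k))
        + (u True True *s g (Inr (True, True)) + u True False *s g (Inr (True, False))
        + (u False True *s g (Inr (False, True)) + u False False *s g (Inr (False, False))))"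
    proof -
      have "(\<Sum>j\<in>UNIV. t j *s g j) = (\<Sum>j\<in>UNIV <+> UNIV. t j *s g j)" by simp
      also have "\<dots> = (\<Sum>k\<in>UNIV. t (Inl k) *s g (Inl k)) + (\<Sum>k\<in>UNIV. t (Inr k) *s g (Inr k))"
        by (subst sum.Plus) (simp_all add: o_def)
      also have "(\<Sum>k\<in>UNIV. t (Inr k) *s g (Inr k)) = (\<Sum>p\<in>UNIV. \<Sum>q\<in>UNIV. t (Inr (p, q)) *s g (Inr (p, q)))"
        by (simp only: sum.cartesian_product UNIV_Times_UNIV case_prod_eta) (simp add: case_prod_unfold)
      finally show ?thesis by (simp add: UNIV_bool u_def add_ac)
    qed
    have blk: "t (Inl i) *s (s i *s image_line i x y)
        + s i *s (image_line i dx y + image_line i x dy) = 0" for i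
    proof -
      have "block (\<Sum>k\<in>UNIV. t (Inl k) *s g (Inl k)) i
          = (\<Sum>k\<in>UNIV. if i = k then t (Inl k) *s (s i *s image_line i x y) else 0)"
        unfolding block_sum by (intro sum.cong) (auto simp: g_def)
      then have l: "block (\<Sum>k\<in>UNIV. t (Inl k) *s g (Inl k)) i = t (Inl i) *s (s i *s image_line i x y)"
        by simp
      have "0 = block (\<Sum>j\<in>UNIV. t j *s g j) i" by (simp add: 0)
      also have "\<dots> = t (Inl i) *s (s i *s image_line i x y) +
          (u True True *s (s i *s image_line i (e a) y) + u True False *s (s i *s image_line i (e b) y)
          + (u False True *s (s i *s image_line i x (e a)) + u False False *s (s i *s image_line i x (e b))))"
        unfolding sum block_simps l by (simp add: g_def E_def)
      also have "\<dots> = t (Inl i) *s (s i *s image_line i x y)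
        + s i *s (image_line i dx y + image_line i x dy)"
        unfolding dx_def dy_def
        by (simp add: camera_simps vec.scale_right_distrib mult_ac)
      finally show ?thesis by simp
    qed
    have pair: "s i * bil (image_line i dx y + image_line i x dy) v = 0"
      if "bil (image_line i x y) v = 0" for i v
    proof -
      have "bil (t (Inl i) *s (s i *s image_line i x y)
        + s i *s (image_line i dx y + image_line i x dy)) v = 0"
        by (simp only: blk bil_simps)
      then show ?thesis using that by (simp only: bil_simps mult_zero_right add_0_left)
    qed
    have dxz: "vol i dx y x = 0" for i
      using pair[of i "C i *v x"] s[of i] by simp
    have dyz: "vol i x dy y = 0" for i
      using pair[of i "C i *v y"] s[of i] by simp
    have dx: "bil (cross (C i *v dx) (C i *v y)) (C i *v x) = - (u True True * vol i x y (e a) + u True False * vol i x y (e b))"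
      and dy: "bil (cross (C i *v x) (C i *v dy)) (C i *v y) = - (u False True * vol i x y (e a) + u False False * vol i x y (e b))" for i
      by (simp_all add: dx_def dy_def camera_simps) (simp_all add: bil_3 algebra_simps)
    have e1: "u True False = 0" "u False False = 0"
      using dx[of a] dy[of a] dxz[of a] dyz[of a] a by simp_all
    have e2: "u True True = 0" "u False True = 0"
      using dx[of b] dy[of b] dxz[of b] dyz[of b] b by simp_all
    have u0: "u p q = 0" for p q using e1 e2 by (cases p; cases q) auto
    have d0: "dx = 0" "dy = 0" by (simp_all add: dx_def dy_def u0)
    have "t (Inl i) = 0" for i
    proof -
      have "image_line i x y \<noteq> 0" using xy by (simp add: nonzero_blocks_def)
      then show ?thesis using blk[of i] s[of i] by (simp add: d0)
    qed
    moreover have "t (Inr pq) = 0" for pq using u0[of "fst pq" "snd pq"] by (simp add: u_def)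
    ultimately show "\<forall>j\<in>UNIV. t j = 0" by (metis sum.exhaust)
  qed simp
  moreover have "card (UNIV :: ('m + bool \<times> bool) set) = CARD('m) + 4"
    by (simp add: card_UNIV_sum)
  ultimately show ?thesis by simp
qed

section \<open>Points whose back-projected planes meet in a line\<close>

text \<open>The equation of the back-projected plane of the \<open>i\<close>-th image line, as a linear form in \<open>z\<close>.\<close>

definition plane :: "complex^('m \<times> 3) \<Rightarrow> 'm \<Rightarrow> complex^4 \<Rightarrow> complex" where
  "plane x i z = bil (block x i) (C i *v z)"

lemma plane_simps [simp]:
  "plane x i (z + w) = plane x i z + plane x i w" "plane x i (z - w) = plane x i z - plane x i w"
  "plane x i (c *s z) = c * plane x i z" "plane x i 0 = 0" "plane x i (e i) = 0"
  "plane (x + y) i z = plane x i z + plane y i z" "plane (c *s x) i z = c * plane x i z"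
  by (simp_all add: plane_def camera_simps)

lemma plane_multihom: "(\<lambda>x. plane x i z) \<in> multihom (\<lambda>k. if k = i then 1 else 0)"
  unfolding plane_def by (rule multihom_bil_block)

lemma plane_nonzero:
  assumes "block x i \<noteq> 0" obtains z where "plane x i z \<noteq> 0"
proof -
  obtain w where w: "bil (block x i) w \<noteq> 0" using bil_eq_0_imp_eq_0[of "block x i"] assms by blast
  obtain z where "C i *v z = w" using surj by blast
  then show ?thesis using that[of z] w by (simp add: plane_def)
qed

text \<open>Modulo the line through \<open>x\<close> and \<open>y\<close>, the space is spanned by the center and one more vector.\<close>

lemma basis_with_center:
  assumes "image_line b x y \<noteq> 0"
  obtains w where "\<And>z. \<exists>p q r s. z = p *s x + q *s y + r *s e b + s *s w"
proof -
  obtain w' where w': "bil (image_line b x y) w' \<noteq> 0"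
    using bil_eq_0_imp_eq_0[of "image_line b x y"] assms by blast
  obtain w where w: "C b *v w = w'" using surj by blast
  show ?thesis
  proof (rule that[of w])
    fix z
    obtain p q s where "C b *v z = p *s (C b *v x) + q *s (C b *v y) + s *s (C b *v w)"
      by (rule cramer_3[OF w'[folded w]]) (rule that)
    then have "C b *v (z - p *s x - q *s y - s *s w) = 0"
      by (simp add: camera_simps)
    then obtain r where "z - p *s x - q *s y - s *s w = r *s e b" using kernel by blast
    then have "z = p *s x + q *s y + r *s e b + s *s w" by (simp add: algebra_simps)
    then show "\<exists>p q r s. z = p *s x + q *s y + r *s e b + s *s w" by blast
  qed
qed

definition minor :: "'m \<Rightarrow> 'm \<Rightarrow> complex^4 \<Rightarrow> complex^4 \<Rightarrow> complex^('m \<times> 3) \<Rightarrow> complex" where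
  "minor a b z1 z2 x = plane x a z1 * plane x b z2 - plane x a z2 * plane x b z1"

text \<open>The 3 by 3 determinant with rows \<open>a\<close>, \<open>b\<close>, \<open>k\<close> and columns \<open>z1\<close>, \<open>z2\<close>, \<open>z\<close>, expanded along row \<open>k\<close>.\<close>

definition minor3 :: "'m \<Rightarrow> 'm \<Rightarrow> 'm \<Rightarrow> complex^4 \<Rightarrow> complex^4 \<Rightarrow> complex^4 \<Rightarrow> complex^('m \<times> 3) \<Rightarrow> complex" where
  "minor3 a b k z1 z2 z x = plane x k z * minor a b z1 z2 x
     - plane x k z2 * minor a b z1 z x + plane x k z1 * minor a b z2 z x"

lemma minor3_multihom: "\<exists>d. minor3 a b k z1 z2 z \<in> multihom d"
proof -
  have "(\<lambda>x. plane x k z * (plane x a z1 * plane x b z2 - plane x a z2 * plane x b z1)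
     - plane x k z2 * (plane x a z1 * plane x b z - plane x a z * plane x b z1)
     + plane x k z1 * (plane x a z2 * plane x b z - plane x a z * plane x b z2))
    \<in> multihom (\<lambda>i. (if i = k then 1 else 0) + ((if i = a then 1 else 0) + (if i = b then 1 else 0)))"
    by (intro multihom_add multihom_diff multihom_mult plane_multihom)
  then show ?thesis unfolding minor3_def[abs_def] minor_def by blast
qed

lemma plane_Psi: "plane (Psi x y) i z = vol i x y z"
  by (simp add: plane_def)

text \<open>At the image of a line all planes contain the line, so they are forms on a quotient of dimension two.\<close>

lemma minor3_vanishes:
  assumes "x \<in> multicone X"
  shows "minor3 a b k z1 z2 z x = 0"
proof -
  obtain d where d: "minor3 a b k z1 z2 z \<in> multihom d" using minor3_multihom by blast
  show ?thesis
  proof (rule vanish_on_X[OF d _ assms])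
    fix x y assume "nonzero_blocks (Psi x y)"
    then have "image_line a x y \<noteq> 0" by (simp add: nonzero_blocks_def)
    then obtain w where w: "\<And>z. \<exists>p q r s. z = p *s x + q *s y + r *s e a + s *s w"
      by (rule basis_with_center) (rule that)
    have "\<exists>r s. \<forall>i. plane (Psi x y) i z = r * plane (Psi x y) i (e a) + s * plane (Psi x y) i w" for z
    proof -
      obtain p q r s where z: "z = p *s x + q *s y + r *s e a + s *s w" using w by blast
      have "plane (Psi x y) i x = 0" "plane (Psi x y) i y = 0" for i by (simp_all add: plane_Psi)
      then have "\<forall>i. plane (Psi x y) i z = r * plane (Psi x y) i (e a) + s * plane (Psi x y) i w"
        by (simp add: z)
      then show ?thesis by blast
    qed
    then obtain r s where rs: "\<And>z i. plane (Psi x y) i z = r z * plane (Psi x y) i (e a) + s z * plane (Psi x y) i w"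
      by metis
    show "minor3 a b k z1 z2 z (Psi x y) = 0"
      unfolding minor3_def minor_def rs[of _ z1] rs[of _ z2] rs[of _ z]
      by (simp add: algebra_simps)
  qed
qed

text \<open>Cramer's rule, applied to the vanishing minors: planes of which two are different belong to the pencil that these
  two span.\<close>

lemma planes_in_pencil:
  assumes x: "x \<in> multicone X" and m: "minor a b z1 z2 x \<noteq> 0"
  obtains \<alpha> \<beta> where "\<And>k z. plane x k z = \<alpha> k * plane x a z + \<beta> k * plane x b z"
    "\<And>k. \<beta> k * minor a b z1 z2 x = plane x a z1 * plane x k z2 - plane x a z2 * plane x k z1"
    "\<And>k. \<alpha> k * minor a b z1 z2 x = - (plane x b z1 * plane x k z2 - plane x b z2 * plane x k z1)"
proof -
  define \<mu> where "\<mu> = minor a b z1 z2 x"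
  define \<alpha> where "\<alpha> = (\<lambda>k. - (plane x b z1 * plane x k z2 - plane x b z2 * plane x k z1) / \<mu>)"
  define \<beta> where "\<beta> = (\<lambda>k. (plane x a z1 * plane x k z2 - plane x a z2 * plane x k z1) / \<mu>)"
  have "plane x k z = \<alpha> k * plane x a z + \<beta> k * plane x b z" for k z
  proof -
    have "plane x k z * \<mu> = - (plane x b z1 * plane x k z2 - plane x b z2 * plane x k z1) * plane x a z
        + (plane x a z1 * plane x k z2 - plane x a z2 * plane x k z1) * plane x b z"
      using minor3_vanishes[OF x, of a b k z1 z2 z] unfolding minor3_def \<mu>_def[symmetric]
      by (simp add: minor_def algebra_simps)
    then have "plane x k z = (- (plane x b z1 * plane x k z2 - plane x b z2 * plane x k z1) * plane x a z
        + (plane x a z1 * plane x k z2 - plane x a z2 * plane x k z1) * plane x b z) / \<mu>"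
      using m unfolding \<mu>_def[symmetric] by (simp add: eq_divide_eq)
    then show ?thesis unfolding \<alpha>_def \<beta>_def by (simp add: add_divide_distrib)
  qed
  then show ?thesis
    by (rule that) (use m in \<open>simp_all add: \<alpha>_def \<beta>_def \<mu>_def\<close>)
qed

text \<open>At a common zero \<open>z\<close> of all planes the third column of the minor vanishes, so its differential is the
  determinant with the velocities of the planes in this column.\<close>

lemma tangent_planes:
  assumes x: "x \<in> multicone X" and m: "minor a b z1 z2 x \<noteq> 0"
    and \<alpha>\<beta>: "\<And>k. \<beta> k * minor a b z1 z2 x = plane x a z1 * plane x k z2 - plane x a z2 * plane x k z1"
      "\<And>k. \<alpha> k * minor a b z1 z2 x = - (plane x b z1 * plane x k z2 - plane x b z2 * plane x k z1)"
    and v: "v \<in> T x" and z: "\<And>i. plane x i z = 0"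
  shows "plane v k z = \<alpha> k * plane v a z + \<beta> k * plane v b z"
proof -
  obtain d where d: "minor3 a b k z1 z2 z \<in> multihom d" using minor3_multihom by blast
  have "differential (minor3 a b k z1 z2 z) x v = 0"
    using v d minor3_vanishes unfolding mem_cone_tangent_space[OF X_subset_multi_points] by blast
  moreover have "differential (minor3 a b k z1 z2 z) x v = plane v k z * minor a b z1 z2 x
      - plane x k z2 * (plane x a z1 * plane v b z - plane v a z * plane x b z1)
      + plane x k z1 * (plane x a z2 * plane v b z - plane v a z * plane x b z2)"
    unfolding differential_def
  proof (rule DERIV_imp_deriv)
    show "((\<lambda>t. minor3 a b k z1 z2 z (x + t *s v)) has_field_derivative
       plane v k z * minor a b z1 z2 x
      - plane x k z2 * (plane x a z1 * plane v b z - plane v a z * plane x b z1)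
      + plane x k z1 * (plane x a z2 * plane v b z - plane v a z * plane x b z2)) (at 0)"
      unfolding minor3_def minor_def plane_simps
      by (auto intro!: derivative_eq_intros simp: z) (simp add: algebra_simps)
  qed
  ultimately have "plane v k z * minor a b z1 z2 x
     = plane v a z * (- (plane x b z1 * plane x k z2 - plane x b z2 * plane x k z1))
      + plane v b z * (plane x a z1 * plane x k z2 - plane x a z2 * plane x k z1)"
    by (simp add: algebra_simps)
  also have "\<dots> = (\<alpha> k * plane v a z + \<beta> k * plane v b z) * minor a b z1 z2 x"
    unfolding \<alpha>\<beta>[symmetric] by (simp add: algebra_simps)
  finally show ?thesis using m by simp
qed

text \<open>The line in which the planes of cameras \<open>a\<close> and \<open>b\<close> meet, and hence the axis of their pencil.\<close>

definition axis_line :: "'m \<Rightarrow> 'm \<Rightarrow> complex^('m \<times> 3) \<Rightarrow> (complex^4) set" where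
  "axis_line a b x = {z. plane x a z = 0 \<and> plane x b z = 0}"

lemma subspace_axis_line: "vec.subspace (axis_line a b x)"
  by (auto simp: axis_line_def vec.subspace_def)

lemma dim_axis_line:
  assumes m: "minor a b z1 z2 x \<noteq> 0"
  shows "vec.dim (axis_line a b x) = 2"
proof -
  define L where "L = axis_line a b x"
  define V where "V = vec.span {z1, z2}"
  define \<mu> where "\<mu> = minor a b z1 z2 x"
  have LV: "L \<inter> V \<subseteq> {0}"
  proof
    fix z assume z: "z \<in> L \<inter> V"
    then obtain p q where pq: "z = p *s z1 + q *s z2" unfolding V_def by (auto simp: in_span_pair)
    have "p * plane x a z1 + q * plane x a z2 = 0" "p * plane x b z1 + q * plane x b z2 = 0"
      using z by (simp_all add: pq L_def axis_line_def)
    then have "p * \<mu> = 0" "q * \<mu> = 0" unfolding \<mu>_def minor_def by algebra+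
    then show "z \<in> {0}" using m by (simp add: pq \<mu>_def)
  qed
  have "z \<in> {u + v |u v. u \<in> L \<and> v \<in> V}" for z
  proof -
    define p where "p = (plane x a z * plane x b z2 - plane x a z2 * plane x b z) / \<mu>"
    define q where "q = (plane x a z1 * plane x b z - plane x a z * plane x b z1) / \<mu>"
    have \<mu>: "\<mu> \<noteq> 0" using m by (simp add: \<mu>_def)
    have "p * plane x a z1 + q * plane x a z2 = (plane x a z * \<mu>) / \<mu>"
      unfolding p_def q_def \<mu>_def minor_def by (simp add: divide_simps) (simp add: algebra_simps)
    then have 1: "plane x a z = p * plane x a z1 + q * plane x a z2" using \<mu> by simp
    have "p * plane x b z1 + q * plane x b z2 = (plane x b z * \<mu>) / \<mu>"
      unfolding p_def q_def \<mu>_def minor_def by (simp add: divide_simps) (simp add: algebra_simps)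
    then have 2: "plane x b z = p * plane x b z1 + q * plane x b z2" using \<mu> by simp
    have "z - (p *s z1 + q *s z2) \<in> L" using 1 2 by (simp add: L_def axis_line_def)
    moreover have "p *s z1 + q *s z2 \<in> V" unfolding V_def in_span_pair by blast
    moreover have "z = (z - (p *s z1 + q *s z2)) + (p *s z1 + q *s z2)" by simp
    ultimately show ?thesis by blast
  qed
  then have all: "{u + v |u v. u \<in> L \<and> v \<in> V} = UNIV" by blast
  have LV0: "vec.dim (L \<inter> V) = 0" using LV by (simp add: vec.dim_eq_0)
  moreover have "vec.dim V = 2"
    unfolding V_def
  proof (rule dim_span_pair(3))
    fix p q assume "p *s z1 + q *s z2 = 0"
    then have "p * plane x a z1 + q * plane x a z2 = 0" "p * plane x b z1 + q * plane x b z2 = 0"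
      by (metis plane_simps(1,3,4))+
    then have "p * \<mu> = 0" "q * \<mu> = 0" unfolding \<mu>_def minor_def by algebra+
    then show "p = 0 \<and> q = 0" using m by (simp add: \<mu>_def)
  qed
  moreover have "vec.subspace L" "vec.subspace V"
    by (simp_all add: L_def V_def subspace_axis_line vec.subspace_span)
  ultimately show ?thesis
    using vec.dim_sums_Int[of L V] unfolding all LV0 L_def[symmetric] by (simp add: vec_dim_card card_cart_basis)
qed

lemma line_eq_span:
  fixes z1 z2 :: "complex^4"
  assumes L: "vec.subspace L" "vec.dim L = 2" "z1 \<in> L" "z2 \<in> L"
    and ind: "\<And>p q. p *s z1 + q *s z2 = 0 \<Longrightarrow> p = 0 \<and> q = 0"
  shows "L = vec.span {z1, z2}"
proof
  show "L \<subseteq> vec.span {z1, z2}"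
    using vec.card_ge_dim_independent[of "{z1, z2}" L] dim_span_pair(1,2)[of z1 z2, OF ind] L by simp
  show "vec.span {z1, z2} \<subseteq> L" using L by (intro vec.span_minimal) auto
qed

lemma line_second_point:
  fixes L :: "(complex^4) set"
  assumes L: "vec.subspace L" "vec.dim L = 2" and v: "v \<in> L" "v \<noteq> 0"
  obtains w where "w \<in> L" "\<And>p q. p *s v + q *s w = 0 \<Longrightarrow> p = 0 \<and> q = 0"
proof -
  have "\<not> L \<subseteq> vec.span {v}"
  proof
    assume "L \<subseteq> vec.span {v}"
    then have "vec.dim L \<le> card {v}" by (rule vec.dim_le_card) simp
    then show False using L by simp
  qed
  then obtain w where w: "w \<in> L" "w \<notin> vec.span {v}" by blast
  show ?thesis
  proof (rule that[OF w(1)])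
    fix p q assume 0: "p *s v + q *s w = 0"
    have "q = 0"
    proof (rule ccontr)
      assume "q \<noteq> 0"
      then have "w = (- p / q) *s v" using 0
        by (simp add: vec_eq_iff field_simps eq_neg_iff_add_eq_0)
      then have "w \<in> vec.span {v}" unfolding vec.span_singleton by blast
      then show False using w(2) by simp
    qed
    then show "p = 0 \<and> q = 0" using 0 v(2) by simp
  qed
qed

lemma at_most_two_centers_on_line:
  assumes L: "vec.subspace L" "vec.dim L = 2" and "i \<noteq> j" "i \<noteq> k" "j \<noteq> k"
    and "e i \<in> L" "e j \<in> L" "e k \<in> L"
  shows False
proof -
  have ij: "L = vec.span {e i, e j}"
    by (rule line_eq_span[OF L]) (use assms distinct_centers[OF \<open>i \<noteq> j\<close>] in auto)
  then obtain p q where "e k = p *s e i + q *s e j" using assms(8) in_span_pair by blast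
  then have "p *s e i + q *s e j + (-1) *s e k = 0" by simp
  then show False using no_three_collinear[OF assms(3-5), of p q "-1"] by simp
qed

subsection \<open>The upper bound for the tangent space\<close>

lemma bil_of_blocks: "bil g v = (\<Sum>i\<in>UNIV. bil (block g i) (block v i))" for g :: "complex^('m \<times> 3)"
  unfolding bil_def block_def by (simp add: sum.cartesian_product case_prod_unfold)

text \<open>By \<open>tangent_planes\<close> every further camera \<open>k\<close> imposes two linear conditions on tangent vectors, one for each vector
  of a basis of the axis. In a relation between the conditions, the coefficients of camera \<open>k\<close> give a
  vector \<open>w k\<close> on the axis in the kernel of \<open>C k\<close>. It can be nonzero only for a center on the axis, and
  there are at most two of these; the coordinates of cameras \<open>a\<close> and \<open>b\<close> then show that no relation
  exists.\<close>

lemma dim_tangent_le: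
  assumes x: "x \<in> multicone X" and m: "minor a b y1 y2 x \<noteq> 0"
  shows "vec.dim (T x) \<le> CARD('m) + 4"
proof -
  have ab: "a \<noteq> b" using m by (auto simp: minor_def)
  obtain \<alpha> \<beta> where pen: "\<And>k z. plane x k z = \<alpha> k * plane x a z + \<beta> k * plane x b z"
    and \<alpha>\<beta>: "\<And>k. \<beta> k * minor a b y1 y2 x = plane x a y1 * plane x k y2 - plane x a y2 * plane x k y1"
    "\<And>k. \<alpha> k * minor a b y1 y2 x = - (plane x b y1 * plane x k y2 - plane x b y2 * plane x k y1)"
    by (rule planes_in_pencil[OF x m]) (rule that)
  define L where "L = axis_line a b x"
  have L: "vec.subspace L" "vec.dim L = 2" by (simp_all add: L_def subspace_axis_line dim_axis_line[OF m])
  have hL: "plane x i z = 0" if "z \<in> L" for i z using that pen[of i z] by (simp add: L_def axis_line_def)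
  obtain z1 where z1: "z1 \<in> L" "z1 \<noteq> 0"
    using L(2) vec.dim_eq_0[of L] by auto
  obtain z2 where z2: "z2 \<in> L" "\<And>p q. p *s z1 + q *s z2 = 0 \<Longrightarrow> p = 0 \<and> q = 0"
    by (rule line_second_point[OF L z1]) (rule that)
  define Z where "Z = (\<lambda>j. if j then z1 else z2)"
  have ZL: "Z j \<in> L" for j using z1 z2 by (simp add: Z_def)
  \<comment> \<open>The condition \<open>(k, j)\<close> is the pairing of the velocity of plane \<open>k\<close> with the basis vector \<open>Z j\<close>.\<close>
  define J where "J = (UNIV - {a, b}) \<times> (UNIV :: bool set)"
  define g where "g = (\<lambda>(k, j). of_blocks (\<lambda>i. if i = k then C i *v Z j
      else if i = a then - \<alpha> k *s (C i *v Z j) else if i = b then - \<beta> k *s (C i *v Z j) else 0))"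
  have bg: "bil (g (k, j)) v = plane v k (Z j) - \<alpha> k * plane v a (Z j) - \<beta> k * plane v b (Z j)"
    if k: "k \<noteq> a" "k \<noteq> b" for k j v
  proof -
    have "bil (g (k, j)) v = (\<Sum>i\<in>UNIV. (if i = k then plane v k (Z j) else 0)
        + ((if i = a then - \<alpha> k * plane v a (Z j) else 0) + (if i = b then - \<beta> k * plane v b (Z j) else 0)))"
      unfolding bil_of_blocks g_def prod.case block_of_blocks
      by (intro sum.cong refl) (use k ab in \<open>auto simp: plane_def bil_commute\<close>)
    then show ?thesis by (simp add: sum.distrib)
  qed
  have "T x \<subseteq> {v. \<forall>j\<in>J. bil (g j) v = 0}"
  proof
    fix v assume v: "v \<in> T x"
    have tp: "plane v k (Z j) = \<alpha> k * plane v a (Z j) + \<beta> k * plane v b (Z j)" for k j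
      by (rule tangent_planes[OF x m \<alpha>\<beta> v hL[OF ZL]])
    have "bil (g (k, j)) v = 0" if "k \<noteq> a" "k \<noteq> b" for k j
      unfolding bg[OF that] by (simp add: tp[of k j])
    then show "v \<in> {v. \<forall>j\<in>J. bil (g j) v = 0}" by (auto simp: J_def)
  qed
  then have le: "vec.dim (T x) \<le> vec.dim {v. \<forall>j\<in>J. bil (g j) v = 0}" by (rule vec.dim_subset)
  have fin: "finite J" by (simp add: J_def)
  have "\<forall>j\<in>J. t j = 0" if t: "(\<Sum>j\<in>J. t j *s g j) = 0" for t
  proof -
    define w where "w = (\<lambda>k. t (k, True) *s z1 + t (k, False) *s z2)"
    have wL: "w k \<in> L" for k unfolding w_def using z1 z2 L(1) by (simp add: vec.subspace_add vec.subspace_scale)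
    define G where "G = (\<lambda>k. t (k, True) *s g (k, True) + t (k, False) *s g (k, False))"
    have S: "(\<Sum>k\<in>UNIV - {a, b}. block (G k) i) = 0" for i
    proof -
      have "(\<Sum>j\<in>J. t j *s g j) = (\<Sum>k\<in>UNIV - {a, b}. \<Sum>j\<in>UNIV. t (k, j) *s g (k, j))"
        unfolding J_def by (simp only: sum.cartesian_product) (simp add: case_prod_unfold)
      also have "\<dots> = (\<Sum>k\<in>UNIV - {a, b}. G k)"
        by (simp add: UNIV_bool add.commute G_def)
      finally have "block (\<Sum>k\<in>UNIV - {a, b}. G k) i = 0"
        using t by simp
      then show ?thesis by (simp only: block_sum)
    qed
    have Cw: "C i *v w k = t (k, True) *s (C i *v z1) + t (k, False) *s (C i *v z2)" for i k
      by (simp add: w_def camera_simps)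
    have bk: "block (G k) i
       = (if i = k then C i *v w k else if i = a then - \<alpha> k *s (C i *v w k)
          else if i = b then - \<beta> k *s (C i *v w k) else 0)" for i k
      unfolding Cw by (simp add: G_def g_def Z_def vec_eq_iff algebra_simps)
    have wk: "C i *v w i = 0" if i: "i \<noteq> a" "i \<noteq> b" for i
    proof -
      have "(\<Sum>k\<in>UNIV - {a, b}. if k = i then C i *v w i else 0)
          = (\<Sum>k\<in>UNIV - {a, b}. block (G k) i)"
        unfolding bk by (intro sum.cong refl) (use i in auto)
      also have "\<dots> = 0" by (rule S)
      finally show ?thesis using i by simp
    qed
    define c where "c = (\<lambda>i. SOME c. w i = c *s e i)"
    have c: "w i = c i *s e i" if "i \<noteq> a" "i \<noteq> b" for i
    proof -
      have "\<exists>c. w i = c *s e i" using wk[OF that] unfolding kernel .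
      then show ?thesis unfolding c_def by (rule someI_ex)
    qed
    have Sa: "(\<Sum>k\<in>UNIV - {a, b}. \<alpha> k *s (C a *v w k)) = 0"
    proof -
      have "(\<Sum>k\<in>UNIV - {a, b}. \<alpha> k *s (C a *v w k)) = - (\<Sum>k\<in>UNIV - {a, b}. block (G k) a)"
        unfolding bk sum_negf[symmetric] by (intro sum.cong refl) auto
      then show ?thesis unfolding S by simp
    qed
    have Sb: "(\<Sum>k\<in>UNIV - {a, b}. \<beta> k *s (C b *v w k)) = 0"
    proof -
      have "(\<Sum>k\<in>UNIV - {a, b}. \<beta> k *s (C b *v w k)) = - (\<Sum>k\<in>UNIV - {a, b}. block (G k) b)"
        unfolding bk sum_negf[symmetric] by (intro sum.cong refl) (use ab in auto)
      then show ?thesis unfolding S by simp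
    qed
    have w0: "w k = 0" if k: "k \<noteq> a" "k \<noteq> b" for k
    proof (rule ccontr)
      assume wk0: "w k \<noteq> 0"
      have on: "e i \<in> L" if "i \<noteq> a" "i \<noteq> b" "w i \<noteq> 0" for i
      proof -
        have "e i = (1 / c i) *s w i" using c[OF that(1,2)] that(3) by auto
        then show ?thesis using wL[of i] L(1) by (metis vec.subspace_scale)
      qed
      have ck: "c k \<noteq> 0" using c[OF k] wk0 by auto
      \<comment> \<open>The only other camera that may have \<open>w l \<noteq> 0\<close>; the value \<open>b\<close> encodes that there is none.\<close>
      obtain l where l: "l \<noteq> k" "l \<noteq> a" "\<And>i. i \<noteq> a \<Longrightarrow> i \<noteq> b \<Longrightarrow> i \<noteq> k \<Longrightarrow> i \<noteq> l \<Longrightarrow> w i = 0"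
        "l \<noteq> b \<or> (\<forall>i. i \<noteq> a \<longrightarrow> i \<noteq> b \<longrightarrow> i \<noteq> k \<longrightarrow> w i = 0)"
      proof (cases "\<exists>l. l \<noteq> a \<and> l \<noteq> b \<and> l \<noteq> k \<and> w l \<noteq> 0")
        case True
        then obtain l where l: "l \<noteq> a" "l \<noteq> b" "l \<noteq> k" "w l \<noteq> 0" by blast
        have "w i = 0" if "i \<noteq> a" "i \<noteq> b" "i \<noteq> k" "i \<noteq> l" for i
          using at_most_two_centers_on_line[OF L, of k l i] on[OF k wk0] on[OF l(1,2,4)] on[of i] l that by metis
        then show ?thesis using that[of l] l by blast
      next
        case False
        then show ?thesis using that[of b] ab k by blast
      qed
      have red: "\<gamma> k * c k = 0" if sum0: "(\<Sum>i\<in>UNIV - {a, b}. \<gamma> i *s (C q *v w i)) = 0" and q: "q = a \<or> q = b" for \<gamma> q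
      proof -
        have qk: "q \<noteq> k" using q k by auto
        show ?thesis
        proof (cases "l = b")
          case True
          then have "(\<Sum>i\<in>UNIV - {a, b}. \<gamma> i *s (C q *v w i)) = (\<Sum>i\<in>{k}. \<gamma> i *s (C q *v w i))"
            by (intro sum.mono_neutral_right) (use l k in auto)
          then have "C q *v ((\<gamma> k * c k) *s e k) = 0"
            using sum0 c[OF k] by (simp add: vector_scalar_commute)
          then show ?thesis using image_of_other_center[OF qk] by (simp add: vector_scalar_commute)
        next
          case False
          then have "(\<Sum>i\<in>UNIV - {a, b}. \<gamma> i *s (C q *v w i)) = (\<Sum>i\<in>{k, l}. \<gamma> i *s (C q *v w i))"
            by (intro sum.mono_neutral_right) (use l k in auto)
          then have "C q *v ((\<gamma> k * c k) *s e k + (\<gamma> l * c l) *s e l) = 0"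
            using sum0 c[OF k] c[OF l(2) False] l(1) by (simp add: camera_simps)
          then obtain r where "(\<gamma> k * c k) *s e k + (\<gamma> l * c l) *s e l = r *s e q" using kernel by blast
          then have r: "(\<gamma> k * c k) *s e k + (\<gamma> l * c l) *s e l + (-r) *s e q = 0" by simp
          have ql: "l \<noteq> q" using q l(2) False by auto
          have "\<gamma> k * c k = 0 \<and> \<gamma> l * c l = 0 \<and> - r = 0"
            by (rule no_three_collinear[OF _ _ ql r]) (use l(1) qk in auto)
          then show ?thesis by blast
        qed
      qed
      have "\<alpha> k = 0" "\<beta> k = 0" using red[OF Sa] red[OF Sb] ck by auto
      then have "plane x k z = 0" for z using pen[of k z] by simp
      moreover have "block x k \<noteq> 0" using x by (simp add: multicone_def nonzero_blocks_def)
      ultimately show False by (metis plane_nonzero)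
    qed
    show ?thesis
    proof
      fix q assume "q \<in> J"
      then obtain k j where q: "q = (k, j)" "k \<noteq> a" "k \<noteq> b" by (auto simp: J_def)
      have "t (k, True) = 0 \<and> t (k, False) = 0" using z2(2) w0[OF q(2,3)] by (simp add: w_def)
      then show "t q = 0" by (cases j) (simp_all add: q(1))
    qed
  qed
  from dim_common_kernel_le[OF fin this]
  have "vec.dim {v. \<forall>j\<in>J. bil (g j) v = 0} + card J \<le> CARD('m \<times> 3)" .
  moreover have "card J = (CARD('m) - 2) * 2"
    unfolding J_def using ab by (simp add: card_cartesian_product card_Diff_subset)
  ultimately show ?thesis using le card3 by simp
qed

subsection \<open>The lower bound for the tangent space\<close>

lemma perpendicular_not_parallel:
  assumes "bil l u = 0" "l \<noteq> 0" "u \<noteq> 0"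
  obtains w where "bil l w = 0" "cross w u \<noteq> 0"
proof -
  obtain q where q: "bil u q \<noteq> 0" using bil_eq_0_imp_eq_0[of u] assms(3) by blast
  have "cross (cross l q) u = bil l u *s q - bil u q *s l"
    by (simp add: vec_eq_iff forall_3 bil_3 algebra_simps)
  then have "cross (cross l q) u \<noteq> 0" using assms q by simp
  moreover have "bil l (cross l q) = 0" unfolding bil_commute[of l] by simp
  ultimately show ?thesis using that by blast
qed

text \<open>A line contains at most two centers, and these serve as basis vectors.\<close>

lemma line_basis_with_centers:
  assumes L: "vec.subspace L" "vec.dim L = 2"
  shows "\<exists>z1 z2. z1 \<in> L \<and> z2 \<in> L \<and> (\<forall>p q. p *s z1 + q *s z2 = 0 \<longrightarrow> p = 0 \<and> q = 0) \<and>
    (\<forall>i. e i \<in> L \<longrightarrow> z1 = e i \<or> z2 = e i)"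
proof (cases "\<exists>i j. i \<noteq> j \<and> e i \<in> L \<and> e j \<in> L")
  case True
  then obtain i j where ij: "i \<noteq> j" "e i \<in> L" "e j \<in> L" by blast
  show ?thesis
    by (rule exI[of _ "e i"], rule exI[of _ "e j"])
      (use ij distinct_centers[OF ij(1)] at_most_two_centers_on_line[OF L ij(1)] in \<open>metis\<close>)
next
  case False
  obtain z1 where z1: "z1 \<in> L" "z1 \<noteq> 0" "\<And>i. e i \<in> L \<Longrightarrow> z1 = e i"
  proof (cases "\<exists>i. e i \<in> L")
    case True
    then obtain i where i: "e i \<in> L" by blast
    have "e i = e k" if "e k \<in> L" for k using False i that by metis
    then show ?thesis using that[OF i e0] by blast
  next
    case none: False
    obtain z where "z \<in> L" "z \<noteq> 0" using L(2) vec.dim_eq_0[of L] by auto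
    then show ?thesis using that[of z] none by blast
  qed
  obtain z2 where z2: "z2 \<in> L" "\<And>p q. p *s z1 + q *s z2 = 0 \<Longrightarrow> p = 0 \<and> q = 0"
    by (rule line_second_point[OF L z1(1,2)]) (rule that)
  show ?thesis by (rule exI[of _ z1], rule exI[of _ z2]) (use z1 z2 in blast)
qed

text \<open>If the basis vector \<open>p\<close> of the axis is a center, it is moved off the axis within the plane of its camera,
  so that this plane is the limit of the planes of the moving line.\<close>

lemma escape_direction:
  assumes bx: "\<And>i. block x i \<noteq> 0" and z: "\<And>i. bil (block x i) (C i *v z) = 0"
    and ne: "\<And>i. p = e i \<Longrightarrow> C i *v z \<noteq> 0"
  obtains r where "\<And>i. p = e i \<Longrightarrow> bil (block x i) (C i *v r) = 0"
    "\<And>i. p = e i \<Longrightarrow> image_line i r z \<noteq> 0"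
proof (cases "\<exists>i. p = e i")
  case True
  then obtain i where i: "p = e i" by blast
  obtain w where w: "bil (block x i) w = 0" "cross w (C i *v z) \<noteq> 0"
    by (rule perpendicular_not_parallel[OF z bx ne[OF i]]) (rule that)
  obtain r where r: "C i *v r = w" using surj by blast
  have "j = i" if "p = e j" for j using distinct_centers[of i j 1 "-1"] that i by auto
  then show ?thesis using that[of r] w r by blast
qed (use that in blast)

text \<open>The axis is approached by the lines through \<open>z1 + t r1\<close> and \<open>z2 + t r2\<close>, which avoid the centers for small
  \<open>t \<noteq> 0\<close>. If \<open>z1\<close> is the center of camera \<open>i\<close>, the \<open>i\<close>-th block of \<open>Psi\<close> is divisible by \<open>t\<close>;
  after division by \<open>t\<close> it tends to the given block of \<open>x\<close>, by the choice of \<open>r1\<close>.\<close>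

lemma dim_tangent_ge:
  assumes x: "x \<in> multicone X" and m: "minor a b y1 y2 x \<noteq> 0"
  shows "CARD('m) + 4 \<le> vec.dim (T x)"
proof -
  have ab: "a \<noteq> b" using m by (auto simp: minor_def)
  obtain \<alpha> \<beta> where pen: "\<And>k z. plane x k z = \<alpha> k * plane x a z + \<beta> k * plane x b z"
    by (rule planes_in_pencil[OF x m]) (rule that)
  define L where "L = axis_line a b x"
  have L: "vec.subspace L" "vec.dim L = 2" by (simp_all add: L_def subspace_axis_line dim_axis_line[OF m])
  have hL: "bil (block x i) (C i *v z) = 0" if "z \<in> L" for i z
    using that pen[of i z] by (simp add: L_def axis_line_def plane_def)
  have bx: "block x i \<noteq> 0" for i using x by (simp add: multicone_def nonzero_blocks_def)
  note line_basis_with_centers[OF L]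
  then obtain z1 z2 where z: "z1 \<in> L" "z2 \<in> L" "\<And>p q. p *s z1 + q *s z2 = 0 \<Longrightarrow> p = 0 \<and> q = 0"
    and onL: "\<And>i. e i \<in> L \<Longrightarrow> z1 = e i \<or> z2 = e i" by blast
  have z12: "\<not> (z1 = e i \<and> z2 = e i)" for i using z(3)[of 1 "-1"] by auto
  have Cz: "C i *v z2 \<noteq> 0" if "z1 = e i" for i
  proof
    assume "C i *v z2 = 0"
    then obtain c where "z2 = c *s e i" using kernel by blast
    then show False using z(3)[of c "-1"] that by simp
  qed
  have Cz': "C i *v z1 \<noteq> 0" if "z2 = e i" for i
  proof
    assume "C i *v z1 = 0"
    then obtain c where "z1 = c *s e i" using kernel by blast
    then show False using z(3)[of "-1" c] that by simp
  qed
  obtain r1 where r1: "\<And>i. z1 = e i \<Longrightarrow> bil (block x i) (C i *v r1) = 0"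
    "\<And>i. z1 = e i \<Longrightarrow> image_line i r1 z2 \<noteq> 0"
  proof (rule escape_direction[where p = z1, OF bx hL[OF z(2)]])
    show "C i *v z2 \<noteq> 0" if "z1 = e i" for i using that by (rule Cz)
  qed (rule that)
  obtain r2 where r2: "\<And>i. z2 = e i \<Longrightarrow> bil (block x i) (C i *v r2) = 0"
    "\<And>i. z2 = e i \<Longrightarrow> image_line i r2 z1 \<noteq> 0"
  proof (rule escape_direction[where p = z2, OF bx hL[OF z(1)]])
    show "C i *v z1 \<noteq> 0" if "z2 = e i" for i using that by (rule Cz')
  qed (rule that)
  \<comment> \<open>Up to a factor \<open>t\<close>, the images of the two moving points in camera \<open>i\<close>.\<close>
  define U where "U = (\<lambda>i (t::complex). if z1 = e i then C i *v r1 else C i *v z1 + t *s (C i *v r1))"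
  define V where "V = (\<lambda>i (t::complex). if z2 = e i then C i *v r2 else C i *v z2 + t *s (C i *v r2))"
  have UV0: "cross (U i 0) (V i 0) \<noteq> 0" "bil (block x i) (U i 0) = 0" "bil (block x i) (V i 0) = 0" for i
  proof -
    show "bil (block x i) (U i 0) = 0" "bil (block x i) (V i 0) = 0"
      using r1(1)[of i] r2(1)[of i] hL z(1,2) by (simp_all add: U_def V_def)
    show "cross (U i 0) (V i 0) \<noteq> 0"
    proof (cases "z1 = e i \<or> z2 = e i")
      case True
      moreover have "cross (C i *v z1) (C i *v r2) = - image_line i r2 z1" by (rule cross_commute)
      ultimately show ?thesis using r1(2)[of i] r2(2)[of i] z12[of i] by (auto simp: U_def V_def)
    next
      case False
      have "image_line i z1 z2 \<noteq> 0"
        unfolding cross_ne_iff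
      proof (intro allI impI)
        fix p q assume "C i *v (p *s z1 + q *s z2) = 0"
        then obtain c where c: "p *s z1 + q *s z2 = c *s e i" using kernel by blast
        show "p = 0 \<and> q = 0"
        proof (cases "c = 0")
          case True
          then show ?thesis using c z(3) by simp
        next
          case c0: False
          have "c *s e i \<in> L" unfolding c[symmetric] using z L(1) by (simp add: vec.subspace_add vec.subspace_scale)
          then have "(1 / c) *s (c *s e i) \<in> L" using L(1) by (metis vec.subspace_scale)
          then have "e i \<in> L" using c0 by simp
          then show ?thesis using onL False by blast
        qed
      qed
      then show ?thesis using False by (simp add: U_def V_def)
    qed
  qed
  have "\<exists>c. block x i = c *s cross (U i 0) (V i 0)" for i
    by (rule orthogonal_to_two[OF UV0(2,3,1)]) blast
  then obtain \<sigma> where \<sigma>: "\<And>i. block x i = \<sigma> i *s cross (U i 0) (V i 0)" by metis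
  have \<sigma>0: "\<sigma> i \<noteq> 0" for i using \<sigma>[of i] bx[of i] by auto
  define P where "P = (\<lambda>t. of_blocks (\<lambda>i. \<sigma> i *s cross (U i t) (V i t)))"
  have P0: "P 0 = x" by (rule vec_block_eqI) (simp add: P_def \<sigma>)
  have contU: "continuous_on UNIV (\<lambda>t. U i t $ j)" "continuous_on UNIV (\<lambda>t. V i t $ j)" for i j
    by (cases "z1 = e i"; cases "z2 = e i"; simp add: U_def V_def; intro continuous_intros)+
  have contP: "continuous_on UNIV P"
  proof -
    have "continuous_on UNIV (\<lambda>t. P t $ k)" for k
    proof -
      obtain i j where k: "k = (i, j)" by (cases k)
      have "j = 1 \<or> j = 2 \<or> j = 3" by (rule exhaust_3)
      then show ?thesis unfolding P_def of_blocks_def k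
        by (elim disjE) (simp_all, (intro continuous_intros contU)+)
    qed
    then have "continuous_on UNIV (\<lambda>t. \<chi> k. P t $ k)" by (intro continuous_on_vec_lambda)
    then show ?thesis by simp
  qed
  define h where "h = (\<lambda>n :: nat. 1 / of_nat (Suc n) :: complex)"
  have h0: "h n \<noteq> 0" for n unfolding h_def by (metis divide_eq_0_iff of_nat_eq_0_iff one_neq_zero nat.simps(3))
  have hlim: "h \<longlonglongrightarrow> 0" unfolding h_def by (rule LIMSEQ_Suc[OF lim_1_over_n])
  have Plim: "(\<lambda>n. P (h n)) \<longlonglongrightarrow> x"
    using continuous_on_tendsto_compose[OF contP hlim] P0 by simp
  have cb: "continuous_on UNIV (\<lambda>w :: complex^('m \<times> 3). block w i $ j)" for i j
    unfolding block_def by (simp, intro continuous_intros)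
  have ch: "continuous_on UNIV (\<lambda>w. plane w i v)" for i v
    unfolding plane_def bil_def by (intro continuous_intros cb)
  have cm: "continuous_on UNIV (minor a b y1 y2)"
    unfolding minor_def[abs_def] by (intro continuous_intros ch)
  have ev1: "eventually (\<lambda>n. minor a b y1 y2 (P (h n)) \<noteq> 0) sequentially"
    using continuous_on_tendsto_compose[OF cm Plim] m by (intro tendsto_imp_eventually_ne) auto
  have evb: "eventually (\<lambda>n. block (P (h n)) i \<noteq> 0) sequentially" for i
  proof -
    obtain j where j: "block x i $ j \<noteq> 0" using bx[of i] by (metis vec_eq_iff zero_index)
    have "(\<lambda>n. block (P (h n)) i $ j) \<longlonglongrightarrow> block x i $ j"
      using continuous_on_tendsto_compose[OF cb Plim] by auto
    then have "eventually (\<lambda>n. block (P (h n)) i $ j \<noteq> 0) sequentially"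
      using j by (rule tendsto_imp_eventually_ne)
    then show ?thesis by (rule eventually_mono) auto
  qed
  have "eventually (\<lambda>n. \<forall>i. block (P (h n)) i \<noteq> 0) sequentially"
    using evb by (intro eventually_all_finite) auto
  with ev1 have "eventually (\<lambda>n. minor a b y1 y2 (P (h n)) \<noteq> 0 \<and> (\<forall>i. block (P (h n)) i \<noteq> 0)) sequentially"
    by (rule eventually_conj)
  then obtain N where N: "\<And>n. n \<ge> N \<Longrightarrow> minor a b y1 y2 (P (h n)) \<noteq> 0"
    "\<And>n i. n \<ge> N \<Longrightarrow> block (P (h n)) i \<noteq> 0"
    unfolding eventually_sequentially by blast
  have generic: "CARD('m) + 4 \<le> vec.dim (T (P (h n)))" if n: "n \<ge> N" for n
  proof -
    define t where "t = h n"
    define u where "u = z1 + t *s r1"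
    define v where "v = z2 + t *s r2"
    have t0: "t \<noteq> 0" using h0 by (simp add: t_def)
    \<comment> \<open>The factor \<open>1 / t\<close> undoes the vanishing of the block of a center on the axis.\<close>
    define s where "s = (\<lambda>i. \<sigma> i * (if z1 = e i then 1 / t else 1) * (if z2 = e i then 1 / t else 1))"
    have s0: "s i \<noteq> 0" for i using \<sigma>0 t0 by (simp add: s_def)
    have cu: "C i *v u = (if z1 = e i then t else 1) *s U i t" for i
      by (simp add: u_def U_def camera_simps)
    have cv: "C i *v v = (if z2 = e i then t else 1) *s V i t" for i
      by (simp add: v_def V_def camera_simps)
    have Pt: "P t = of_blocks (\<lambda>i. s i *s image_line i u v)"
      unfolding P_def
    proof (rule arg_cong[where f = of_blocks], rule ext)
      fix i
      show "\<sigma> i *s cross (U i t) (V i t) = s i *s image_line i u v"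
        unfolding cu cv s_def using t0 by simp
    qed
    have nzP: "nonzero_blocks (Psi u v)"
    proof -
      have "s i *s image_line i u v \<noteq> 0" for i
        using N(2)[OF n, of i] unfolding t_def[symmetric] Pt by simp
      then show ?thesis unfolding nonzero_blocks_def block_Psi by (metis vec.scale_zero_right)
    qed
    \<comment> \<open>The line is skew to the one through the centers of \<open>a\<close> and \<open>b\<close>, since otherwise the two planes would coincide.\<close>
    have sk: "vol p u v (e q) \<noteq> 0"
      if pq: "p = a \<and> q = b \<or> p = b \<and> q = a" for p q
    proof
      assume 0: "vol p u v (e q) = 0"
      have hP: "plane (P t) i w = s i * vol i u v w" for i w
        unfolding Pt plane_def by simp
      have "image_line q u v \<noteq> 0" using nzP by (simp add: nonzero_blocks_def)
      then obtain w where w: "\<And>z. \<exists>p' q' r' s'. z = p' *s u + q' *s v + r' *s e q + s' *s w"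
        by (rule basis_with_center) (rule that)
      have hu: "plane (P t) i u = 0" "plane (P t) i v = 0" for i by (simp_all add: hP)
      have he: "plane (P t) p (e q) = 0" using 0 by (simp add: hP)
      have "\<exists>s'. plane (P t) p y = s' * plane (P t) p w \<and> plane (P t) q y = s' * plane (P t) q w" for y
      proof -
        obtain p' q' r' s' where y: "y = p' *s u + q' *s v + r' *s e q + s' *s w" using w by blast
        have "plane (P t) p y = s' * plane (P t) p w \<and> plane (P t) q y = s' * plane (P t) q w"
          unfolding y plane_simps hu he by simp
        then show ?thesis by blast
      qed
      then obtain f where f: "\<And>y. plane (P t) p y = f y * plane (P t) p w" "\<And>y. plane (P t) q y = f y * plane (P t) q w"
        by metis
      have "minor p q y1 y2 (P t) = 0" unfolding minor_def f[of y1] f[of y2] by simp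
      moreover have "minor p q y1 y2 (P t) = minor a b y1 y2 (P t) \<or> minor p q y1 y2 (P t) = - minor a b y1 y2 (P t)"
        using pq by (auto simp: minor_def)
      ultimately show False using N(1)[OF n] by (auto simp: t_def)
    qed
    show ?thesis unfolding t_def[symmetric] Pt
      by (rule dim_tangent_generic_ge[OF s0 nzP ab]) (use sk in auto)
  qed
  show ?thesis
  proof (rule dim_tangent_semicontinuous[OF X_subset_multi_points])
    show "(\<lambda>n. P (h (n + N))) \<longlonglongrightarrow> x" using Plim by (rule LIMSEQ_ignore_initial_segment)
    show "CARD('m) + 4 \<le> vec.dim (T (P (h (n + N))))" for n by (rule generic) simp
  qed
qed

lemma dim_tangent_eq:
  assumes "x \<in> multicone X" "minor a b y1 y2 x \<noteq> 0"
  shows "vec.dim (T x) = CARD('m) + 4"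
  using dim_tangent_le[OF assms] dim_tangent_ge[OF assms] by simp

section \<open>Coplanar centers\<close>

text \<open>Vanishing 2 by 2 minors make all planes proportional.\<close>

lemma all_planes_equal:
  assumes x: "x \<in> multicone X" and m: "\<And>a b y1 y2. minor a b y1 y2 x = 0"
    and "plane x i z = 0"
  shows "plane x j z = 0"
proof -
  have "block x i \<noteq> 0" using x by (simp add: multicone_def nonzero_blocks_def)
  then obtain w where w: "plane x i w \<noteq> 0" by (rule plane_nonzero)
  have "plane x i w * plane x j z = 0" using m[of i j w z] assms(3) by (simp add: minor_def)
  then show ?thesis using w by simp
qed

lemma kernel_plane:
  assumes "block x i \<noteq> 0"
  shows "{z. plane x i z = 0} \<in> proj_planes"
proof -
  define H where "H = {z. plane x i z = 0}"
  obtain w where w: "plane x i w \<noteq> 0" by (rule plane_nonzero[OF assms])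
  have sH: "vec.subspace H" by (auto simp: H_def vec.subspace_def)
  have wP: "vec.span {w} \<in> proj_points" using w by (intro span_singleton_in_proj_points) auto
  then have sw: "vec.subspace (vec.span {w})" "vec.dim (vec.span {w}) = 1" unfolding proj_flats_def by auto
  have "H \<inter> vec.span {w} \<subseteq> {0}" using w by (auto simp: H_def vec.span_singleton)
  then have d0: "vec.dim (H \<inter> vec.span {w}) = 0" by (simp add: vec.dim_eq_0)
  have "z \<in> {u + v |u v. u \<in> H \<and> v \<in> vec.span {w}}" for z
  proof -
    have "z = (z - (plane x i z / plane x i w) *s w) + (plane x i z / plane x i w) *s w" by simp
    moreover have "z - (plane x i z / plane x i w) *s w \<in> H" using w by (simp add: H_def)
    moreover have "(plane x i z / plane x i w) *s w \<in> vec.span {w}" by (simp add: vec.span_base vec.span_scale)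
    ultimately show ?thesis by blast
  qed
  then have all: "{u + v |u v. u \<in> H \<and> v \<in> vec.span {w}} = UNIV" by blast
  have "vec.dim H = 3"
    using vec.dim_sums_Int[OF sH sw(1)] unfolding all d0 sw(2) by (simp add: vec_dim_card card_cart_basis)
  then show ?thesis using sH by (simp add: proj_flats_def H_def)
qed

lemma rank_one_coplanar:
  assumes x: "x \<in> multicone X" and m: "\<And>a b y1 y2. minor a b y1 y2 x = 0"
  shows "coplanar_cameras C"
proof -
  define i :: 'm where "i = undefined"
  have "{z. plane x i z = 0} \<in> proj_planes" using x by (intro kernel_plane) (simp add: multicone_def nonzero_blocks_def)
  moreover have "center (C j) \<subseteq> {z. plane x i z = 0}" for j
  proof -
    have "plane x i (e j) = 0" by (rule all_planes_equal[OF x m, of j]) simp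
    then show ?thesis by (auto simp: center vec.span_singleton)
  qed
  ultimately show ?thesis unfolding coplanar_cameras_def by blast
qed

definition center_span :: "(complex^4) set" where
  "center_span = vec.span (\<Union>i. center (C i))"

lemma e_in_center_span: "e i \<in> center_span"
  unfolding center_span_def by (intro vec.span_base UN_I[of i]) (simp_all add: center vec.span_base)

lemma subspace_center_span: "vec.subspace center_span"
  by (simp add: center_span_def vec.subspace_span)

lemma three_centers_span:
  assumes ijk: "i \<noteq> j" "i \<noteq> k" "j \<noteq> k" and H: "vec.subspace H" "vec.dim H = 3" "\<And>i. e i \<in> H" "z \<in> H"
  shows "\<exists>p q r. z = p *s e i + q *s e j + r *s e k"
proof -
  define B where "B = {e i, e j, e k}"
  have ne: "e i \<noteq> e j" "e i \<noteq> e k" "e j \<noteq> e k"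
    using distinct_centers[of _ _ 1 "-1"] ijk by auto
  have 1: "e i \<notin> vec.span {e j, e k}"
  proof
    assume "e i \<in> vec.span {e j, e k}"
    then obtain p q where "e i = p *s e j + q *s e k" unfolding in_span_pair by blast
    then have "(-1) *s e i + p *s e j + q *s e k = 0" by simp
    then show False using no_three_collinear[OF ijk, of "-1" p q] by simp
  qed
  have 2: "e j \<notin> vec.span {e k}"
  proof
    assume "e j \<in> vec.span {e k}"
    then obtain q where "e j = q *s e k" by (auto simp: vec.span_singleton)
    then have "(-1) *s e j + q *s e k = 0" by simp
    then show False using distinct_centers[OF ijk(3), of "-1" q] by simp
  qed
  have "vec.independent B" using 1 2 ne e0 by (simp add: B_def vec.independent_insert)
  moreover have "card B = 3" using ne by (simp add: B_def)
  ultimately have "H \<subseteq> vec.span B"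
    using vec.card_ge_dim_independent[of B H] H by (auto simp: B_def)
  then have "z \<in> vec.span (insert (e i) {e j, e k})" using H(4) by (auto simp: B_def)
  then obtain p where "z - p *s e i \<in> vec.span {e j, e k}" by (auto simp: vec.span_insert[of "e i"])
  then obtain q r where "z - p *s e i = q *s e j + r *s e k" unfolding in_span_pair by blast
  then have "z = p *s e i + q *s e j + r *s e k" by (simp add: algebra_simps)
  then show ?thesis by blast
qed

lemma distinct_triple:
  fixes i :: 'm
  obtains j k :: 'm where "i \<noteq> j" "i \<noteq> k" "j \<noteq> k"
proof -
  obtain j where j: "j \<noteq> i" by (rule third_camera[of i i]) (rule that)
  obtain k where k: "k \<noteq> i" "k \<noteq> j" by (rule third_camera[of i j]) (rule that)
  show ?thesis by (rule that[of j k]) (use j k in auto)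
qed

lemma cross_centers_ne:
  assumes "i \<noteq> j" "i \<noteq> k" "j \<noteq> k"
  shows "image_line i (e j) (e k) \<noteq> 0"
  unfolding cross_ne_iff
proof (intro allI impI)
  fix p q assume "C i *v (p *s e j + q *s e k) = 0"
  then obtain r where "p *s e j + q *s e k = r *s e i" using kernel by blast
  then have "(-r) *s e i + p *s e j + q *s e k = 0" by (simp add: algebra_simps)
  then show "p = 0 \<and> q = 0" using no_three_collinear[OF assms, of "-r" p q] by simp
qed

end

locale coplanar_arrangement = camera_arrangement C e
  for C :: "'m::finite \<Rightarrow> complex^4^3" and e +
  assumes coplanar: "coplanar_cameras C"
begin

lemma center_span_dim: "vec.dim center_span = 3"
proof -
  obtain H where H: "H \<in> proj_planes" "\<And>i. center (C i) \<subseteq> H"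
    using coplanar by (auto simp: coplanar_cameras_def)
  have sH: "vec.subspace H" "vec.dim H = 3" using H(1) by (auto simp: proj_flats_def)
  have eH: "e i \<in> H" for i using H(2)[of i] by (auto simp: center vec.span_base)
  obtain j k :: 'm where jk: "undefined \<noteq> j" "undefined \<noteq> k" "j \<noteq> k" by (rule distinct_triple[of undefined])
  have "H \<subseteq> center_span"
  proof
    fix z assume "z \<in> H"
    then obtain p q r where "z = p *s e undefined + q *s e j + r *s e k"
      using three_centers_span[OF jk sH eH] by blast
    then show "z \<in> center_span"
      using e_in_center_span subspace_center_span by (simp add: vec.subspace_add vec.subspace_scale)
  qed
  moreover have "center_span \<subseteq> H" unfolding center_span_def
    using H(2) sH(1) by (intro vec.span_minimal) auto
  ultimately show ?thesis using sH by auto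
qed

lemma in_center_span:
  assumes "i \<noteq> j" "i \<noteq> k" "j \<noteq> k" "z \<in> center_span"
  shows "\<exists>p q r. z = p *s e i + q *s e j + r *s e k"
  by (rule three_centers_span[OF assms(1-3) subspace_center_span center_span_dim e_in_center_span assms(4)])

text \<open>The image of a line in the plane of the centers does not depend on the line; it is the image of the plane.\<close>

definition singular_pt :: "'m \<Rightarrow> (complex^3) set" where
  "singular_pt = (\<lambda>i. linear_equation ((*v) (C i) ` center_span))"

lemma mem_singular_pt: "l \<in> singular_pt i \<longleftrightarrow> (\<forall>z\<in>center_span. bil l (C i *v z) = 0)"
proof -
  have s: "(\<Sum>j\<in>UNIV. z $ j * l $ j) = bil l z" for z :: "complex^3"
    unfolding bil_def by (intro sum.cong) (simp_all add: mult.commute)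
  show ?thesis unfolding singular_pt_def linear_equation_def by (simp only: s mem_Collect_eq ball_simps)
qed

text \<open>Two further centers give two different points of the image of the plane, so the image is a line.\<close>

lemma singular_pt_eq_span:
  assumes "l \<noteq> 0" "l \<in> singular_pt i"
  shows "singular_pt i = vec.span {l}"
proof -
  obtain j k where jk: "i \<noteq> j" "i \<noteq> k" "j \<noteq> k" by (rule distinct_triple[of i])
  define \<eta> where "\<eta> = image_line i (e j) (e k)"
  have \<eta>: "\<exists>c. l' = c *s \<eta>" if "l' \<in> singular_pt i" for l'
  proof -
    have "bil l' (C i *v e j) = 0" "bil l' (C i *v e k) = 0" using that e_in_center_span unfolding mem_singular_pt by blast+
    then show ?thesis unfolding \<eta>_def by (rule orthogonal_to_two[OF _ _ cross_centers_ne[OF jk]]) blast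
  qed
  obtain c where c: "l = c *s \<eta>" using \<eta>[OF assms(2)] by blast
  have c0: "c \<noteq> 0" using c assms(1) by auto
  show ?thesis
  proof (intro equalityI subsetI)
    fix l' assume "l' \<in> singular_pt i"
    then obtain c' where "l' = c' *s \<eta>" using \<eta> by blast
    then have "l' = (c' / c) *s l" using c c0 by simp
    then show "l' \<in> vec.span {l}" unfolding vec.span_singleton by blast
  next
    fix l' assume "l' \<in> vec.span {l}"
    then obtain c' where "l' = c' *s l" unfolding vec.span_singleton by blast
    then show "l' \<in> singular_pt i" using assms(2) unfolding mem_singular_pt by simp
  qed
qed

lemma proj_eq_singular_pt:
  assumes "nonzero_blocks x" "\<And>i z. z \<in> center_span \<Longrightarrow> plane x i z = 0"
  shows "proj x = singular_pt"
proof
  fix i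
  have "block x i \<noteq> 0" using assms(1) by (simp add: nonzero_blocks_def)
  moreover have "block x i \<in> singular_pt i" unfolding mem_singular_pt using assms(2) by (simp add: plane_def)
  ultimately show "proj x i = singular_pt i" unfolding proj_def by (rule singular_pt_eq_span[symmetric])
qed

lemma singular_pt_planes:
  assumes "nonzero_blocks x" "proj x = singular_pt" "z \<in> center_span"
  shows "plane x i z = 0"
proof -
  have "block x i \<in> proj x i" by (simp add: proj_def vec.span_base)
  then have "block x i \<in> singular_pt i" by (simp add: assms(2))
  then show ?thesis using assms(3) unfolding mem_singular_pt plane_def by blast
qed

lemma proj_Psi_coplanar:
  assumes "nonzero_blocks (Psi x y)" "x \<in> center_span" "y \<in> center_span"
  shows "proj (Psi x y) = singular_pt"
proof (rule proj_eq_singular_pt[OF assms(1)])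
  fix i :: 'm and z assume z: "z \<in> center_span"
  obtain j k where jk: "i \<noteq> j" "i \<noteq> k" "j \<noteq> k" by (rule distinct_triple[of i])
  have c: "\<exists>q r. C i *v w = q *s (C i *v e j) + r *s (C i *v e k)" if w: "w \<in> center_span" for w
  proof -
    obtain p q r where "w = p *s e i + q *s e j + r *s e k" using in_center_span[OF jk w] by blast
    then have "C i *v w = q *s (C i *v e j) + r *s (C i *v e k)"
      by (simp add: camera_simps)
    then show ?thesis by blast
  qed
  obtain q1 r1 where 1: "C i *v x = q1 *s (C i *v e j) + r1 *s (C i *v e k)" using c[OF assms(2)] by blast
  obtain q2 r2 where 2: "C i *v y = q2 *s (C i *v e j) + r2 *s (C i *v e k)" using c[OF assms(3)] by blast
  obtain q3 r3 where 3: "C i *v z = q3 *s (C i *v e j) + r3 *s (C i *v e k)" using c[OF z] by blast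
  show "plane (Psi x y) i z = 0" unfolding plane_Psi 1 2 3 by (simp add: bil_3 algebra_simps)
qed

lemma rank_one_is_singular_pt:
  assumes x: "x \<in> multicone X" and m: "\<And>a b y1 y2. minor a b y1 y2 x = 0"
  shows "proj x = singular_pt"
proof (rule proj_eq_singular_pt)
  show "nonzero_blocks x" using x by (simp add: multicone_def)
  fix i z assume "z \<in> center_span"
  moreover have "center_span \<subseteq> {z. plane x i z = 0}"
    unfolding center_span_def
  proof (rule vec.span_minimal)
    have "plane x i (e j) = 0" for j by (rule all_planes_equal[OF x m, of j]) simp
    then show "(\<Union>i. center (C i)) \<subseteq> {z. plane x i z = 0}" by (auto simp: center vec.span_singleton)
    show "vec.subspace {z. plane x i z = 0}" by (auto simp: vec.subspace_def)
  qed
  ultimately show "plane x i z = 0" by blast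
qed

subsection \<open>Lines in the plane of the centers\<close>

text \<open>The lines used near the singular point form a family in the plane of \<open>e a\<close>, \<open>e b\<close>, \<open>e c\<close>. For fixed \<open>q\<close>
  each camera excludes at most one value of \<open>r\<close>.\<close>

lemma finite_bad_lines:
  assumes abc: "a \<noteq> b" "a \<noteq> c" "b \<noteq> c" and q: "q \<noteq> 0"
  shows "finite {r. \<not> nonzero_blocks (Psi (e c - q *s e b) (e a - r *s e b))}"
proof -
  have blk: "block (Psi (e c - q *s e b) (e a - r *s e b)) i
      = (image_line i (e c) (e a) - q *s image_line i (e b) (e a)) - r *s image_line i (e c) (e b)" for i r
    by (simp add: camera_simps vec.scale_right_diff_distrib algebra_simps)
  have "finite {r. block (Psi (e c - q *s e b) (e a - r *s e b)) i = 0}" for i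
  proof (cases "i = b \<or> i = c")
    case True
    have "block (Psi (e c - q *s e b) (e a - r *s e b)) i \<noteq> 0" for r
      unfolding blk using True cross_centers_ne[of b c a] cross_centers_ne[of c b a] abc q by auto
    then show ?thesis by simp
  next
    case False
    define A where "A = image_line i (e c) (e a) - q *s image_line i (e b) (e a)"
    define B where "B = image_line i (e c) (e b)"
    have "B \<noteq> 0" unfolding B_def using False abc by (intro cross_centers_ne) auto
    then obtain j where j: "B $ j \<noteq> 0" by (auto simp: vec_eq_iff)
    have "r = A $ j / B $ j" if "A - r *s B = 0" for r
    proof -
      have "(A - r *s B) $ j = 0" unfolding that by simp
      then show ?thesis using j by (simp add: field_simps)
    qed
    then have "{r. A - r *s B = 0} \<subseteq> {A $ j / B $ j}" by blast
    then show ?thesis unfolding blk A_def[symmetric] B_def[symmetric] by (rule finite_subset) simp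
  qed
  then have "finite (\<Union>i. {r. block (Psi (e c - q *s e b) (e a - r *s e b)) i = 0})"
    by (intro finite_UN_I) simp_all
  moreover have "{r. \<not> nonzero_blocks (Psi (e c - q *s e b) (e a - r *s e b))}
      \<subseteq> (\<Union>i. {r. block (Psi (e c - q *s e b) (e a - r *s e b)) i = 0})" unfolding nonzero_blocks_def by blast
  ultimately show ?thesis by (rule rev_finite_subset)
qed

lemma good_line:
  assumes "a \<noteq> b" "a \<noteq> c" "b \<noteq> c" "q \<noteq> 0" "finite S"
  obtains r where "nonzero_blocks (Psi (e c - q *s e b) (e a - r *s e b))" "r \<notin> S"
proof -
  have "finite ({r. \<not> nonzero_blocks (Psi (e c - q *s e b) (e a - r *s e b))} \<union> S)"
    using finite_bad_lines[OF assms(1-4)] assms(5) by blast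
  then obtain r where "r \<notin> {r. \<not> nonzero_blocks (Psi (e c - q *s e b) (e a - r *s e b))} \<union> S"
    using ex_new_if_finite[OF infinite_UNIV_char_0] by blast
  then show ?thesis using that by blast
qed

lemma line_in_center_span: "e c - q *s e b \<in> center_span" "e a - r *s e b \<in> center_span"
  using e_in_center_span subspace_center_span by (simp_all add: vec.subspace_diff vec.subspace_scale)

lemma image_of_plane_lines:
  "joint_camera_map C ` {L \<in> camera_domain C. L \<subseteq> center_span} = {singular_pt}"
proof (intro equalityI subsetI)
  fix p assume "p \<in> joint_camera_map C ` {L \<in> camera_domain C. L \<subseteq> center_span}"
  then obtain L where L: "L \<in> camera_domain C" "L \<subseteq> center_span" "p = joint_camera_map C L" by blast
  obtain x y where xy: "L = vec.span {x, y}" "nonzero_blocks (Psi x y)" by (rule camera_domain_pair[OF L(1)])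
  have "x \<in> L" "y \<in> L" unfolding xy(1) by (simp_all add: vec.span_base)
  then have "proj (Psi x y) = singular_pt" using L(2) xy(2) by (intro proj_Psi_coplanar) auto
  then show "p \<in> {singular_pt}" using span_pair_in_domain(2)[OF xy(2)] L(3) xy(1) by simp
next
  fix p assume "p \<in> {singular_pt}"
  obtain b c :: 'm where bc: "undefined \<noteq> b" "undefined \<noteq> c" "b \<noteq> c" by (rule distinct_triple[of undefined])
  obtain r where r: "nonzero_blocks (Psi (e c - 1 *s e b) (e undefined - r *s e b))"
    by (rule good_line[OF bc, of 1 "{}"]) simp_all
  define L where "L = vec.span {e c - 1 *s e b, e undefined - r *s e b}"
  have "L \<in> camera_domain C" "joint_camera_map C L = singular_pt"
    unfolding L_def span_pair_in_domain(2)[OF r] using span_pair_in_domain(1)[OF r] proj_Psi_coplanar[OF r line_in_center_span]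
    by simp_all
  moreover have "L \<subseteq> center_span" unfolding L_def
    by (intro vec.span_minimal subspace_center_span) (use line_in_center_span[of c 1 b] line_in_center_span(2) in auto)
  ultimately show "p \<in> joint_camera_map C ` {L \<in> camera_domain C. L \<subseteq> center_span}"
    using \<open>p \<in> {singular_pt}\<close> by (intro image_eqI[of _ _ L]) simp_all
qed

lemma singular_pt_in_X: "singular_pt \<in> X"
proof -
  have "singular_pt \<in> joint_camera_map C ` camera_domain C" using image_of_plane_lines by blast
  then show ?thesis unfolding line_multiview_variety_def by (rule hull_inc)
qed

subsection \<open>The tangent space at the singular point\<close>

text \<open>A line in the plane of the centers is tilted by moving its point \<open>u\<close> in the direction \<open>d\<close>. The factors
  \<open>s i\<close> adjust the image of the line to the given coordinates \<open>x\<close> of the singular point.\<close>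

lemma plane_line_tangent:
  assumes x: "nonzero_blocks x" "proj x = singular_pt" and p: "nonzero_blocks (Psi u v)" "u \<in> center_span" "v \<in> center_span"
  obtains s where "\<And>i. block x i = s i *s image_line i u v"
    "of_blocks (\<lambda>i. s i *s image_line i d v) \<in> T x"
proof -
  have "\<exists>s. block x i = s *s image_line i u v" for i
  proof -
    have "image_line i u v \<noteq> 0" using p(1) by (simp add: nonzero_blocks_def)
    moreover have "bil (block x i) (C i *v u) = 0" "bil (block x i) (C i *v v) = 0"
      using singular_pt_planes[OF x p(2)] singular_pt_planes[OF x p(3)] by (simp_all add: plane_def)
    ultimately show ?thesis using orthogonal_to_two by blast
  qed
  then obtain s where s: "\<And>i. block x i = s i *s image_line i u v" by metis
  have "x = of_blocks (\<lambda>i. s i *s image_line i u v)" by (rule vec_block_eqI) (simp add: s)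
  then have "of_blocks (\<lambda>i. s i *s image_line i d v) \<in> T x"
    using moving_line_tangent[of s d v u 0] by simp
  then show ?thesis using that s by blast
qed

lemma double_cross_span:
  assumes "bil (cross u v) w \<noteq> 0"
  obtains p q r where "z = p *s cross u v + q *s cross u w + r *s cross v w"
proof -
  define D where "D = bil (cross u v) w"
  have "D *s z = bil z w *s cross u v + (- bil z v) *s cross u w + bil z u *s cross v w"
    by (simp add: D_def vec_eq_iff forall_3 bil_3 algebra_simps)
  then have "(1 / D) *s (D *s z) = (1 / D) *s (bil z w *s cross u v + (- bil z v) *s cross u w + bil z u *s cross v w)"
    by simp
  then have "z = (bil z w / D) *s cross u v + (- bil z v / D) *s cross u w + (bil z u / D) *s cross v w"
    using assms by (simp add: D_def[symmetric] vec.scale_right_distrib)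
  then show ?thesis by (rule that)
qed

text \<open>Consider the tangent vectors from the lines of \<open>finite_bad_lines\<close>, tilted in a direction \<open>d\<close> outside
  the plane. Their blocks in cameras \<open>a\<close> and \<open>b\<close> depend neither on \<open>q\<close> nor on \<open>r\<close>, but the block in
  camera \<open>c\<close> does. Hence differences of such vectors vanish in cameras \<open>a\<close> and \<open>b\<close>, and in camera \<open>c\<close>
  they give two directions, which together with the rescaling span everything.\<close>

lemma one_camera_tangent:
  assumes x: "x \<in> multicone X" "proj x = singular_pt" and abc: "a \<noteq> b" "a \<noteq> c" "b \<noteq> c"
  shows "\<exists>v\<in>T x. block v a = 0 \<and> block v b = 0 \<and> block v c = w"
proof -
  have nzx: "nonzero_blocks x" using x(1) by (simp add: multicone_def)
  have bx: "block x i \<noteq> 0" for i using nzx by (simp add: nonzero_blocks_def)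
  have "\<exists>d. d \<notin> center_span"
  proof (rule ccontr)
    assume "\<not> ?thesis"
    then have "center_span = UNIV" by blast
    then show False using center_span_dim by (simp add: vec_dim_card card_cart_basis)
  qed
  then obtain d where d: "d \<notin> center_span" by blast
  define \<eta> where "\<eta> = (\<lambda>i j k. image_line i (e j) (e k))"
  have \<eta>0: "\<eta> i j k \<noteq> 0" if "i \<noteq> j" "i \<noteq> k" "j \<noteq> k" for i j k
    unfolding \<eta>_def using that by (rule cross_centers_ne)
  define A where "A = image_line c d (e a)"
  define B where "B = image_line c d (e b)"
  have \<lambda>: "\<exists>l. block x i = l *s \<eta> i j k" if "i \<noteq> j" "i \<noteq> k" "j \<noteq> k" for i j k
  proof -
    have "bil (block x i) (C i *v e j) = 0" "bil (block x i) (C i *v e k) = 0"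
      using singular_pt_planes[OF nzx x(2) e_in_center_span] by (simp_all add: plane_def)
    then show ?thesis unfolding \<eta>_def
      using orthogonal_to_two cross_centers_ne[OF that] by blast
  qed
  obtain la where la: "block x a = la *s \<eta> a b c" using \<lambda>[of a b c] abc by blast
  obtain lb where lb: "block x b = lb *s \<eta> b c a" using \<lambda>[of b c a] abc by blast
  obtain lc where lc: "block x c = lc *s \<eta> c a b" using \<lambda>[of c a b] abc by blast
  have lc0: "lc \<noteq> 0" using lc bx[of c] by auto
  have tan: "\<exists>v\<in>T x. block v a = (- la) *s image_line a d (e b) \<and>
      block v b = lb *s image_line b d (e a) \<and> block v c = (lc / q) *s (A - r *s B)"
    if q: "q \<noteq> 0" and r: "r \<noteq> 0" "nonzero_blocks (Psi (e c - q *s e b) (e a - r *s e b))" for q r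
  proof -
    obtain s where s: "\<And>i. block x i = s i *s image_line i (e c - q *s e b) (e a - r *s e b)"
      "of_blocks (\<lambda>i. s i *s image_line i d (e a - r *s e b)) \<in> T x"
      by (rule plane_line_tangent[OF nzx x(2) r(2) line_in_center_span]) (rule that)
    have "la *s \<eta> a b c = (s a * r) *s \<eta> a b c"
      unfolding la[symmetric] s(1)[of a] by (simp add: \<eta>_def camera_simps)
        (simp add: vec_eq_iff forall_3 algebra_simps)
    then have sa: "la = s a * r" using \<eta>0[of a b c] abc by (simp add: vec.scale_cancel_right)
    have "lb *s \<eta> b c a = s b *s \<eta> b c a"
      unfolding lb[symmetric] s(1)[of b] by (simp add: \<eta>_def camera_simps)
    then have sb: "lb = s b" using \<eta>0[of b c a] abc by (simp add: vec.scale_cancel_right)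
    have "lc *s \<eta> c a b = (s c * q) *s \<eta> c a b"
      unfolding lc[symmetric] s(1)[of c] by (simp add: \<eta>_def camera_simps)
        (simp add: vec_eq_iff forall_3 algebra_simps)
    then have sc: "lc = s c * q" using \<eta>0[of c a b] abc by (simp add: vec.scale_cancel_right)
    show ?thesis
    proof (rule bexI[OF _ s(2)], intro conjI)
      show "block (of_blocks (\<lambda>i. s i *s image_line i d (e a - r *s e b))) a
          = (- la) *s image_line a d (e b)"
        by (simp add: sa camera_simps)
      show "block (of_blocks (\<lambda>i. s i *s image_line i d (e a - r *s e b))) b
          = lb *s image_line b d (e a)"
        by (simp add: sb camera_simps)
      show "block (of_blocks (\<lambda>i. s i *s image_line i d (e a - r *s e b))) c
          = (lc / q) *s (A - r *s B)"
        using q by (simp add: sc A_def B_def camera_simps)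
    qed
  qed
  obtain r1 where r1: "nonzero_blocks (Psi (e c - 1 *s e b) (e a - r1 *s e b))" "r1 \<notin> {0}"
    by (rule good_line[OF abc, of 1 "{0}"]) simp_all
  obtain r2 where r2: "nonzero_blocks (Psi (e c - 1 *s e b) (e a - r2 *s e b))" "r2 \<notin> {0, r1}"
    by (rule good_line[OF abc, of 1 "{0, r1}"]) simp_all
  obtain r3 where r3: "nonzero_blocks (Psi (e c - 2 *s e b) (e a - r3 *s e b))" "r3 \<notin> {0}"
    by (rule good_line[OF abc, of 2 "{0}"]) simp_all
  obtain v1 where v1: "v1 \<in> T x" "block v1 a = (- la) *s image_line a d (e b)"
      "block v1 b = lb *s image_line b d (e a)" "block v1 c = (lc / 1) *s (A - r1 *s B)"
    using tan[of 1 r1] r1 by auto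
  obtain v2 where v2: "v2 \<in> T x" "block v2 a = (- la) *s image_line a d (e b)"
      "block v2 b = lb *s image_line b d (e a)" "block v2 c = (lc / 1) *s (A - r2 *s B)"
    using tan[of 1 r2] r2 by auto
  obtain v3 where v3: "v3 \<in> T x" "block v3 a = (- la) *s image_line a d (e b)"
      "block v3 b = lb *s image_line b d (e a)" "block v3 c = (lc / 2) *s (A - r3 *s B)"
    using tan[of 2 r3] r3 by auto
  \<comment> \<open>Changing \<open>r\<close> alone gives the direction \<open>B\<close>; changing \<open>q\<close> then gives \<open>A\<close>.\<close>
  define uB where "uB = (1 / (lc * (r2 - r1))) *s (v1 - v2)"
  have r21: "r2 - r1 \<noteq> 0" using r2(2) by auto
  have uB: "uB \<in> T x" "block uB a = 0" "block uB b = 0" "block uB c = B"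
  proof -
    show "uB \<in> T x" unfolding uB_def using v1(1) v2(1) subspace_T by (intro vec.subspace_scale vec.subspace_diff)
    show "block uB a = 0" "block uB b = 0" by (simp_all add: uB_def v1 v2)
    have "block uB c = (1 / (lc * (r2 - r1))) *s ((lc * (r2 - r1)) *s B)"
    proof -
      have "lc *s (A - r1 *s B) - lc *s (A - r2 *s B) = (lc * (r2 - r1)) *s B"
        by (simp add: vec_eq_iff algebra_simps)
      then show ?thesis by (simp only: uB_def v1 v2 block_simps div_by_1)
    qed
    then show "block uB c = B" using lc0 r21 by simp
  qed
  define uA where "uA = (2 / lc) *s (v1 - v3) + (2 * r1 - r3) *s uB"
  have uA: "uA \<in> T x" "block uA a = 0" "block uA b = 0" "block uA c = A"
  proof -
    show "uA \<in> T x" unfolding uA_def using v1(1) v3(1) uB(1) subspace_T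
      by (intro vec.subspace_scale vec.subspace_diff vec.subspace_add)
    show "block uA a = 0" "block uA b = 0" by (simp_all add: uA_def v1 v3 uB)
    have "block uA c = (2 / lc) *s (lc *s (A - r1 *s B) - (lc / 2) *s (A - r3 *s B)) + (2 * r1 - r3) *s B"
      by (simp add: uA_def v1 v3 uB)
    also have "\<dots> = (2 *s (A - r1 *s B) - (A - r3 *s B)) + (2 * r1 - r3) *s B"
      using lc0 by (simp add: vec.scale_right_diff_distrib)
    also have "\<dots> = A" by (simp add: vec_eq_iff algebra_simps)
    finally show "block uA c = A" .
  qed
  define uC where "uC = of_blocks (\<lambda>i. if i = c then block x c else 0)"
  have uC: "uC \<in> T x" "block uC a = 0" "block uC b = 0" "block uC c = lc *s \<eta> c a b"
    unfolding uC_def using scale_block_tangent[OF X_subset_multi_points x(1)] abc lc by simp_all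
  have "vol c (e a) (e b) d \<noteq> 0"
  proof
    assume 0: "vol c (e a) (e b) d = 0"
    have "\<exists>p q. C c *v d = p *s (C c *v e a) + q *s (C c *v e b)"
    proof -
      define n where "n = \<eta> c a b"
      have n: "n \<noteq> 0" "n = image_line c (e a) (e b)" using \<eta>0[of c a b] abc by (auto simp: n_def \<eta>_def)
      obtain f where f: "bil n f \<noteq> 0" using bil_eq_0_imp_eq_0[of n] n(1) by blast
      obtain p q r where pqr: "C c *v d = p *s (C c *v e a) + q *s (C c *v e b) + r *s f"
        by (rule cramer_3[OF f[unfolded n(2)]]) (rule that)
      have "r * bil n f = 0" using 0 unfolding pqr n(2)[symmetric] by (simp add: n(2))
      then have "r = 0" using f by simp
      then show ?thesis using pqr by auto
    qed
    then obtain p q where "C c *v d = p *s (C c *v e a) + q *s (C c *v e b)" by blast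
    then have "C c *v (d - p *s e a - q *s e b) = 0"
      by (simp add: camera_simps)
    then obtain r where "d - p *s e a - q *s e b = r *s e c" using kernel by blast
    then have "d = p *s e a + q *s e b + r *s e c" by (simp add: algebra_simps)
    then have "d \<in> center_span" using e_in_center_span subspace_center_span
      by (simp add: vec.subspace_add vec.subspace_scale)
    then show False using d by blast
  qed
  then obtain p q r where pqr: "w = p *s image_line c (e a) (e b) + q *s image_line c (e a) d + r *s image_line c (e b) d"
    by (rule double_cross_span[where z = w]) (rule that)
  have AB: "image_line c (e a) d = - A" "image_line c (e b) d = - B"
    unfolding A_def B_def by (rule cross_commute)+
  show ?thesis
  proof (rule bexI, intro conjI)
    show "(p / lc) *s uC + (- q) *s uA + (- r) *s uB \<in> T x"
      using uA(1) uB(1) uC(1) subspace_T by (intro vec.subspace_scale vec.subspace_add)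
    show "block ((p / lc) *s uC + (- q) *s uA + (- r) *s uB) a = 0"
      "block ((p / lc) *s uC + (- q) *s uA + (- r) *s uB) b = 0"
      by (simp_all add: uA uB uC)
    show "block ((p / lc) *s uC + (- q) *s uA + (- r) *s uB) c = w"
      unfolding pqr AB using lc0 by (simp add: uA uB uC \<eta>_def)
  qed
qed

text \<open>Three cameras contribute three independent directions each, and each of the other cameras contributes its
  rescaling.\<close>

lemma dim_tangent_singular_pt:
  assumes x: "x \<in> multicone X" "proj x = singular_pt"
  shows "CARD('m) + 6 \<le> vec.dim (T x)"
proof -
  obtain b c :: 'm where bc: "undefined \<noteq> b" "undefined \<noteq> c" "b \<noteq> c" by (rule distinct_triple[of undefined])
  define a :: 'm where "a = undefined"
  have abc: "a \<noteq> b" "a \<noteq> c" "b \<noteq> c" using bc by (simp_all add: a_def)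
  define K where "K = {a, b, c}"
  have cK: "card K = 3" using abc by (simp add: K_def)
  have "\<exists>v. \<forall>k\<in>K. \<forall>w. v k w \<in> T x \<and> block (v k w) k = w \<and> (\<forall>l\<in>K. l \<noteq> k \<longrightarrow> block (v k w) l = 0)"
  proof -
    have "\<exists>v. v \<in> T x \<and> block v k = w \<and> (\<forall>l\<in>K. l \<noteq> k \<longrightarrow> block v l = 0)" if "k \<in> K" for k w
      using that one_camera_tangent[OF x, of a b c w] one_camera_tangent[OF x, of b c a w]
        one_camera_tangent[OF x, of c a b w] abc unfolding K_def by blast
    then have "\<forall>k w. \<exists>v. k \<in> K \<longrightarrow> v \<in> T x \<and> block v k = w \<and> (\<forall>l\<in>K. l \<noteq> k \<longrightarrow> block v l = 0)" by blast
    then show ?thesis by metis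
  qed
  then obtain v where v: "\<And>k w. k \<in> K \<Longrightarrow> v k w \<in> T x" "\<And>k w. k \<in> K \<Longrightarrow> block (v k w) k = w"
    "\<And>k l w. k \<in> K \<Longrightarrow> l \<in> K \<Longrightarrow> l \<noteq> k \<Longrightarrow> block (v k w) l = 0" by blast
  define g where "g = (\<lambda>j :: 'm + 'm \<times> 3. case j of
      Inl k \<Rightarrow> of_blocks (\<lambda>i. if i = k then block x k else 0) | Inr (k, j) \<Rightarrow> v k (axis j 1))"
  define J :: "('m + 'm \<times> 3) set" where "J = (UNIV - K) <+> (K \<times> UNIV)"
  have fJ: "finite J" by (simp add: J_def)
  have "card J \<le> vec.dim (T x)"
  proof (rule card_le_dim_independent_family[OF fJ subspace_T, where g = g])
    show "g j \<in> T x" if "j \<in> J" for j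
      using that v(1) scale_block_tangent[OF X_subset_multi_points x(1)] by (auto simp: J_def g_def)
    fix t assume 0: "(\<Sum>j\<in>J. t j *s g j) = 0"
    have sum: "(\<Sum>j\<in>J. t j *s g j) = (\<Sum>k\<in>UNIV - K. t (Inl k) *s g (Inl k))
        + (\<Sum>k\<in>K. \<Sum>j\<in>UNIV. t (Inr (k, j)) *s g (Inr (k, j)))"
      unfolding J_def by (subst sum.Plus) (simp_all add: sum.cartesian_product case_prod_unfold)
    have blk: "block (\<Sum>k\<in>UNIV - K. t (Inl k) *s g (Inl k)) i
        + block (\<Sum>k\<in>K. \<Sum>j\<in>UNIV. t (Inr (k, j)) *s g (Inr (k, j))) i = 0" for i
      unfolding block_simps(1)[symmetric] sum[symmetric] 0 by simp
    have l: "block (\<Sum>k\<in>UNIV - K. t (Inl k) *s g (Inl k)) i = (if i \<in> K then 0 else t (Inl i) *s block x i)" for i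
    proof -
      have "block (\<Sum>k\<in>UNIV - K. t (Inl k) *s g (Inl k)) i
          = (\<Sum>k\<in>UNIV - K. if k = i then t (Inl i) *s block x i else 0)"
        unfolding block_sum by (intro sum.cong) (auto simp: g_def)
      then show ?thesis by simp
    qed
    have tr: "t (Inr (i, j)) = 0" if i: "i \<in> K" for i j
    proof -
      have "block (\<Sum>k\<in>K. \<Sum>j\<in>UNIV. t (Inr (k, j)) *s g (Inr (k, j))) i
          = (\<Sum>k\<in>K. if k = i then (\<Sum>j\<in>UNIV. t (Inr (i, j)) *s axis j 1) else 0)"
        unfolding block_sum by (intro sum.cong) (use v(2,3) i in \<open>auto simp: g_def\<close>)
      also have "\<dots> = (\<Sum>j\<in>UNIV. t (Inr (i, j)) *s axis j 1)"
        using i by (simp add: K_def)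
      finally have "(\<Sum>j\<in>UNIV. t (Inr (i, j)) *s (axis j 1 :: complex^3)) = 0"
        using blk[of i] i by (simp add: l)
      then have "(\<Sum>k\<in>UNIV. t (Inr (i, k)) *s (axis k 1 :: complex^3)) $ j = 0" by simp
      then have "(\<Sum>k\<in>UNIV. if k = j then t (Inr (i, k)) else 0) = 0"
        by (simp add: axis_def if_distrib cong: if_cong)
      then show ?thesis by simp
    qed
    have "t (Inl i) = 0" if i: "i \<notin> K" for i
    proof -
      have "(\<Sum>k\<in>K. \<Sum>j\<in>UNIV. t (Inr (k, j)) *s g (Inr (k, j))) = 0"
        by (intro sum.neutral) (simp add: tr)
      then have "t (Inl i) *s block x i = 0" using blk[of i] i by (simp add: l)
      moreover have "block x i \<noteq> 0" using x(1) by (simp add: multicone_def nonzero_blocks_def)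
      ultimately show ?thesis by simp
    qed
    then show "\<forall>j\<in>J. t j = 0" using tr by (auto simp: J_def)
  qed
  moreover have "card J = CARD('m) + 6"
  proof -
    have "card K \<le> CARD('m)" by (rule card_mono) simp_all
    then show ?thesis unfolding J_def using cK
      by (simp add: card_Plus card_cartesian_product card_Diff_subset K_def)
  qed
  ultimately show ?thesis by simp
qed

end

context camera_arrangement
begin

lemma smooth_at_point:
  assumes "x \<in> multicone X" "minor a b y1 y2 x \<noteq> 0"
  shows "smooth_at X (proj x)"
  unfolding smooth_at_def
proof
  fix z assume z: "z \<in> homogeneous_coords (proj x)"
  have nzx: "nonzero_blocks x" using assms(1) by (simp add: multicone_def)
  have pX: "proj x \<in> X" using assms(1) by (simp add: multicone_def)
  note zc = homogeneous_coords_imp[OF proj_multi_points[OF nzx] z]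
  obtain c where c: "\<And>i. c i \<noteq> 0" "z = (\<chi> k. c (fst k) * x $ k)"
    by (rule proj_coords_scaling[OF nzx z]) (rule that)
  have "block z i = c i *s block x i" for i unfolding c(2) block_def by (simp add: vec_eq_iff)
  then have "minor a b y1 y2 z = c a * c b * minor a b y1 y2 x"
    by (simp add: minor_def plane_def algebra_simps)
  then have m: "minor a b y1 y2 z \<noteq> 0" using assms(2) c(1) by simp
  have zX: "z \<in> multicone X" using zc pX by (simp add: multicone_def)
  show "enat (vec.dim (T z)) = local_dim X (proj x) + enat CARD('m)"
    unfolding local_dim_X[OF pX] dim_tangent_eq[OF zX m] by (simp add: numeral_eq_enat)
qed

lemma noncoplanar_smooth:
  assumes "\<not> coplanar_cameras C"
  shows "smooth_variety X"
  unfolding smooth_variety_def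
proof
  fix p assume p: "p \<in> X"
  then obtain x where x: "nonzero_blocks x" "p = proj x" using X_subset_multi_points multi_points_coords by blast
  then have xX: "x \<in> multicone X" using p by (simp add: multicone_def)
  then obtain a b y1 y2 where "minor a b y1 y2 x \<noteq> 0" using rank_one_coplanar assms by blast
  then show "smooth_at X p" unfolding x(2) by (rule smooth_at_point[OF xX])
qed

lemma coplanar_singular:
  assumes "coplanar_cameras C"
  shows "\<exists>s. singular_points X = {s} \<and>
    joint_camera_map C ` {L \<in> camera_domain C. L \<subseteq> vec.span (\<Union>i. center (C i))} = {s}"
proof -
  interpret coplanar_arrangement C e using assms by unfold_locales
  have "singular_points X = {singular_pt}"
  proof (intro equalityI subsetI)
    fix p assume p: "p \<in> singular_points X"
    then have pX: "p \<in> X" "\<not> smooth_at X p" by (auto simp: singular_points_def)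
    then obtain x where x: "nonzero_blocks x" "p = proj x" using X_subset_multi_points multi_points_coords by blast
    have xX: "x \<in> multicone X" using pX x by (simp add: multicone_def)
    have "minor a b y1 y2 x = 0" for a b y1 y2
      using smooth_at_point[OF xX, of a b y1 y2] pX(2) x(2) by blast
    then show "p \<in> {singular_pt}" using rank_one_is_singular_pt[OF xX] x(2) by simp
  next
    fix p assume "p \<in> {singular_pt}"
    then have p: "p = singular_pt" by simp
    have "singular_pt \<in> multi_points" using singular_pt_in_X X_subset_multi_points by blast
    then obtain x where x: "nonzero_blocks x" "singular_pt = proj x" by (rule multi_points_coords)
    have xX: "x \<in> multicone X" using singular_pt_in_X x by (simp add: multicone_def)
    have "\<not> smooth_at X singular_pt"
    proof
      assume "smooth_at X singular_pt"
      moreover have "x \<in> homogeneous_coords singular_pt" unfolding x(2) by (rule homogeneous_coords_proj[OF x(1)])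
      ultimately have "enat (vec.dim (T x)) = 4 + enat CARD('m)"
        unfolding smooth_at_def local_dim_X[OF singular_pt_in_X] by blast
      then have "vec.dim (T x) = 4 + CARD('m)" by (simp add: numeral_eq_enat)
      then show False using dim_tangent_singular_pt[OF xX x(2)[symmetric]] by simp
    qed
    then show "p \<in> singular_points X" using singular_pt_in_X p by (simp add: singular_points_def)
  qed
  then show ?thesis using image_of_plane_lines unfolding center_span_def by blast
qed

end

lemma camera_arrangement_exists:
  fixes C :: "'m::finite \<Rightarrow> complex^4^3"
  assumes card: "CARD('m) \<ge> 3" and pin: "\<And>i. pinhole_camera (C i)"
    and inj: "inj (\<lambda>i. center (C i))"
    and nc: "\<And>i j k. i \<noteq> j \<Longrightarrow> i \<noteq> k \<Longrightarrow> j \<noteq> k \<Longrightarrow>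
           \<not> flat_collinear {center (C i), center (C j), center (C k)}"
  obtains e where "camera_arrangement C e"
proof -
  have "\<exists>e. e \<noteq> 0 \<and> (\<forall>z. C i *v z = 0 \<longleftrightarrow> (\<exists>c. z = c *s e)) \<and> (\<forall>w. \<exists>z. C i *v z = w) \<and>
      center (C i) = vec.span {e}" for i
    by (rule pinhole_camera_kernel[OF pin[of i]]) blast
  then obtain e where e: "\<And>i. e i \<noteq> 0" "\<And>i z. C i *v z = 0 \<longleftrightarrow> (\<exists>c. z = c *s e i)"
    "\<And>i w. \<exists>z. C i *v z = w" "\<And>i. center (C i) = vec.span {e i}" by metis
  have two: "e i \<notin> vec.span {e j}" if "i \<noteq> j" for i j
  proof
    assume "e i \<in> vec.span {e j}"
    then have "vec.span {e j} = vec.span {e i}"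
      by (rule proj_point_eq_span[OF span_singleton_in_proj_points[OF e(1)] _ e(1)])
    then have "center (C j) = center (C i)" by (simp add: e(4))
    then have "j = i" by (rule injD[OF inj])
    then show False using that by simp
  qed
  have line: "vec.span {e i, e j} \<in> proj_lines" if "i \<noteq> j" for i j
  proof -
    have "e i \<noteq> e j" using two[OF that] vec.span_base[of "e j" "{e j}"] by auto
    then have "vec.independent {e i, e j}" "card {e i, e j} = 2"
      using two[OF that] e(1) by (simp_all add: vec.independent_insert)
    then show ?thesis by (simp add: proj_flats_def vec.subspace_span vec.dim_eq_card_independent)
  qed
  have not_in: "e k \<notin> vec.span {e i, e j}" if "i \<noteq> j" "i \<noteq> k" "j \<noteq> k" for i j k
  proof
    assume k: "e k \<in> vec.span {e i, e j}"
    have "vec.span {v} \<subseteq> vec.span {e i, e j}" if "v \<in> vec.span {e i, e j}" for v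
      using that by (intro vec.span_minimal vec.subspace_span) auto
    then have "\<forall>p\<in>{center (C i), center (C j), center (C k)}. p \<subseteq> vec.span {e i, e j}"
      using k by (simp add: e(4) vec.span_base)
    then have "flat_collinear {center (C i), center (C j), center (C k)}"
      unfolding flat_collinear_def using line[OF that(1)] by blast
    then show False using nc[OF that] by blast
  qed
  have coeff: "r = 0" if ijk: "i \<noteq> j" "i \<noteq> k" "j \<noteq> k" and 0: "p *s e i + q *s e j + r *s e k = 0" for i j k p q r
  proof (rule ccontr)
    assume r: "r \<noteq> 0"
    then have "e k = (- p / r) *s e i + (- q / r) *s e j"
    proof -
      have "r *s e k = (- p) *s e i + (- q) *s e j" using 0 by (simp add: eq_neg_iff_add_eq_0 algebra_simps)
      then have "(1 / r) *s (r *s e k) = (1 / r) *s ((- p) *s e i + (- q) *s e j)" by simp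
      then show ?thesis using r by (simp add: vec.scale_right_distrib)
    qed
    moreover have "(- p / r) *s e i + (- q / r) *s e j \<in> vec.span {e i, e j}"
      by (intro vec.span_add vec.span_scale vec.span_base) auto
    ultimately show False using not_in[OF ijk] by simp
  qed
  have "camera_arrangement C e"
  proof
    fix i j k p q r
    assume ijk: "i \<noteq> j" "i \<noteq> k" "j \<noteq> k" and 0: "p *s e i + q *s e j + r *s e k = 0"
    have "r = 0" by (rule coeff[OF ijk 0])
    moreover have "q = 0" by (rule coeff[of i k j p r q]) (use ijk 0 in \<open>auto simp: algebra_simps\<close>)
    moreover have "p = 0" by (rule coeff[of j k i q r p]) (use ijk 0 in \<open>auto simp: algebra_simps\<close>)
    ultimately show "p = 0 \<and> q = 0 \<and> r = 0" by blast
  qed (use e card in auto)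
  then show ?thesis by (rule that)
qed

theorem corollary3p2:
  fixes C :: "'m::finite \<Rightarrow> complex^4^3"
  assumes "CARD('m) \<ge> 3"
    and "\<And>i. pinhole_camera (C i)"
    and "inj (\<lambda>i. center (C i))"
    and "\<And>i j k. i \<noteq> j \<Longrightarrow> i \<noteq> k \<Longrightarrow> j \<noteq> k \<Longrightarrow>
           \<not> flat_collinear {center (C i), center (C j), center (C k)}"
  shows "(CARD('m) \<ge> 4 \<and> \<not> coplanar_cameras C \<longrightarrow>
            smooth_variety (line_multiview_variety C)) \<and>
         (coplanar_cameras C \<longrightarrow>
            (\<exists>s. singular_points (line_multiview_variety C) = {s} \<and>
              joint_camera_map C `
                {L \<in> camera_domain C. L \<subseteq> vec.span (\<Union>i. center (C i))} = {s}))"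
proof -
  obtain e where "camera_arrangement C e" by (rule camera_arrangement_exists[OF assms])
  then interpret camera_arrangement C e .
  show ?thesis using noncoplanar_smooth coplanar_singular by blast
qed

end
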